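(* There exist absolute constants $A, C, c, c_1 > 0$ such that the following holds. Let $N\ge 1$ be an integer, let $\mathbb{T}$ be a probability space, and let $\Phi = \{\phi_n\}_{n=1}^N$ be an orthonormal system of functions from $\mathbb{T}$ to $\mathbb{R}$ such that $\sum_{n=1}^N |\phi_n(x)|^2 \le N$ holds pointwise. Then there exists a measurable set $Q \subset \mathcal{O}(N)$ with $\mathbb{P}[Q] \ge 1 - C e^{-c_1N^{2/5}}$ such that for every $O \in Q$ the orthonormal system $\Phi(O) = \{\psi_n\}_{n=1}^N$ has the following property. For any $f = \sum_{n=1}^N a_n \psi_n$ with $a_n \in \mathbb{R}$, letting $m$ denote the number of nonzero $a_n$, the function $f$ can be decomposed as $f = G + E$ where $$\|G\|_{\mathcal{G}} \le A \|f\|_{L^2} \quad\text{and}\quad \|E\|_{L^2} \le A \left(\frac{m}{N}\right)^{c} \|f\|_{L^2}.$$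
   Context: Orthonormal is with respect to $L^2(\mathbb{T})$. $\mathcal{O}(N)$ is the group of $N\times N$ real orthogonal matrices and $\mathbb{P}[Q]$ denotes the normalized Haar measure of a measurable $Q\subset\mathcal{O}(N)$. For $O = (o_{i,n})_{1\le i,n\le N} \in \mathcal{O}(N)$, the system $\Phi(O) = \{\psi_n\}_{n=1}^N$ is defined by $\psi_n(x) := \sum_{i=1}^{N} o_{i,n}\phi_i(x)$. The norm $\|\cdot\|_{\mathcal{G}}$ is the Orlicz norm associated with $e^{x^2}-1$: $\|g\|_{\mathcal{G}} := \inf\{\lambda>0 : \int_{\mathbb{T}} (e^{|g/\lambda|^2}-1) \le 1\}$. *)

theory Defs
  imports "HOL-Probability.Probability" "Jordan_Normal_Form.Matrix"
begin

text \<open>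
  The orthogonal group \<open>O(N)\<close>, with matrix indices running over \<open>0, \<dots>, N - 1\<close>. (The library predicate
  \<open>orthogonal_mat\<close> only asks for pairwise orthogonal nonzero columns, so it is not used here.)
\<close>

definition orthogonal_group :: "nat \<Rightarrow> real mat set" where
  "orthogonal_group N = {U \<in> carrier_mat N N. transpose_mat U * U = 1\<^sub>m N}"

text \<open>
  The type of matrices of arbitrary dimension carries no topology. The Borel sets of \<open>O(N)\<close>, as a
  subspace of the Euclidean space of dimension \<open>N\<^sup>2\<close>, form the sigma-algebra generated by the entry
  maps. The measure component of \<open>orthogonal_borel\<close> is irrelevant.
\<close>

definition orthogonal_borel :: "nat \<Rightarrow> real mat measure" where
  "orthogonal_borel N =
     vimage_algebra (orthogonal_group N)
       (\<lambda>U. \<lambda>p \<in> {..<N} \<times> {..<N}. U $$ p)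
       (PiM ({..<N} \<times> {..<N}) (\<lambda>_. borel))"

text \<open>
  Being a compact metrizable group, \<open>O(N)\<close> has exactly one left-invariant Borel probability measure
  (regularity is automatic): its normalized Haar measure.
\<close>

definition normalized_haar :: "nat \<Rightarrow> real mat measure \<Rightarrow> bool" where
  "normalized_haar N \<mu> \<longleftrightarrow>
     prob_space \<mu> \<and> sets \<mu> = sets (orthogonal_borel N) \<and>
     (\<forall>R \<in> orthogonal_group N. distr \<mu> \<mu> (\<lambda>U. R * U) = \<mu>)"

definition L2_functions :: "'a measure \<Rightarrow> ('a \<Rightarrow> real) set" where
  "L2_functions M = {g \<in> borel_measurable M. integrable M (\<lambda>x. \<bar>g x\<bar>\<^sup>2)}"

definition norm_L2 :: "'a measure \<Rightarrow> ('a \<Rightarrow> real) \<Rightarrow> real" where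
  "norm_L2 M g = sqrt (\<integral>x. \<bar>g x\<bar>\<^sup>2 \<partial>M)"

text \<open>
  Values in \<^typ>\<open>ennreal\<close>, so that the infimum over the empty set is infinite.
\<close>

definition norm_Orlicz :: "'a measure \<Rightarrow> ('a \<Rightarrow> real) \<Rightarrow> ennreal" where
  "norm_Orlicz M g =
     Inf {ennreal l | l. l > 0 \<and> (\<integral>\<^sup>+x. ennreal (exp (\<bar>g x / l\<bar>\<^sup>2) - 1) \<partial>M) \<le> 1}"

definition orthonormal_system :: "'a measure \<Rightarrow> nat \<Rightarrow> (nat \<Rightarrow> 'a \<Rightarrow> real) \<Rightarrow> bool" where
  "orthonormal_system M N \<phi> \<longleftrightarrow>
     (\<forall>n<N. \<phi> n \<in> L2_functions M) \<and>
     (\<forall>i<N. \<forall>j<N. (\<integral>x. \<phi> i x * \<phi> j x \<partial>M) = (if i = j then 1 else 0))"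

definition rotated_system :: "nat \<Rightarrow> real mat \<Rightarrow> (nat \<Rightarrow> 'a \<Rightarrow> real) \<Rightarrow> nat \<Rightarrow> 'a \<Rightarrow> real" where
  "rotated_system N U \<phi> n x = (\<Sum>i<N. U $$ (i, n) * \<phi> i x)"

text \<open>
  The property of the individual system \<open>\<psi>\<close>. As \<open>c > 0\<close> in its use, the convention \<open>0 powr c = 0\<close>
  is the right one for \<open>m = 0\<close>.
\<close>

definition decomposition_property ::
  "real \<Rightarrow> real \<Rightarrow> 'a measure \<Rightarrow> nat \<Rightarrow> (nat \<Rightarrow> 'a \<Rightarrow> real) \<Rightarrow> bool" where
  "decomposition_property A c M N \<psi> \<longleftrightarrow>
     (\<forall>a :: nat \<Rightarrow> real.
        let f = (\<lambda>x. \<Sum>n<N. a n * \<psi> n x);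
            m = card {n. n < N \<and> a n \<noteq> 0}
        in \<exists>G E. G \<in> borel_measurable M \<and> E \<in> L2_functions M \<and>
             (\<forall>x \<in> space M. f x = G x + E x) \<and>
             norm_Orlicz M G \<le> ennreal (A * norm_L2 M f) \<and>
             norm_L2 M E \<le> A * (real m / real N) powr c * norm_L2 M f)"

text \<open>
  The assertion of the theorem for given constants and for all probability spaces on the type \<open>'a\<close>.
  The type argument makes it possible to compare the constants that work for different types.
\<close>

definition admissible_constants :: "'a itself \<Rightarrow> real \<Rightarrow> real \<Rightarrow> real \<Rightarrow> real \<Rightarrow> bool" where
  "admissible_constants _ A C c c\<^sub>1 \<longleftrightarrow>
     (\<forall>N \<ge> 1. \<forall>\<mu> (T :: 'a measure) (\<phi> :: nat \<Rightarrow> 'a \<Rightarrow> real).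
        normalized_haar N \<mu> \<longrightarrow> prob_space T \<longrightarrow> orthonormal_system T N \<phi> \<longrightarrow>
        (\<forall>x \<in> space T. (\<Sum>n<N. \<bar>\<phi> n x\<bar>\<^sup>2) \<le> real N) \<longrightarrow>
        (\<exists>Q \<in> sets \<mu>.
           measure \<mu> Q \<ge> 1 - C * exp (- c\<^sub>1 * real N powr (2 / 5)) \<and>
           (\<forall>U \<in> Q. orthonormal_system T N (rotated_system N U \<phi>) \<and>
                     decomposition_property A c T N (rotated_system N U \<phi>))))"

text \<open>
  On absolute constants: a statement of the form ``there are constants that are admissible for
  \<open>'a\<close>'' would let the constants depend on the type \<open>'a\<close>, since types cannot be quantified inside a
  formula. The theorem therefore states that admissible constants exist for the one fixed type
  \<^typ>\<open>nat \<Rightarrow> real\<close>, and that all such constants are admissible for every type \<open>'a\<close>. The choice of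
  \<^typ>\<open>nat \<Rightarrow> real\<close> is harmless: the values of \<open>\<phi>\<close> transport \<open>T\<close> to a measure on this type.
\<close>

end

theory Submission
  imports Defs "Jordan_Normal_Form.Determinant" "HOL-Real_Asymp.Real_Asymp"
begin

text \<open>
  Put \<open>b = U a\<close> for the unit coefficient vector \<open>a\<close>, so that \<open>f\<close> is the linear combination \<open>f\<^sub>b\<close> of
  the \<open>\<phi>\<^sub>i\<close> with coefficients \<open>b\<close>, and let \<open>F(b)\<close> (called \<open>energy\<close> below) be the integral of \<open>H(f\<^sub>b\<^sup>2 / 12)\<close>, where \<open>H\<close> is
  \<open>exp - 1\<close> up to \<open>\<Lambda>\<close> and continues along its tangent. If \<open>F(b) \<le> 1\<close>, then truncating \<open>f\<close> at height
  \<open>sqrt (12 \<Lambda>)\<close> gives \<open>G\<close>, and the remainder \<open>E\<close> has norm of order \<open>exp (- \<Lambda> / 2)\<close>. Choosing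
  \<open>exp \<Lambda> = (N / m) powr (1 / 10)\<close>, it suffices to show that with high probability \<open>F(U a) \<le> 1\<close> for all
  unit vectors \<open>a\<close> with at most \<open>m\<close> nonzero entries, where \<open>m\<close> is at most a small multiple of \<open>N\<close>;
  for larger \<open>m\<close> the choice \<open>E = f\<close> is good enough.

  The functional \<open>F\<close> is convex, and by Bessel's inequality its subgradients on the unit sphere have
  length at most \<open>exp \<Lambda>\<close>. It therefore concentrates by the argument of Maurey and Pisier, carried out
  on the sphere: a quarter turn from the first to the second column of \<open>U\<close> passes through orthonormal
  pairs, all of which have the same distribution since \<open>\<mu>\<close> is right invariant. By the same
  invariance the second column may be replaced by a normalized sum, with independent random signs, of
  all columns but the first. This makes its inner products with functions of the first column
  subgaussian, and it bounds the conditional mean of \<open>F\<close> at the second column. A union bound over a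
  lattice of sparse vectors concludes.
\<close>

subsection \<open>Averages over random signs\<close>

text \<open>The Taylor series are compared term by term, by means of
  \<open>2 ^ n * fact n \<le> fact (2 * n)\<close>.\<close>

lemma cosh_le_exp_half_square: "cosh (x::real) \<le> exp (x\<^sup>2 / 2)"
proof -
  have s: "(\<lambda>n. if even n then x ^ n /\<^sub>R fact n else 0) sums cosh x" by (rule cosh_converges)
  have "strict_mono (\<lambda>n::nat. 2 * n)" by (simp add: strict_mono_def)
  then have "(\<lambda>n. (if even (2*n) then x ^ (2*n) /\<^sub>R fact (2*n) else 0)) sums cosh x"
    by (subst sums_mono_reindex[of "\<lambda>n. 2*n"]) (use s in \<open>auto simp: image_iff elim!: evenE\<close>)
  then have 1: "(\<lambda>n. x ^ (2*n) / fact (2*n)) sums cosh x"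
    by (simp add: field_simps)
  have 2: "(\<lambda>n. (x\<^sup>2 / 2) ^ n / fact n) sums exp (x\<^sup>2 / 2)"
    using exp_converges[of "x\<^sup>2/2"] by (simp add: field_simps)
  have f: "(2::real) ^ n * fact n \<le> fact (2 * n)" for n
  proof (induction n)
    case (Suc n)
    have "(2::real) ^ Suc n * fact (Suc n) = 2 * (1 + real n) * (2 ^ n * fact n)" by simp
    also have "\<dots> \<le> (2 * (1 + real n) * (2 * real n + 1)) * fact (2 * n)"
      by (intro mult_mono Suc) auto
    also have "\<dots> = fact (2 * Suc n)" by (simp add: algebra_simps)
    finally show ?case .
  qed simp
  show ?thesis
  proof (rule sums_le[OF _ 1 2])
    fix n
    have "x ^ (2*n) / fact (2*n) \<le> x ^ (2*n) / (2 ^ n * fact n)"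
      by (intro divide_left_mono f) auto
    also have "\<dots> = (x\<^sup>2 / 2) ^ n / fact n" by (simp add: power_mult power_divide)
    finally show "x ^ (2*n) / fact (2*n) \<le> (x\<^sup>2 / 2) ^ n / fact n" .
  qed
qed

text \<open>Extensional functions keep the set of sign patterns finite.\<close>

definition signs :: "nat set \<Rightarrow> (nat \<Rightarrow> real) set" where
  "signs J = J \<rightarrow>\<^sub>E {-1, 1}"

text \<open>The expectation over independent fair signs. As a finite sum it commutes with integrals
  by linearity, without a second probability space.\<close>

definition sign_avg :: "nat set \<Rightarrow> ((nat \<Rightarrow> real) \<Rightarrow> real) \<Rightarrow> real" where
  "sign_avg J g = (\<Sum>e\<in>signs J. g e) / 2 ^ card J"

lemma finite_signs [simp]: "finite J \<Longrightarrow> finite (signs J)"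
  by (auto simp: signs_def intro!: finite_PiE)

lemma card_signs: "finite J \<Longrightarrow> card (signs J) = 2 ^ card J"
  by (simp add: signs_def card_PiE numeral_2_eq_2)

lemma sign_avg_mono: "(\<And>e. e \<in> signs J \<Longrightarrow> f e \<le> g e) \<Longrightarrow> sign_avg J f \<le> sign_avg J g"
  by (simp add: sign_avg_def divide_right_mono sum_mono)

lemma sign_avg_const: "finite J \<Longrightarrow> sign_avg J (\<lambda>_. c) = c"
  by (simp add: sign_avg_def card_signs)

lemma sign_avg_cmult: "sign_avg J (\<lambda>e. c * g e) = c * sign_avg J g"
  by (simp add: sign_avg_def sum_distrib_left)

lemma sign_avg_diff: "sign_avg J (\<lambda>e. f e - g e) = sign_avg J f - sign_avg J g"
  by (simp add: sign_avg_def sum_subtractf diff_divide_distrib)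

text \<open>Conditioning on the single sign \<open>e j\<close>; this is the recursion behind both
  moment bounds below.\<close>

lemma sign_avg_insert:
  assumes "finite J" "j \<notin> J"
  shows "sign_avg (insert j J) g = sign_avg J (\<lambda>e. (g (e(j := 1)) + g (e(j := -1))) / 2)"
proof -
  have "signs (insert j J) = (\<lambda>(y, e). e(j := y)) ` ({-1, 1} \<times> signs J)"
    unfolding signs_def PiE_insert_eq ..
  moreover have "inj_on (\<lambda>(y, e). e(j := y)) ({-1, 1} \<times> signs J)"
    unfolding signs_def using assms inj_combinator[of j J "\<lambda>_. {-1, 1::real}"] by simp
  ultimately have "(\<Sum>e\<in>signs (insert j J). g e) = (\<Sum>(y, e)\<in>{-1, 1} \<times> signs J. g (e(j := y)))"
    by (simp add: sum.reindex case_prod_unfold)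
  also have "\<dots> = (\<Sum>e\<in>signs J. g (e(j := 1)) + g (e(j := -1)))"
    by (subst sum.cartesian_product[symmetric]) (simp add: sum.distrib)
  finally show ?thesis
    using assms by (simp add: sign_avg_def sum_divide_distrib field_simps)
qed

lemma sign_sum_fun_upd:
  assumes "finite J" "j \<notin> J"
  shows "(\<Sum>i\<in>insert j J. (e(j := y)) i * c i) = y * c j + (\<Sum>i\<in>J. e i * (c i :: real))"
proof -
  have "(\<Sum>i\<in>J. (e(j := y)) i * c i) = (\<Sum>i\<in>J. e i * c i)"
    using assms by (intro sum.cong) auto
  then show ?thesis using assms by simp
qed

text \<open>By independence the average is the product of the values \<open>cosh (c j)\<close>, each
  at most \<open>exp ((c j)\<^sup>2 / 2)\<close>.\<close>

lemma sign_avg_exp: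
  assumes "finite J"
  shows "sign_avg J (\<lambda>e. exp (\<Sum>j\<in>J. e j * c j)) \<le> exp ((\<Sum>j\<in>J. (c j)\<^sup>2) / 2)"
  using assms
proof (induction J rule: finite_induct)
  case empty
  then show ?case by (simp add: sign_avg_def signs_def)
next
  case (insert j J)
  have "sign_avg (insert j J) (\<lambda>e. exp (\<Sum>j\<in>insert j J. e j * c j)) =
      sign_avg J (\<lambda>e. cosh (c j) * exp (\<Sum>j\<in>J. e j * c j))"
    unfolding sign_avg_insert[OF insert.hyps] sign_sum_fun_upd[OF insert.hyps]
    by (intro arg_cong[where f="sign_avg J"] ext) (simp only: mult_1 mult_minus1 exp_add cosh_field_def, simp add: algebra_simps)
  also have "\<dots> \<le> exp ((c j)\<^sup>2 / 2) * exp ((\<Sum>j\<in>J. (c j)\<^sup>2) / 2)"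
    unfolding sign_avg_cmult
    by (intro mult_mono cosh_le_exp_half_square insert.IH)
       (auto simp: sign_avg_def intro!: divide_nonneg_nonneg sum_nonneg)
  also have "\<dots> = exp ((\<Sum>j\<in>insert j J. (c j)\<^sup>2) / 2)"
    using insert.hyps by (simp add: exp_add[symmetric] add_divide_distrib)
  finally show ?case .
qed

text \<open>The shift \<open>s\<close> makes the induction on the number of signs possible.\<close>

lemma sign_avg_exp_square:
  assumes "finite J" and "2 * (\<Sum>j\<in>J. (c j)\<^sup>2) < K"
  shows "sign_avg J (\<lambda>e. exp ((s + (\<Sum>j\<in>J. e j * c j))\<^sup>2 / K))
         \<le> exp ((s\<^sup>2 + (\<Sum>j\<in>J. (c j)\<^sup>2)) / (K - 2 * (\<Sum>j\<in>J. (c j)\<^sup>2)))"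
  using assms
proof (induction J arbitrary: s rule: finite_induct)
  case empty
  then show ?case by (simp add: sign_avg_def signs_def)
next
  case (insert j J)
  define S where "S = (\<Sum>j\<in>J. (c j)\<^sup>2)"
  define d where "d = c j"
  define K' where "K' = K - 2 * S"
  have S: "(\<Sum>j\<in>insert j J. (c j)\<^sup>2) = d\<^sup>2 + S" using insert.hyps by (simp add: S_def d_def)
  have K': "0 < K' - 2 * d\<^sup>2" using insert.prems unfolding S K'_def by simp
  then have K'0: "0 < K'" by (smt (verit) zero_le_power2)
  have KS: "2 * (\<Sum>j\<in>J. (c j)\<^sup>2) < K" using K'0 by (simp add: S_def K'_def)
  have "sign_avg (insert j J) (\<lambda>e. exp ((s + (\<Sum>j\<in>insert j J. e j * c j))\<^sup>2 / K)) =
      (sign_avg J (\<lambda>e. exp (((s + d) + (\<Sum>j\<in>J. e j * c j))\<^sup>2 / K)) +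
       sign_avg J (\<lambda>e. exp (((s - d) + (\<Sum>j\<in>J. e j * c j))\<^sup>2 / K))) / 2"
  proof -
    have "s + (1 * d + X) = (s + d) + X" "s + (- 1 * d + X) = (s - d) + X" for X :: real by simp_all
    then show ?thesis
      unfolding sign_avg_insert[OF insert.hyps] sign_sum_fun_upd[OF insert.hyps] d_def[symmetric]
      by (simp only:) (simp add: sign_avg_def sum.distrib sum_divide_distrib[symmetric] add_divide_distrib)
  qed
  also have "\<dots> \<le> (exp (((s + d)\<^sup>2 + S) / K') + exp (((s - d)\<^sup>2 + S) / K')) / 2"
    using insert.IH[OF KS, of "s + d"] insert.IH[OF KS, of "s - d"] unfolding S_def[symmetric] K'_def[symmetric]
    by simp
  also have "\<dots> = exp ((s\<^sup>2 + d\<^sup>2 + S) / K') * cosh (2 * s * d / K')"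
  proof -
    have "((s + d)\<^sup>2 + S) / K' = (s\<^sup>2 + d\<^sup>2 + S) / K' + 2 * s * d / K'"
      "((s - d)\<^sup>2 + S) / K' = (s\<^sup>2 + d\<^sup>2 + S) / K' - 2 * s * d / K'"
      by (simp_all add: power2_sum power2_diff add_divide_distrib diff_divide_distrib)
    then show ?thesis
      by (simp only: exp_add exp_diff cosh_field_def exp_minus) (simp add: field_simps)
  qed
  also have "\<dots> \<le> exp ((s\<^sup>2 + d\<^sup>2 + S) / K') * exp ((2 * s * d / K')\<^sup>2 / 2)"
    by (intro mult_left_mono cosh_le_exp_half_square) simp
  also have "\<dots> = exp ((s\<^sup>2 + d\<^sup>2 + S) / K' + (2 * s * d / K')\<^sup>2 / 2)"
    by (simp add: exp_add)
  \<comment> \<open>The bound for \<open>cosh\<close> costs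
    \<open>2 * s\<^sup>2 * d\<^sup>2 / K'\<^sup>2\<close> in the exponent. Lowering the denominator
    from \<open>K'\<close> to \<open>K' - 2 * d\<^sup>2\<close> absorbs this, which is why twice the
    sum of squares is subtracted from \<open>K\<close> in the statement.\<close>
  also have "\<dots> \<le> exp ((s\<^sup>2 + (d\<^sup>2 + S)) / (K' - 2 * d\<^sup>2))"
  proof -
    have "0 \<le> S" by (simp add: S_def sum_nonneg)
    have "1 / K' + 2 * d\<^sup>2 / K'\<^sup>2 \<le> 1 / (K' - 2 * d\<^sup>2)"
    proof -
      have "(1 / K' + 2 * d\<^sup>2 / K'\<^sup>2) * (K' - 2 * d\<^sup>2) = 1 - (2 * d\<^sup>2 / K')\<^sup>2"
        using K'0 by (simp add: field_simps power2_eq_square)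
      also have "\<dots> \<le> 1" by simp
      finally show ?thesis using K' by (simp add: pos_le_divide_eq)
    qed
    then have "s\<^sup>2 * (1 / K' + 2 * d\<^sup>2 / K'\<^sup>2) \<le> s\<^sup>2 * (1 / (K' - 2 * d\<^sup>2))"
      by (intro mult_left_mono) auto
    moreover have "(d\<^sup>2 + S) / K' \<le> (d\<^sup>2 + S) / (K' - 2 * d\<^sup>2)"
      using K' K'0 \<open>0 \<le> S\<close> by (intro divide_left_mono) auto
    moreover have "(2 * s * d / K')\<^sup>2 / 2 = s\<^sup>2 * (2 * d\<^sup>2 / K'\<^sup>2)"
      by (simp add: power2_eq_square)
    ultimately show ?thesis by (simp add: add_divide_distrib distrib_left mult_ac)
  qed
  finally show ?case unfolding S K'_def by (simp add: algebra_simps)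
qed

text \<open>Jensen's inequality with uniform weights, applied below both to averages over signs and
  to the steps of a quarter turn.\<close>

lemma exp_mean_le:
  assumes "finite I" "I \<noteq> {}"
  shows "exp ((\<Sum>i\<in>I. g i) / real (card I)) \<le> (\<Sum>i\<in>I. exp (g i)) / real (card I)"
proof -
  have c: "real (card I) > 0" using assms by (simp add: card_gt_0_iff)
  have "exp (\<Sum>i\<in>I. (1 / real (card I)) *\<^sub>R g i) \<le> (\<Sum>i\<in>I. (1 / real (card I)) * exp (g i))"
    by (rule convex_on_sum[OF assms exp_convex]) (use c in auto)
  then show ?thesis by (simp add: sum_divide_distrib)
qed

lemma exp_sign_avg_le:
  assumes "finite J"
  shows "exp (sign_avg J g) \<le> sign_avg J (\<lambda>e. exp (g e))"
proof -
  have "signs J \<noteq> {}" using card_signs[OF assms] by (metis card.empty power_not_zero zero_neq_numeral)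
  then show ?thesis
    using exp_mean_le[of "signs J" g] assms by (simp add: sign_avg_def card_signs)
qed

subsection \<open>Haar measure on the orthogonal group\<close>

lemma orthogonal_groupD:
  assumes "U \<in> orthogonal_group N"
  shows "U \<in> carrier_mat N N" "transpose_mat U * U = 1\<^sub>m N" "U * transpose_mat U = 1\<^sub>m N"
  using assms mat_mult_left_right_inverse[of "transpose_mat U" N U] by (auto simp: orthogonal_group_def)

lemma orthogonal_group_transpose:
  assumes "U \<in> orthogonal_group N"
  shows "transpose_mat U \<in> orthogonal_group N"
  using orthogonal_groupD[OF assms] by (auto simp: orthogonal_group_def)

lemma orthogonal_group_mult:
  assumes "U \<in> orthogonal_group N" "V \<in> orthogonal_group N"
  shows "U * V \<in> orthogonal_group N"
proof -
  note U = orthogonal_groupD[OF assms(1)] and V = orthogonal_groupD[OF assms(2)]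
  have "transpose_mat (U * V) * (U * V) = transpose_mat V * (transpose_mat U * (U * V))"
    using U V by (simp add: transpose_mult[of _ N N _ N] assoc_mult_mat[of _ N N _ N _ N])
  also have "transpose_mat U * (U * V) = (transpose_mat U * U) * V"
    by (rule assoc_mult_mat[symmetric, of _ N N _ N _ N]) (use U V in auto)
  also have "transpose_mat V * ((transpose_mat U * U) * V) = 1\<^sub>m N"
    using U V by simp
  finally show ?thesis using U V by (simp add: orthogonal_group_def)
qed

lemma orthogonal_scalar_prod:
  assumes "U \<in> orthogonal_group N" "a \<in> carrier_vec N" "b \<in> carrier_vec N"
  shows "scalar_prod (U *\<^sub>v a) (U *\<^sub>v b) = scalar_prod a b"
proof -
  note U = orthogonal_groupD[OF assms(1)]
  have "scalar_prod (transpose_mat U *\<^sub>v (U *\<^sub>v a)) b = scalar_prod (U *\<^sub>v a) (U *\<^sub>v b)"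
    using assms U by (intro transpose_vec_mult_scalar[of _ N N]) auto
  also have "transpose_mat U *\<^sub>v (U *\<^sub>v a) = (transpose_mat U * U) *\<^sub>v a"
    by (rule assoc_mult_mat_vec[symmetric, of _ N N _ N]) (use U assms in auto)
  finally show ?thesis using U assms by simp
qed

section \<open>Householder reflections and transitivity on orthonormal pairs\<close>

definition reflection :: "nat \<Rightarrow> real vec \<Rightarrow> real mat" where
  "reflection N w = mat N N (\<lambda>(i, j). (if i = j then 1 else 0) - 2 / scalar_prod w w * w $ i * w $ j)"

text \<open>The computation rests on \<open>c * c * scalar_prod w w = 2 * c\<close>. This also holds
  if \<open>scalar_prod w w = 0\<close>: division by zero then gives \<open>c = 0\<close>, and the
  reflection is the identity.\<close>

lemma reflection_orthogonal:
  assumes w: "w \<in> carrier_vec N"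
  shows "reflection N w \<in> orthogonal_group N"
proof -
  define c where "c = 2 / scalar_prod w w"
  have c: "c * c * scalar_prod w w = 2 * c" by (simp add: c_def)
  have t: "transpose_mat (reflection N w) = reflection N w"
    by (rule eq_matI) (auto simp: reflection_def)
  have "reflection N w * reflection N w = 1\<^sub>m N"
  proof (rule eq_matI)
    fix i j assume "i < dim_row (1\<^sub>m N :: real mat)" "j < dim_col (1\<^sub>m N :: real mat)"
    then have i: "i < N" and j: "j < N" by auto
    let ?d = "\<lambda>i j. if i = j then 1 else (0::real)"
    have "(reflection N w * reflection N w) $$ (i, j) =
      (\<Sum>k\<in>{0..<N}. (?d i k - c * w $ i * w $ k) * (?d k j - c * w $ k * w $ j))"
      using i j by (simp add: reflection_def c_def scalar_prod_def times_mat_def row_def col_def)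
    also have "\<dots> = (\<Sum>k\<in>{0..<N}. ?d i k * ?d k j - ?d i k * (c * w $ k * w $ j)
        - (c * w $ i * w $ k) * ?d k j + c * c * w $ i * w $ j * (w $ k * w $ k))"
      by (intro sum.cong refl) (simp add: algebra_simps)
    also have "\<dots> = ?d i j - c * w $ i * w $ j - c * w $ i * w $ j
        + c * c * w $ i * w $ j * (\<Sum>k\<in>{0..<N}. w $ k * w $ k)"
      using i j by (simp add: sum.distrib sum_subtractf sum_distrib_left if_distrib[of "\<lambda>x. x * _"] if_distrib[of "\<lambda>x. _ * x"] cong: if_cong)
    also have "(\<Sum>k\<in>{0..<N}. w $ k * w $ k) = scalar_prod w w"
      using w by (simp add: scalar_prod_def)
    also have "c * c * w $ i * w $ j * scalar_prod w w = c * c * scalar_prod w w * (w $ i * w $ j)"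
      by simp
    also have "\<dots> = 2 * c * (w $ i * w $ j)" unfolding c ..
    finally show "(reflection N w * reflection N w) $$ (i, j) = 1\<^sub>m N $$ (i, j)"
      using i j by simp
  qed (auto simp: reflection_def)
  then show ?thesis by (simp add: orthogonal_group_def t) (simp add: reflection_def)
qed

lemma reflection_mult_vec:
  assumes "w \<in> carrier_vec N" "a \<in> carrier_vec N"
  shows "reflection N w *\<^sub>v a = a - (2 * scalar_prod w a / scalar_prod w w) \<cdot>\<^sub>v w"
proof (rule eq_vecI)
  fix i assume "i < dim_vec (a - (2 * scalar_prod w a / scalar_prod w w) \<cdot>\<^sub>v w)"
  then have i: "i < N" using assms by simp
  have "(reflection N w *\<^sub>v a) $ i =
     (\<Sum>k\<in>{0..<N}. (if i = k then a $ k else 0) - 2 / scalar_prod w w * w $ i * (w $ k * a $ k))"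
    using i assms by (simp add: reflection_def scalar_prod_def row_def left_diff_distrib
        if_distrib[of "\<lambda>x. x * _"] mult.assoc cong: if_cong)
  also have "\<dots> = a $ i - 2 / scalar_prod w w * w $ i * scalar_prod w a"
    using i assms by (simp add: sum_subtractf sum_distrib_left scalar_prod_def)
  finally show "(reflection N w *\<^sub>v a) $ i = (a - (2 * scalar_prod w a / scalar_prod w w) \<cdot>\<^sub>v w) $ i"
    using i assms by simp
qed (use assms in \<open>auto simp: reflection_def\<close>)

lemma scalar_prod_self_eq_0:
  assumes "w \<in> carrier_vec N" "scalar_prod w w = (0::real)"
  shows "w = 0\<^sub>v N"
proof (rule eq_vecI)
  fix i assume "i < dim_vec (0\<^sub>v N :: real vec)"
  moreover have "\<forall>i\<in>{0..<N}. w $ i * w $ i = 0"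
    using assms by (subst sum_nonneg_eq_0_iff[symmetric]) (auto simp: scalar_prod_def)
  ultimately show "w $ i = 0\<^sub>v N $ i" by auto
qed (use assms in auto)

lemma minus_zero_smult_vec:
  assumes "w \<in> carrier_vec N" "a \<in> carrier_vec N"
  shows "a - 0 \<cdot>\<^sub>v w = (a :: real vec)"
  using assms by (auto intro!: eq_vecI)

text \<open>The reflection along \<open>p - q\<close> maps \<open>p\<close> to \<open>q\<close>
  because the two have equal length. It fixes every vector orthogonal to both, so that a second
  vector can later be moved without disturbing a first one.\<close>

lemma exists_orthogonal_map:
  assumes p: "p \<in> carrier_vec N" and q: "q \<in> carrier_vec N" and pq: "scalar_prod p p = scalar_prod q q"
  shows "\<exists>V\<in>orthogonal_group N. V *\<^sub>v p = q \<and>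
           (\<forall>r\<in>carrier_vec N. scalar_prod p r = 0 \<longrightarrow> scalar_prod q r = 0 \<longrightarrow> V *\<^sub>v r = r)"
proof -
  define w where "w = p - q"
  have w: "w \<in> carrier_vec N" using p q by (simp add: w_def)
  have wr: "scalar_prod w r = scalar_prod p r - scalar_prod q r" if "r \<in> carrier_vec N" for r
    using p q that by (simp add: w_def minus_scalar_prod_distrib)
  \<comment> \<open>Equal lengths make the coefficient
    \<open>2 * scalar_prod w p / scalar_prod w w\<close> in the reflection formula equal to 1,
    provided that \<open>w\<close> is not zero.\<close>
  have ww: "scalar_prod w w = 2 * scalar_prod w p"
    using p q pq wr[OF w] wr[OF p] by (simp add: w_def scalar_prod_minus_distrib comm_scalar_prod[of p N q])
  have "reflection N w *\<^sub>v p = q"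
  proof (cases "scalar_prod w w = 0")
    case True
    then have "w = 0\<^sub>v N" using scalar_prod_self_eq_0[OF w] by simp
    have "p = q"
    proof (rule eq_vecI)
      fix i assume "i < dim_vec q"
      then have "i < N" using q by simp
      then have "w $ i = 0" using \<open>w = 0\<^sub>v N\<close> by simp
      then show "p $ i = q $ i" using \<open>i < N\<close> p q by (simp add: w_def)
    qed (use p q in simp)
    then show ?thesis using True w p by (simp add: reflection_mult_vec minus_zero_smult_vec)
  next
    case False
    have "reflection N w *\<^sub>v p = p - 1 \<cdot>\<^sub>v w"
      using False ww by (simp add: reflection_mult_vec[OF w p])
    also have "\<dots> = q" using p q by (auto simp: w_def intro!: eq_vecI)
    finally show ?thesis .
  qed
  moreover have "reflection N w *\<^sub>v r = r" if "r \<in> carrier_vec N" "scalar_prod p r = 0" "scalar_prod q r = 0" for r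
    using that w by (simp add: reflection_mult_vec wr minus_zero_smult_vec)
  ultimately show ?thesis using reflection_orthogonal[OF w] by blast
qed

definition orthonormal_pair :: "nat \<Rightarrow> real vec \<Rightarrow> real vec \<Rightarrow> bool" where
  "orthonormal_pair N p q \<longleftrightarrow> p \<in> carrier_vec N \<and> q \<in> carrier_vec N \<and>
     scalar_prod p p = 1 \<and> scalar_prod q q = 1 \<and> scalar_prod p q = 0"

text \<open>First \<open>p\<close> is moved to \<open>q\<close>. The image \<open>r\<close> of
  \<open>p'\<close> is then orthogonal to \<open>q\<close>, as is \<open>q'\<close>, so the
  reflection taking \<open>r\<close> to \<open>q'\<close> leaves \<open>q\<close> in place.\<close>

lemma exists_orthogonal_map_pair:
  assumes p: "orthonormal_pair N p p'" and q: "orthonormal_pair N q q'"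
  shows "\<exists>V\<in>orthogonal_group N. V *\<^sub>v p = q \<and> V *\<^sub>v p' = q'"
proof -
  note p = p[unfolded orthonormal_pair_def] and q = q[unfolded orthonormal_pair_def]
  obtain V where V: "V \<in> orthogonal_group N" "V *\<^sub>v p = q"
    using exists_orthogonal_map[of p N q] p q by auto
  define r where "r = V *\<^sub>v p'"
  have r: "r \<in> carrier_vec N" using orthogonal_groupD[OF V(1)] p by (simp add: r_def)
  have "scalar_prod r r = 1" "scalar_prod q r = 0"
    using orthogonal_scalar_prod[OF V(1), of p' p'] orthogonal_scalar_prod[OF V(1), of p p'] p V
    by (auto simp: r_def)
  moreover have "scalar_prod r q = scalar_prod q r" "scalar_prod q' q = scalar_prod q q'"
    using r q comm_scalar_prod[of r N q] comm_scalar_prod[of q' N q] by auto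
  ultimately obtain W where W: "W \<in> orthogonal_group N" "W *\<^sub>v r = q'" "W *\<^sub>v q = q"
    using exists_orthogonal_map[of r N q'] q r by auto
  have "(W * V) *\<^sub>v p = q" "(W * V) *\<^sub>v p' = q'"
    using p V W orthogonal_groupD[OF V(1)] orthogonal_groupD[OF W(1)]
    by (auto simp: assoc_mult_mat_vec[of W N N V N] r_def)
  then show ?thesis using orthogonal_group_mult[OF W(1) V(1)] by blast
qed

section \<open>Invariance of Haar measure under transposition and right translation\<close>

locale haar =
  fixes N :: nat and \<mu> :: "real mat measure"
  assumes haar: "normalized_haar N \<mu>"
begin

sublocale prob_space \<mu>
  using haar by (simp add: normalized_haar_def)

lemma sets_haar: "sets \<mu> = sets (orthogonal_borel N)"
  using haar by (simp add: normalized_haar_def)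

lemma space_haar: "space \<mu> = orthogonal_group N"
  using sets_eq_imp_space_eq[OF sets_haar] by (simp add: orthogonal_borel_def)

lemma measurable_entry [measurable (raw)]:
  assumes "f \<in> measurable M \<mu>" "i < N" "j < N"
  shows "(\<lambda>x. f x $$ (i, j)) \<in> borel_measurable M"
proof -
  have "(\<lambda>U. \<lambda>p \<in> {..<N} \<times> {..<N}. U $$ p) \<in> measurable \<mu> (PiM ({..<N} \<times> {..<N}) (\<lambda>_. borel :: real measure))"
    unfolding measurable_cong_sets[OF sets_haar refl] orthogonal_borel_def
    by (rule measurable_vimage_algebra1) (auto simp: space_PiM)
  from measurable_compose[OF this measurable_component_singleton[of "(i, j)"]]
  have "(\<lambda>U. U $$ (i, j)) \<in> borel_measurable \<mu>" using assms by simp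
  then show ?thesis using assms(1) by (rule measurable_compose[rotated])
qed

lemma measurable_haarI:
  assumes "\<And>x. x \<in> space M \<Longrightarrow> f x \<in> orthogonal_group N"
    and "\<And>i j. i < N \<Longrightarrow> j < N \<Longrightarrow> (\<lambda>x. f x $$ (i, j)) \<in> borel_measurable M"
  shows "f \<in> measurable M \<mu>"
  unfolding measurable_cong_sets[OF refl sets_haar] orthogonal_borel_def
  by (rule measurable_vimage_algebra2) (use assms in \<open>auto intro!: measurable_restrict\<close>)

lemma measurable_matrix_mult:
  assumes f: "f \<in> measurable M \<mu>" and g: "g \<in> measurable M \<mu>"
  shows "(\<lambda>x. f x * g x) \<in> measurable M \<mu>"
proof (rule measurable_haarI)
  note [measurable] = f g
  have O: "f x \<in> orthogonal_group N" "g x \<in> orthogonal_group N" if "x \<in> space M" for x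
    using that measurable_space[OF f] measurable_space[OF g] by (auto simp: space_haar)
  show "f x * g x \<in> orthogonal_group N" if "x \<in> space M" for x
    using O[OF that] by (rule orthogonal_group_mult)
  fix i j assume ij: "i < N" "j < N"
  have "(f x * g x) $$ (i, j) = (\<Sum>k\<in>{0..<N}. f x $$ (i, k) * g x $$ (k, j))" if "x \<in> space M" for x
    using orthogonal_groupD[OF O(1)[OF that]] orthogonal_groupD[OF O(2)[OF that]] ij
    by (simp add: times_mat_def scalar_prod_def)
  moreover have "(\<lambda>x. \<Sum>k\<in>{0..<N}. f x $$ (i, k) * g x $$ (k, j)) \<in> borel_measurable M"
    using ij by measurable
  ultimately show "(\<lambda>x. (f x * g x) $$ (i, j)) \<in> borel_measurable M"
    by (simp cong: measurable_cong)
qed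

lemma measurable_transpose:
  assumes f: "f \<in> measurable M \<mu>"
  shows "(\<lambda>x. transpose_mat (f x)) \<in> measurable M \<mu>"
proof (rule measurable_haarI)
  have O: "f x \<in> orthogonal_group N" if "x \<in> space M" for x
    using that measurable_space[OF f] by (auto simp: space_haar)
  show "transpose_mat (f x) \<in> orthogonal_group N" if "x \<in> space M" for x
    using O[OF that] by (rule orthogonal_group_transpose)
  fix i j assume ij: "i < N" "j < N"
  have "(\<lambda>x. f x $$ (j, i)) \<in> borel_measurable M"
    using f ij by simp
  moreover have "transpose_mat (f x) $$ (i, j) = f x $$ (j, i)" if "x \<in> space M" for x
    using orthogonal_groupD[OF O[OF that]] ij by simp
  ultimately show "(\<lambda>x. transpose_mat (f x) $$ (i, j)) \<in> borel_measurable M"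
    by (simp cong: measurable_cong)
qed

lemma nn_integral_left_mult:
  assumes R: "R \<in> orthogonal_group N" and f: "f \<in> borel_measurable \<mu>"
  shows "(\<integral>\<^sup>+U. f (R * U) \<partial>\<mu>) = (\<integral>\<^sup>+U. f U \<partial>\<mu>)"
proof -
  have m: "(\<lambda>U. R * U) \<in> measurable \<mu> \<mu>"
    using R by (intro measurable_matrix_mult[of "\<lambda>_. R" \<mu> "\<lambda>U. U"]) (auto simp: space_haar)
  have "(\<integral>\<^sup>+U. f U \<partial>distr \<mu> \<mu> (\<lambda>U. R * U)) = (\<integral>\<^sup>+U. f U \<partial>\<mu>)"
    using haar R by (simp add: normalized_haar_def)
  then show ?thesis using nn_integral_distr[OF m, of f] f by simp
qed

text \<open>
  Integrating \<open>f (W\<^sup>T U)\<close> over both variables shows that \<open>\<mu>\<close> is also its own image under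
  transposition, which turns left into right translations.
\<close>

lemma nn_integral_transpose:
  assumes f: "f \<in> borel_measurable \<mu>"
  shows "(\<integral>\<^sup>+U. f (transpose_mat U) \<partial>\<mu>) = (\<integral>\<^sup>+U. f U \<partial>\<mu>)"
proof -
  interpret P: pair_sigma_finite \<mu> \<mu> ..
  have m: "(\<lambda>(W, U). transpose_mat W * U) \<in> measurable (\<mu> \<Otimes>\<^sub>M \<mu>) \<mu>"
    unfolding case_prod_beta
    by (intro measurable_matrix_mult[of "\<lambda>p. transpose_mat (fst p)" _ snd] measurable_transpose) auto
  have ft: "(\<lambda>U. f (transpose_mat U)) \<in> borel_measurable \<mu>"
    by (rule measurable_compose[OF _ f]) (rule measurable_transpose, simp)
  have "(\<integral>\<^sup>+U. f U \<partial>\<mu>) = (\<integral>\<^sup>+W. (\<integral>\<^sup>+U. f (transpose_mat W * U) \<partial>\<mu>) \<partial>\<mu>)"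
  proof -
    have "(\<integral>\<^sup>+W. (\<integral>\<^sup>+U. f (transpose_mat W * U) \<partial>\<mu>) \<partial>\<mu>) = (\<integral>\<^sup>+W. (\<integral>\<^sup>+U. f U \<partial>\<mu>) \<partial>\<mu>)"
      by (intro nn_integral_cong nn_integral_left_mult f orthogonal_group_transpose) (simp add: space_haar)
    then show ?thesis by (simp add: emeasure_space_1)
  qed
  also have "\<dots> = (\<integral>\<^sup>+U. (\<integral>\<^sup>+W. f (transpose_mat W * U) \<partial>\<mu>) \<partial>\<mu>)"
    using measurable_compose[OF m f]
    by (intro P.Fubini'[of "\<lambda>W U. f (transpose_mat W * U)", symmetric]) (simp add: case_prod_beta)
  also have "\<dots> = (\<integral>\<^sup>+U. (\<integral>\<^sup>+W. f (transpose_mat W) \<partial>\<mu>) \<partial>\<mu>)"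
  proof (rule nn_integral_cong)
    fix U assume "U \<in> space \<mu>"
    then have U: "U \<in> orthogonal_group N" by (simp add: space_haar)
    \<comment> \<open>For fixed \<open>U\<close> the argument is the transpose of
      \<open>transpose_mat U * W\<close>, so left invariance in \<open>W\<close> removes
      \<open>U\<close>.\<close>
    have "(\<integral>\<^sup>+W. f (transpose_mat W * U) \<partial>\<mu>) = (\<integral>\<^sup>+W. f (transpose_mat (transpose_mat U * W)) \<partial>\<mu>)"
    proof (rule nn_integral_cong)
      fix W assume "W \<in> space \<mu>"
      then have W: "W \<in> orthogonal_group N" by (simp add: space_haar)
      show "f (transpose_mat W * U) = f (transpose_mat (transpose_mat U * W))"
        using orthogonal_groupD[OF U] orthogonal_groupD[OF W] by (simp add: transpose_mult[of _ N N _ N])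
    qed
    also have "\<dots> = (\<integral>\<^sup>+W. f (transpose_mat W) \<partial>\<mu>)"
      using nn_integral_left_mult[OF orthogonal_group_transpose[OF U] ft] .
    finally show "(\<integral>\<^sup>+W. f (transpose_mat W * U) \<partial>\<mu>) = (\<integral>\<^sup>+W. f (transpose_mat W) \<partial>\<mu>)" .
  qed
  also have "\<dots> = (\<integral>\<^sup>+W. f (transpose_mat W) \<partial>\<mu>)"
    by (simp add: emeasure_space_1)
  finally show ?thesis ..
qed

lemma right_mult_measurable:
  assumes V: "V \<in> orthogonal_group N"
  shows "(\<lambda>U. U * V) \<in> measurable \<mu> \<mu>"
  using V by (intro measurable_matrix_mult[of "\<lambda>U. U" \<mu> "\<lambda>_. V"]) (auto simp: space_haar)

lemma nn_integral_right_mult: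
  assumes V: "V \<in> orthogonal_group N" and f: "f \<in> borel_measurable \<mu>"
  shows "(\<integral>\<^sup>+U. f (U * V) \<partial>\<mu>) = (\<integral>\<^sup>+U. f U \<partial>\<mu>)"
proof -
  have ft: "(\<lambda>U. f (transpose_mat U)) \<in> borel_measurable \<mu>"
    by (rule measurable_compose[OF _ f]) (rule measurable_transpose, simp)
  have "(\<integral>\<^sup>+U. f (U * V) \<partial>\<mu>) = (\<integral>\<^sup>+U. f (transpose_mat U * V) \<partial>\<mu>)"
    using nn_integral_transpose[OF measurable_compose[OF right_mult_measurable[OF V] f]] by simp
  also have "\<dots> = (\<integral>\<^sup>+U. f (transpose_mat (transpose_mat V * U)) \<partial>\<mu>)"
  proof (rule nn_integral_cong)
    fix U assume "U \<in> space \<mu>"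
    then have U: "U \<in> orthogonal_group N" by (simp add: space_haar)
    show "f (transpose_mat U * V) = f (transpose_mat (transpose_mat V * U))"
      using orthogonal_groupD[OF U] orthogonal_groupD[OF V] by (simp add: transpose_mult[of _ N N _ N])
  qed
  also have "\<dots> = (\<integral>\<^sup>+U. f (transpose_mat U) \<partial>\<mu>)"
    using nn_integral_left_mult[OF orthogonal_group_transpose[OF V] ft] .
  also have "\<dots> = (\<integral>\<^sup>+U. f U \<partial>\<mu>)" by (rule nn_integral_transpose[OF f])
  finally show ?thesis .
qed

lemma distr_right_mult:
  assumes V: "V \<in> orthogonal_group N"
  shows "distr \<mu> \<mu> (\<lambda>U. U * V) = \<mu>"
proof (rule measure_eqI)
  fix X assume "X \<in> sets (distr \<mu> \<mu> (\<lambda>U. U * V))"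
  then have X: "X \<in> sets \<mu>" by simp
  have "emeasure (distr \<mu> \<mu> (\<lambda>U. U * V)) X = (\<integral>\<^sup>+U. indicator X U \<partial>distr \<mu> \<mu> (\<lambda>U. U * V))"
    using X by simp
  also have "\<dots> = (\<integral>\<^sup>+U. indicator X (U * V) \<partial>\<mu>)"
    using X right_mult_measurable[OF V] by (subst nn_integral_distr) auto
  also have "\<dots> = (\<integral>\<^sup>+U. indicator X U \<partial>\<mu>)"
    using X by (intro nn_integral_right_mult[OF V]) auto
  finally show "emeasure (distr \<mu> \<mu> (\<lambda>U. U * V)) X = emeasure \<mu> X" using X by simp
qed simp

lemma integral_right_mult:
  fixes f :: "real mat \<Rightarrow> real"
  assumes V: "V \<in> orthogonal_group N" and f: "f \<in> borel_measurable \<mu>"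
  shows "(\<integral>U. f (U * V) \<partial>\<mu>) = (\<integral>U. f U \<partial>\<mu>)"
  using integral_distr[OF right_mult_measurable[OF V] f] by (simp add: distr_right_mult[OF V])

end

subsection \<open>Concentration of convex functionals\<close>

text \<open>The entry with index 0 vanishes to make the vector orthogonal to
  \<open>unit_vec N 0\<close>; the square root gives it unit length. Its image under
  \<open>U\<close> is the normalized signed sum of all columns of \<open>U\<close> but the
  first.\<close>

definition sign_vec :: "nat \<Rightarrow> (nat \<Rightarrow> real) \<Rightarrow> real vec" where
  "sign_vec N e = vec N (\<lambda>j. if j = 0 then 0 else e j / sqrt (real N - 1))"

lemma sign_vec_carrier [simp]: "sign_vec N e \<in> carrier_vec N"
  by (simp add: sign_vec_def)

lemma scalar_prod_sign_vec:
  assumes "c \<in> carrier_vec N"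
  shows "scalar_prod c (sign_vec N e) = (\<Sum>j\<in>{1..<N}. e j * (c $ j / sqrt (real N - 1)))"
proof -
  have "scalar_prod c (sign_vec N e) = (\<Sum>j\<in>{0..<N}. c $ j * sign_vec N e $ j)"
    by (simp add: scalar_prod_def sign_vec_def)
  also have "\<dots> = (\<Sum>j\<in>{1..<N}. c $ j * sign_vec N e $ j)"
    by (rule sum.mono_neutral_right) (auto simp: sign_vec_def)
  also have "\<dots> = (\<Sum>j\<in>{1..<N}. e j * (c $ j / sqrt (real N - 1)))"
    by (intro sum.cong refl) (auto simp: sign_vec_def)
  finally show ?thesis .
qed

lemma orthonormal_pair_sign_vec:
  assumes "N \<ge> 2" "e \<in> signs {1..<N}"
  shows "orthonormal_pair N (unit_vec N 0) (sign_vec N e)"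
proof -
  have e: "e j * e j = 1" if "j \<in> {1..<N}" for j
    using PiE_mem[OF assms(2)[unfolded signs_def] that] by auto
  have "scalar_prod (sign_vec N e) (sign_vec N e) = (\<Sum>j\<in>{1..<N}. 1 / (real N - 1))"
    unfolding scalar_prod_sign_vec[OF sign_vec_carrier]
  proof (intro sum.cong refl)
    fix j assume j: "j \<in> {1..<N}"
    have "e j * (sign_vec N e $ j / sqrt (real N - 1)) = (e j * e j) / (sqrt (real N - 1) * sqrt (real N - 1))"
      using j by (simp add: sign_vec_def)
    then show "e j * (sign_vec N e $ j / sqrt (real N - 1)) = 1 / (real N - 1)"
      using j assms(1) by (simp add: e)
  qed
  also have "\<dots> = 1" using assms(1) by (simp add: of_nat_diff)
  finally show ?thesis using assms(1)
    by (auto simp: orthonormal_pair_def) (simp add: sign_vec_def)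
qed

text \<open>The left side is the variance of the inner product of \<open>v\<close> with
  \<open>U *\<^sub>v sign_vec N e\<close> under random signs. The map \<open>transpose_mat U\<close>
  preserves length, and omitting the coordinate 0 only decreases the sum.\<close>

lemma sum_sign_coeffs_le:
  assumes "N \<ge> 2" "U \<in> orthogonal_group N" "v \<in> carrier_vec N"
  shows "(\<Sum>j\<in>{1..<N}. ((transpose_mat U *\<^sub>v v) $ j / sqrt (real N - 1))\<^sup>2)
         \<le> scalar_prod v v / (real N - 1)"
proof -
  define c where "c = transpose_mat U *\<^sub>v v"
  have c: "c \<in> carrier_vec N" using assms(3) orthogonal_groupD[OF assms(2)] by (simp add: c_def)
  have "(\<Sum>j\<in>{1..<N}. (c $ j / sqrt (real N - 1))\<^sup>2) = (\<Sum>j\<in>{1..<N}. c $ j * c $ j) / (real N - 1)"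
    using assms(1) by (simp add: power_divide sum_divide_distrib power2_eq_square)
  also have "\<dots> \<le> (\<Sum>j\<in>{0..<N}. c $ j * c $ j) / (real N - 1)"
    using assms(1) by (intro divide_right_mono sum_mono2) auto
  also have "(\<Sum>j\<in>{0..<N}. c $ j * c $ j) = scalar_prod v v"
    using orthogonal_scalar_prod[OF orthogonal_group_transpose[OF assms(2)] assms(3) assms(3)] c
    by (simp add: c_def[symmetric]) (simp add: scalar_prod_def)
  finally show ?thesis by (simp add: c_def)
qed

lemma scalar_prod_rotated_sign_vec:
  assumes "U \<in> orthogonal_group N" "v \<in> carrier_vec N"
  shows "scalar_prod v (U *\<^sub>v sign_vec N e) =
    (\<Sum>j\<in>{1..<N}. e j * ((transpose_mat U *\<^sub>v v) $ j / sqrt (real N - 1)))"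
proof -
  note U = orthogonal_groupD[OF assms(1)]
  show ?thesis
    using scalar_prod_sign_vec[of "transpose_mat U *\<^sub>v v" N e]
      transpose_vec_mult_scalar[OF U(1) sign_vec_carrier assms(2)] U assms(2) by simp
qed

lemma sign_avg_exp_rotated:
  assumes "N \<ge> 2" "U \<in> orthogonal_group N" "v \<in> carrier_vec N"
  shows "sign_avg {1..<N} (\<lambda>e. exp (t * scalar_prod v (U *\<^sub>v sign_vec N e)))
         \<le> exp (t\<^sup>2 * scalar_prod v v / (2 * (real N - 1)))"
proof -
  define c where "c j = (transpose_mat U *\<^sub>v v) $ j / sqrt (real N - 1)" for j
  have "sign_avg {1..<N} (\<lambda>e. exp (t * scalar_prod v (U *\<^sub>v sign_vec N e))) =
      sign_avg {1..<N} (\<lambda>e. exp (\<Sum>j\<in>{1..<N}. e j * (t * c j)))"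
    unfolding scalar_prod_rotated_sign_vec[OF assms(2,3)] c_def sum_distrib_left
    by (simp add: mult_ac)
  also have "\<dots> \<le> exp ((\<Sum>j\<in>{1..<N}. (t * c j)\<^sup>2) / 2)"
    by (rule sign_avg_exp) simp
  also have "\<dots> \<le> exp (t\<^sup>2 * scalar_prod v v / (2 * (real N - 1)))"
  proof -
    have "(\<Sum>j\<in>{1..<N}. (t * c j)\<^sup>2) = t\<^sup>2 * (\<Sum>j\<in>{1..<N}. (c j)\<^sup>2)"
      by (simp add: power_mult_distrib sum_distrib_left)
    also have "\<dots> \<le> t\<^sup>2 * (scalar_prod v v / (real N - 1))"
      unfolding c_def by (intro mult_left_mono sum_sign_coeffs_le assms) auto
    finally have "(\<Sum>j\<in>{1..<N}. (t * c j)\<^sup>2) / 2 \<le> t\<^sup>2 * (scalar_prod v v / (real N - 1)) / 2"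
      by (rule divide_right_mono) simp
    then show ?thesis
      by (simp only: times_divide_eq_right divide_divide_eq_left mult.commute[of 2] exp_le_cancel_iff)
  qed
  finally show ?thesis .
qed

text \<open>The bound is stated through an upper bound \<open>s\<close> for the variance, so that it
  depends on neither \<open>U\<close> nor \<open>v\<close>.\<close>

lemma sign_avg_exp_square_rotated:
  assumes "N \<ge> 2" "U \<in> orthogonal_group N" "v \<in> carrier_vec N"
    and s: "scalar_prod v v / (real N - 1) \<le> s" and K: "2 * s < K"
  shows "sign_avg {1..<N} (\<lambda>e. exp ((scalar_prod v (U *\<^sub>v sign_vec N e))\<^sup>2 / K)) \<le> exp (s / (K - 2 * s))"
proof -
  define c where "c j = (transpose_mat U *\<^sub>v v) $ j / sqrt (real N - 1)" for j
  have c: "(\<Sum>j\<in>{1..<N}. (c j)\<^sup>2) \<le> s"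
    using sum_sign_coeffs_le[OF assms(1-3)] s unfolding c_def by simp
  have "sign_avg {1..<N} (\<lambda>e. exp ((scalar_prod v (U *\<^sub>v sign_vec N e))\<^sup>2 / K)) =
      sign_avg {1..<N} (\<lambda>e. exp ((0 + (\<Sum>j\<in>{1..<N}. e j * c j))\<^sup>2 / K))"
    unfolding scalar_prod_rotated_sign_vec[OF assms(2,3)] c_def by simp
  also have "\<dots> \<le> exp ((0\<^sup>2 + (\<Sum>j\<in>{1..<N}. (c j)\<^sup>2)) / (K - 2 * (\<Sum>j\<in>{1..<N}. (c j)\<^sup>2)))"
    using c K by (intro sign_avg_exp_square) auto
  also have "\<dots> \<le> exp (s / (K - 2 * s))"
    using c K by (auto intro!: frac_le sum_nonneg intro: order_trans[OF _ c])
  finally show ?thesis .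
qed

text \<open>\<open>F_subgradient\<close> encodes convexity together with a Lipschitz bound at unit
  vectors, \<open>F_bounded\<close> makes the exponentials integrable, and \<open>F_sign_avg\<close>
  supplies the level around which upper deviations are measured.\<close>

locale haar_functional = haar +
  fixes F :: "real vec \<Rightarrow> real" and L B C\<^sub>0 :: real
  assumes N: "N \<ge> 2" and L: "L \<ge> 1"
    and F_measurable: "\<And>a. a \<in> carrier_vec N \<Longrightarrow> (\<lambda>U. F (U *\<^sub>v a)) \<in> borel_measurable \<mu>"
    and F_bounded: "\<And>b. b \<in> carrier_vec N \<Longrightarrow> scalar_prod b b = 1 \<Longrightarrow> \<bar>F b\<bar> \<le> B"
    and F_subgradient: "\<And>b. b \<in> carrier_vec N \<Longrightarrow> scalar_prod b b = 1 \<Longrightarrow>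
        \<exists>v\<in>carrier_vec N. scalar_prod v v \<le> L\<^sup>2 \<and>
          (\<forall>b'\<in>carrier_vec N. F b - F b' \<le> scalar_prod v (b - b'))"
    and F_sign_avg: "\<And>U. U \<in> orthogonal_group N \<Longrightarrow>
        sign_avg {1..<N} (\<lambda>e. F (U *\<^sub>v sign_vec N e)) \<le> C\<^sub>0"
begin

section \<open>Exponential moments and the upper tail of the functional\<close>

lemma F_bounded_rotated:
  assumes "U \<in> space \<mu>" "a \<in> carrier_vec N" "scalar_prod a a = 1"
  shows "\<bar>F (U *\<^sub>v a)\<bar> \<le> B"
proof -
  have U: "U \<in> orthogonal_group N" using assms(1) by (simp add: space_haar)
  show ?thesis using orthogonal_groupD[OF U] orthogonal_scalar_prod[OF U assms(2) assms(2)] assms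
    by (intro F_bounded) auto
qed

lemma integrable_exp_diff:
  assumes p: "p \<in> carrier_vec N" "scalar_prod p p = 1" and q: "q \<in> carrier_vec N" "scalar_prod q q = 1"
  shows "integrable \<mu> (\<lambda>U. exp (t * (F (U *\<^sub>v p) - F (U *\<^sub>v q))))"
proof (rule integrable_const_bound[where B = "exp (\<bar>t\<bar> * (2 * B))"])
  show "AE U in \<mu>. norm (exp (t * (F (U *\<^sub>v p) - F (U *\<^sub>v q)))) \<le> exp (\<bar>t\<bar> * (2 * B))"
  proof (rule AE_I2)
    fix U assume U: "U \<in> space \<mu>"
    have "t * (F (U *\<^sub>v p) - F (U *\<^sub>v q)) \<le> \<bar>t\<bar> * \<bar>F (U *\<^sub>v p) - F (U *\<^sub>v q)\<bar>"
      by (metis abs_ge_self abs_mult)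
    also have "\<dots> \<le> \<bar>t\<bar> * (2 * B)"
      using F_bounded_rotated[OF U p] F_bounded_rotated[OF U q] by (intro mult_left_mono) auto
    finally show "norm (exp (t * (F (U *\<^sub>v p) - F (U *\<^sub>v q)))) \<le> exp (\<bar>t\<bar> * (2 * B))" by simp
  qed
  note [measurable] = F_measurable[OF p(1)] F_measurable[OF q(1)]
  show "(\<lambda>U. exp (t * (F (U *\<^sub>v p) - F (U *\<^sub>v q)))) \<in> borel_measurable \<mu>" by measurable
qed

lemma integrable_exp:
  assumes p: "p \<in> carrier_vec N" "scalar_prod p p = 1"
  shows "integrable \<mu> (\<lambda>U. exp (t * F (U *\<^sub>v p)))"
proof (rule integrable_const_bound[where B = "exp (\<bar>t\<bar> * B)"])
  show "AE U in \<mu>. norm (exp (t * F (U *\<^sub>v p))) \<le> exp (\<bar>t\<bar> * B)"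
  proof (rule AE_I2)
    fix U assume U: "U \<in> space \<mu>"
    have "t * F (U *\<^sub>v p) \<le> \<bar>t\<bar> * \<bar>F (U *\<^sub>v p)\<bar>"
      by (metis abs_ge_self abs_mult)
    also have "\<dots> \<le> \<bar>t\<bar> * B"
      using F_bounded_rotated[OF U p] by (intro mult_left_mono) auto
    finally show "norm (exp (t * F (U *\<^sub>v p))) \<le> exp (\<bar>t\<bar> * B)" by simp
  qed
  note [measurable] = F_measurable[OF p(1)]
  show "(\<lambda>U. exp (t * F (U *\<^sub>v p))) \<in> borel_measurable \<mu>" by measurable
qed

text \<open>Right translation by a matrix \<open>V\<close> carrying one pair to the other preserves
  \<open>\<mu>\<close>. The law of an increment therefore depends only on the coefficients
  \<open>x\<close> and \<open>y\<close>, not on the pair.\<close>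

lemma integral_exp_diff_pair:
  assumes p: "orthonormal_pair N p p'" and q: "orthonormal_pair N q q'"
  shows "(\<integral>U. exp (t * (F (U *\<^sub>v p) - F (U *\<^sub>v (x \<cdot>\<^sub>v p + y \<cdot>\<^sub>v p')))) \<partial>\<mu>) =
         (\<integral>U. exp (t * (F (U *\<^sub>v q) - F (U *\<^sub>v (x \<cdot>\<^sub>v q + y \<cdot>\<^sub>v q')))) \<partial>\<mu>)"
proof -
  obtain V where V: "V \<in> orthogonal_group N" "V *\<^sub>v p = q" "V *\<^sub>v p' = q'"
    using exists_orthogonal_map_pair[OF p q] by blast
  have c: "p \<in> carrier_vec N" "p' \<in> carrier_vec N" using p by (auto simp: orthonormal_pair_def)
  have comb: "V *\<^sub>v (x \<cdot>\<^sub>v p + y \<cdot>\<^sub>v p') = x \<cdot>\<^sub>v q + y \<cdot>\<^sub>v q'"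
    using V c orthogonal_groupD[OF V(1)] by (simp add: mult_add_distrib_mat_vec[of _ N N] mult_mat_vec[of _ N N])
  have f: "(\<lambda>U. exp (t * (F (U *\<^sub>v p) - F (U *\<^sub>v (x \<cdot>\<^sub>v p + y \<cdot>\<^sub>v p'))))) \<in> borel_measurable \<mu>"
  proof -
    have "x \<cdot>\<^sub>v p + y \<cdot>\<^sub>v p' \<in> carrier_vec N" using c by simp
    note [measurable] = F_measurable[OF this] F_measurable[OF c(1)]
    show ?thesis by measurable
  qed
  have "(\<integral>U. exp (t * (F (U *\<^sub>v p) - F (U *\<^sub>v (x \<cdot>\<^sub>v p + y \<cdot>\<^sub>v p')))) \<partial>\<mu>) =
        (\<integral>U. exp (t * (F ((U * V) *\<^sub>v p) - F ((U * V) *\<^sub>v (x \<cdot>\<^sub>v p + y \<cdot>\<^sub>v p')))) \<partial>\<mu>)"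
    using integral_right_mult[OF V(1) f] by simp
  also have "\<dots> = (\<integral>U. exp (t * (F (U *\<^sub>v q) - F (U *\<^sub>v (x \<cdot>\<^sub>v q + y \<cdot>\<^sub>v q')))) \<partial>\<mu>)"
  proof (rule Bochner_Integration.integral_cong[OF refl])
    fix U assume "U \<in> space \<mu>"
    then have U: "U \<in> carrier_mat N N" by (auto simp: space_haar dest: orthogonal_groupD)
    have "(U * V) *\<^sub>v p = U *\<^sub>v q" "(U * V) *\<^sub>v (x \<cdot>\<^sub>v p + y \<cdot>\<^sub>v p') = U *\<^sub>v (x \<cdot>\<^sub>v q + y \<cdot>\<^sub>v q')"
      using U c V(2) comb orthogonal_groupD[OF V(1)] by (simp_all add: assoc_mult_mat_vec[of _ N N _ N])
    then show "exp (t * (F ((U * V) *\<^sub>v p) - F ((U * V) *\<^sub>v (x \<cdot>\<^sub>v p + y \<cdot>\<^sub>v p')))) =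
        exp (t * (F (U *\<^sub>v q) - F (U *\<^sub>v (x \<cdot>\<^sub>v q + y \<cdot>\<^sub>v q'))))" by simp
  qed
  finally show ?thesis .
qed

lemma integral_exp_unit:
  assumes p: "p \<in> carrier_vec N" "scalar_prod p p = 1" and q: "q \<in> carrier_vec N" "scalar_prod q q = 1"
  shows "(\<integral>U. exp (t * F (U *\<^sub>v p)) \<partial>\<mu>) = (\<integral>U. exp (t * F (U *\<^sub>v q)) \<partial>\<mu>)"
proof -
  obtain V where V: "V \<in> orthogonal_group N" "V *\<^sub>v p = q"
    using exists_orthogonal_map[OF p(1) q(1)] p q by auto
  have "(\<integral>U. exp (t * F (U *\<^sub>v p)) \<partial>\<mu>) = (\<integral>U. exp (t * F ((U * V) *\<^sub>v p)) \<partial>\<mu>)"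
    using integral_right_mult[OF V(1) borel_measurable_integrable[OF integrable_exp[OF p]], of t] by simp
  also have "\<dots> = (\<integral>U. exp (t * F (U *\<^sub>v q)) \<partial>\<mu>)"
  proof (rule Bochner_Integration.integral_cong[OF refl])
    fix U assume "U \<in> space \<mu>"
    then have U: "U \<in> carrier_mat N N" by (auto simp: space_haar dest: orthogonal_groupD)
    have "(U * V) *\<^sub>v p = U *\<^sub>v q"
      using U p V(2) orthogonal_groupD[OF V(1)] by (simp add: assoc_mult_mat_vec[of _ N N _ N])
    then show "exp (t * F ((U * V) *\<^sub>v p)) = exp (t * F (U *\<^sub>v q))" by simp
  qed
  finally show ?thesis .
qed

lemma orthonormal_pair_combination:
  assumes "orthonormal_pair N p p'" "x\<^sup>2 + y\<^sup>2 = 1"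
  shows "scalar_prod (x \<cdot>\<^sub>v p + y \<cdot>\<^sub>v p') (x \<cdot>\<^sub>v p + y \<cdot>\<^sub>v p') = 1"
proof -
  have c: "p \<in> carrier_vec N" "p' \<in> carrier_vec N" "scalar_prod p p = 1" "scalar_prod p' p' = 1"
    "scalar_prod p p' = 0" "scalar_prod p' p = 0"
    using assms comm_scalar_prod[of p N p'] by (auto simp: orthonormal_pair_def)
  have "scalar_prod (x \<cdot>\<^sub>v p + y \<cdot>\<^sub>v p') (x \<cdot>\<^sub>v p + y \<cdot>\<^sub>v p') = x * x + y * y"
    using c by (simp add: add_scalar_prod_distrib[of _ N] scalar_prod_add_distrib[of _ N])
  then show ?thesis using assms(2) by (simp add: power2_eq_square)
qed

lemma orthonormal_pair_units: "orthonormal_pair N (unit_vec N 0) (unit_vec N 1)"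
  using N by (auto simp: orthonormal_pair_def)

text \<open>The subgradient \<open>v\<close> belongs to the first column \<open>b\<close> and does
  not depend on the signs. The part of the increment along \<open>b\<close> has the factor
  \<open>1 - cos d\<close>, of second order in \<open>d\<close>; the part along the signed sum
  \<open>w\<close> is linear in the signs, hence subgaussian.\<close>

lemma sign_avg_exp_step:
  assumes U: "U \<in> orthogonal_group N" and t: "t \<ge> 0"
  shows "sign_avg {1..<N} (\<lambda>e. exp (t * (F (U *\<^sub>v unit_vec N 0) -
             F (U *\<^sub>v (cos d \<cdot>\<^sub>v unit_vec N 0 + sin d \<cdot>\<^sub>v sign_vec N e)))))
         \<le> exp (t * (1 - cos d) * L\<^sup>2 + t\<^sup>2 * (sin d)\<^sup>2 * L\<^sup>2 / (2 * (real N - 1)))"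
proof -
  define b where "b = U *\<^sub>v unit_vec N 0"
  note U' = orthogonal_groupD[OF U]
  have b: "b \<in> carrier_vec N" using U' by (simp add: b_def)
  have bb: "scalar_prod b b = 1"
    using orthogonal_scalar_prod[OF U, of "unit_vec N 0" "unit_vec N 0"] N by (simp add: b_def)
  obtain v where v: "v \<in> carrier_vec N" "scalar_prod v v \<le> L\<^sup>2"
      "\<And>b'. b' \<in> carrier_vec N \<Longrightarrow> F b - F b' \<le> scalar_prod v (b - b')"
    using F_subgradient[OF b bb] by blast
  \<comment> \<open>Expanding the square gives
    \<open>2 * scalar_prod v b \<le> scalar_prod v v + scalar_prod b b\<close>. Since
    \<open>L \<ge> 1\<close>, the right side is at most \<open>2 * L\<^sup>2\<close>.\<close>
  have vb: "scalar_prod v b \<le> L\<^sup>2"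
  proof -
    have "0 \<le> scalar_prod (v - b) (v - b)"
      by (auto simp: scalar_prod_def intro!: sum_nonneg)
    also have "\<dots> = scalar_prod v v - 2 * scalar_prod v b + scalar_prod b b"
      using v b comm_scalar_prod[OF b v(1)]
      by (simp add: minus_scalar_prod_distrib[of _ N] scalar_prod_minus_distrib[of _ N])
    finally have "2 * scalar_prod v b \<le> L\<^sup>2 + 1" using v bb by simp
    moreover have "1 \<le> L\<^sup>2" using L by (simp add: one_le_power)
    ultimately show ?thesis by simp
  qed
  have "exp (t * (F b - F (U *\<^sub>v (cos d \<cdot>\<^sub>v unit_vec N 0 + sin d \<cdot>\<^sub>v sign_vec N e))))
      \<le> exp (t * (1 - cos d) * L\<^sup>2) * exp ((- (t * sin d)) * scalar_prod v (U *\<^sub>v sign_vec N e))" for e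
  proof -
    define w where "w = U *\<^sub>v sign_vec N e"
    have w: "w \<in> carrier_vec N" using U' by (simp add: w_def)
    have eq: "U *\<^sub>v (cos d \<cdot>\<^sub>v unit_vec N 0 + sin d \<cdot>\<^sub>v sign_vec N e) = cos d \<cdot>\<^sub>v b + sin d \<cdot>\<^sub>v w"
      using U' by (simp add: b_def w_def mult_add_distrib_mat_vec[of _ N N] mult_mat_vec[of _ N N])
    have "F b - F (cos d \<cdot>\<^sub>v b + sin d \<cdot>\<^sub>v w) \<le> scalar_prod v (b - (cos d \<cdot>\<^sub>v b + sin d \<cdot>\<^sub>v w))"
      using b w by (intro v) auto
    also have "\<dots> = (1 - cos d) * scalar_prod v b - sin d * scalar_prod v w"
      using v b w by (simp add: scalar_prod_minus_distrib[of _ N] scalar_prod_add_distrib[of _ N] algebra_simps)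
    also have "\<dots> \<le> (1 - cos d) * L\<^sup>2 - sin d * scalar_prod v w"
      using vb by (simp add: mult_left_mono)
    finally have "t * (F b - F (cos d \<cdot>\<^sub>v b + sin d \<cdot>\<^sub>v w)) \<le> t * ((1 - cos d) * L\<^sup>2 - sin d * scalar_prod v w)"
      using t by (rule mult_left_mono)
    then show ?thesis unfolding eq w_def[symmetric] exp_add[symmetric] by (simp add: algebra_simps)
  qed
  then have "sign_avg {1..<N} (\<lambda>e. exp (t * (F b - F (U *\<^sub>v (cos d \<cdot>\<^sub>v unit_vec N 0 + sin d \<cdot>\<^sub>v sign_vec N e)))))
      \<le> exp (t * (1 - cos d) * L\<^sup>2) * sign_avg {1..<N} (\<lambda>e. exp ((- (t * sin d)) * scalar_prod v (U *\<^sub>v sign_vec N e)))"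
    unfolding sign_avg_cmult[symmetric] by (intro sign_avg_mono)
  also have "\<dots> \<le> exp (t * (1 - cos d) * L\<^sup>2) * exp ((- (t * sin d))\<^sup>2 * scalar_prod v v / (2 * (real N - 1)))"
    by (intro mult_left_mono sign_avg_exp_rotated N U v) auto
  also have "\<dots> \<le> exp (t * (1 - cos d) * L\<^sup>2) * exp (t\<^sup>2 * (sin d)\<^sup>2 * L\<^sup>2 / (2 * (real N - 1)))"
    using v N by (intro mult_left_mono) (auto simp: power_mult_distrib intro!: divide_right_mono mult_left_mono)
  finally show ?thesis by (simp add: b_def exp_add)
qed

text \<open>Each pair of \<open>unit_vec N 0\<close> and \<open>sign_vec N e\<close> gives the same
  integral as \<open>p\<close> and \<open>p'\<close>. Averaging over \<open>e\<close> thus changes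
  nothing, and the bound for fixed \<open>U\<close> can be applied under the integral.\<close>

lemma integral_exp_step:
  assumes p: "orthonormal_pair N p p'" and t: "t \<ge> 0"
  shows "(\<integral>U. exp (t * (F (U *\<^sub>v p) - F (U *\<^sub>v (cos d \<cdot>\<^sub>v p + sin d \<cdot>\<^sub>v p')))) \<partial>\<mu>)
         \<le> exp (t * (1 - cos d) * L\<^sup>2 + t\<^sup>2 * (sin d)\<^sup>2 * L\<^sup>2 / (2 * (real N - 1)))" (is "?I \<le> ?R")
proof -
  let ?g = "\<lambda>U e. exp (t * (F (U *\<^sub>v unit_vec N 0) - F (U *\<^sub>v (cos d \<cdot>\<^sub>v unit_vec N 0 + sin d \<cdot>\<^sub>v sign_vec N e))))"
  have int: "integrable \<mu> (\<lambda>U. ?g U e)" if "e \<in> signs {1..<N}" for e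
    using orthonormal_pair_combination[OF orthonormal_pair_sign_vec[OF N that], of "cos d" "sin d"] N
    by (intro integrable_exp_diff) auto
  have "?I = sign_avg {1..<N} (\<lambda>e. ?I)" by (simp add: sign_avg_const)
  also have "\<dots> = sign_avg {1..<N} (\<lambda>e. \<integral>U. ?g U e \<partial>\<mu>)"
    unfolding sign_avg_def
    by (intro arg_cong2[where f="(/)"] sum.cong refl integral_exp_diff_pair p orthonormal_pair_sign_vec N)
  also have "\<dots> = (\<integral>U. sign_avg {1..<N} (?g U) \<partial>\<mu>)"
    unfolding sign_avg_def using int by simp
  also have "\<dots> \<le> (\<integral>U. ?R \<partial>\<mu>)"
    using int sign_avg_exp_step[OF _ t] by (intro integral_mono) (auto simp: sign_avg_def space_haar)
  also have "\<dots> = ?R" by (simp add: prob_space)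
  finally show ?thesis .
qed

text \<open>
  A quarter turn from the first to the second column is split into \<open>n\<close> small rotations, so that
  the second order term \<open>1 - cos d\<close> of each step disappears in the limit.
\<close>

lemma integral_exp_diff_steps:
  assumes t: "t \<ge> 0" and n: "n \<ge> 1"
  shows "(\<integral>U. exp (t * (F (U *\<^sub>v unit_vec N 0) - F (U *\<^sub>v unit_vec N 1))) \<partial>\<mu>)
         \<le> exp (2 * t * L\<^sup>2 / real n + 2 * t\<^sup>2 * L\<^sup>2 / (real N - 1))"
proof -
  define d where "d = pi / (2 * real n)"
  define p where "p i = cos (real i * d) \<cdot>\<^sub>v unit_vec N 0 + sin (real i * d) \<cdot>\<^sub>v (unit_vec N 1 :: real vec)" for i
  define p' where "p' i = (- sin (real i * d)) \<cdot>\<^sub>v unit_vec N 0 + cos (real i * d) \<cdot>\<^sub>v (unit_vec N 1 :: real vec)" for i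
  have N1: "0 < N" "1 < N" using N by auto
  have pc: "p i \<in> carrier_vec N" "p' i \<in> carrier_vec N" for i by (auto simp: p_def p'_def)
  have pair: "orthonormal_pair N (p i) (p' i)" for i
  proof -
    have "scalar_prod (p i) (p' i) = 0"
      using N1 by (simp add: p_def p'_def add_scalar_prod_distrib[of _ N] scalar_prod_add_distrib[of _ N])
    then show ?thesis
      using orthonormal_pair_combination[OF orthonormal_pair_units, of "cos (real i * d)" "sin (real i * d)"]
        orthonormal_pair_combination[OF orthonormal_pair_units, of "- sin (real i * d)" "cos (real i * d)"] pc
      by (auto simp: orthonormal_pair_def p_def p'_def)
  qed
  have Suc: "p (Suc i) = cos d \<cdot>\<^sub>v p i + sin d \<cdot>\<^sub>v p' i" for i
  proof (rule eq_vecI)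
    fix k assume "k < dim_vec (cos d \<cdot>\<^sub>v p i + sin d \<cdot>\<^sub>v p' i)"
    then have k: "k < N" by (simp add: p'_def)
    have a: "real (Suc i) * d = real i * d + d" by (simp add: algebra_simps)
    show "p (Suc i) $ k = (cos d \<cdot>\<^sub>v p i + sin d \<cdot>\<^sub>v p' i) $ k"
      unfolding p_def p'_def a cos_add sin_add using k N1 by (simp add: algebra_simps)
  qed (simp add: p_def p'_def)
  have p0: "p 0 = unit_vec N 0"
    by (rule eq_vecI) (auto simp: p_def)
  have "real n * d = pi / 2" using n by (simp add: d_def)
  then have "cos (real n * d) = 0" "sin (real n * d) = 1" by (simp_all only: cos_pi_half sin_pi_half)
  then have pn: "p n = unit_vec N 1"
    by (intro eq_vecI) (auto simp: p_def)
  \<comment> \<open>The telescoping sum is the mean of \<open>real n\<close> times its terms, whence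
    the factor \<open>real n\<close> when Jensen's inequality is applied. The quadratic term stays
    bounded, as \<open>(real n)\<^sup>2 * (sin d)\<^sup>2 \<le> 4\<close>.\<close>
  let ?X = "\<lambda>i U. exp (real n * t * (F (U *\<^sub>v p i) - F (U *\<^sub>v p (Suc i))))"
  have int: "integrable \<mu> (?X i)" for i
    using pair[of i] pair[of "Suc i"] by (intro integrable_exp_diff) (auto simp: orthonormal_pair_def)
  have X: "(\<integral>U. ?X i U \<partial>\<mu>) \<le> exp (2 * t * L\<^sup>2 / real n + 2 * t\<^sup>2 * L\<^sup>2 / (real N - 1))" for i
  proof -
    have "(\<integral>U. ?X i U \<partial>\<mu>) \<le> exp (real n * t * (1 - cos d) * L\<^sup>2 + (real n * t)\<^sup>2 * (sin d)\<^sup>2 * L\<^sup>2 / (2 * (real N - 1)))"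
      unfolding Suc using t by (intro integral_exp_step pair) simp
    also have "\<dots> \<le> exp (2 * t * L\<^sup>2 / real n + 2 * t\<^sup>2 * L\<^sup>2 / (real N - 1))"
    proof -
      have d0: "0 \<le> d" by (simp add: d_def)
      have pi: "pi * pi \<le> 4 * 4" using pi_less_4 by (intro mult_mono) auto
      have nd: "(real n * d)\<^sup>2 \<le> 4"
        unfolding \<open>real n * d = pi / 2\<close> using pi by (simp add: power2_eq_square)
      have "1 - cos d \<le> d\<^sup>2 / 2"
        
        using cos_double_sin[of "d / 2"] power_mono[OF abs_sin_x_le_abs_x[of "d / 2"], of 2]
        by (simp add: power_divide)
      then have "real n * (1 - cos d) \<le> real n * (d\<^sup>2 / 2)" by (rule mult_left_mono) simp
      also have "\<dots> = (real n * d)\<^sup>2 / (2 * real n)" using n by (simp add: power2_eq_square field_simps)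
      also have "\<dots> \<le> 4 / (2 * real n)" using nd by (intro divide_right_mono) auto
      finally have 1: "real n * (1 - cos d) \<le> 2 / real n" by simp
      have "\<bar>sin d\<bar> \<le> d" using abs_sin_x_le_abs_x[of d] d0 by simp
      then have "(sin d)\<^sup>2 \<le> d\<^sup>2" by (metis abs_ge_zero power2_abs power_mono)
      then have "(real n)\<^sup>2 * (sin d)\<^sup>2 \<le> (real n)\<^sup>2 * d\<^sup>2" by (rule mult_left_mono) simp
      also have "\<dots> \<le> 4" using nd by (simp add: power_mult_distrib)
      finally have 2: "(real n)\<^sup>2 * (sin d)\<^sup>2 \<le> 4" .
      have "real n * t * (1 - cos d) * L\<^sup>2 = (real n * (1 - cos d)) * (t * L\<^sup>2)" by simp
      also have "\<dots> \<le> 2 / real n * (t * L\<^sup>2)" using 1 t by (intro mult_right_mono) auto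
      finally have 3: "real n * t * (1 - cos d) * L\<^sup>2 \<le> 2 * t * L\<^sup>2 / real n" by simp
      have "(real n * t)\<^sup>2 * (sin d)\<^sup>2 * L\<^sup>2 = ((real n)\<^sup>2 * (sin d)\<^sup>2) * (t\<^sup>2 * L\<^sup>2)"
        by (simp add: power_mult_distrib)
      also have "\<dots> \<le> 4 * (t\<^sup>2 * L\<^sup>2)" using 2 by (intro mult_right_mono) auto
      finally have "(real n * t)\<^sup>2 * (sin d)\<^sup>2 * L\<^sup>2 / (2 * (real N - 1)) \<le> 4 * (t\<^sup>2 * L\<^sup>2) / (2 * (real N - 1))"
        using N by (intro divide_right_mono) auto
      also have "\<dots> = 2 * t\<^sup>2 * L\<^sup>2 / (real N - 1)" using N by (simp add: field_simps)
      finally show ?thesis using 3 by simp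
    qed
    finally show ?thesis .
  qed
  have "(\<integral>U. exp (t * (F (U *\<^sub>v unit_vec N 0) - F (U *\<^sub>v unit_vec N 1))) \<partial>\<mu>) \<le> (\<integral>U. (\<Sum>i<n. ?X i U) / real n \<partial>\<mu>)"
  proof (rule integral_mono)
    show "integrable \<mu> (\<lambda>U. exp (t * (F (U *\<^sub>v unit_vec N 0) - F (U *\<^sub>v unit_vec N 1))))"
      using N by (intro integrable_exp_diff) auto
    show "integrable \<mu> (\<lambda>U. (\<Sum>i<n. ?X i U) / real n)" using int by auto
    fix U assume "U \<in> space \<mu>"
    have "(\<Sum>i<n. F (U *\<^sub>v p i) - F (U *\<^sub>v p (Suc i))) = F (U *\<^sub>v p 0) - F (U *\<^sub>v p n)"
      by (rule sum_lessThan_telescope')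
    then have "t * (F (U *\<^sub>v unit_vec N 0) - F (U *\<^sub>v unit_vec N 1)) =
        (\<Sum>i<n. real n * t * (F (U *\<^sub>v p i) - F (U *\<^sub>v p (Suc i)))) / real (card {..<n})"
      using n by (simp add: p0 pn sum_distrib_left[symmetric])
    then show "exp (t * (F (U *\<^sub>v unit_vec N 0) - F (U *\<^sub>v unit_vec N 1))) \<le> (\<Sum>i<n. ?X i U) / real n"
      using exp_mean_le[of "{..<n}" "\<lambda>i. real n * t * (F (U *\<^sub>v p i) - F (U *\<^sub>v p (Suc i)))"] n
      by (simp add: lessThan_empty_iff)
  qed
  also have "\<dots> = (\<Sum>i<n. \<integral>U. ?X i U \<partial>\<mu>) / real n" using int by simp
  also have "\<dots> \<le> (\<Sum>i<n. exp (2 * t * L\<^sup>2 / real n + 2 * t\<^sup>2 * L\<^sup>2 / (real N - 1))) / real n"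
    by (intro divide_right_mono sum_mono X) auto
  also have "\<dots> = exp (2 * t * L\<^sup>2 / real n + 2 * t\<^sup>2 * L\<^sup>2 / (real N - 1))" using n by simp
  finally show ?thesis .
qed

text \<open>By Jensen's inequality over the signs, subtracting \<open>C\<^sub>0\<close> from
  \<open>F\<close> at the first column is no worse than subtracting \<open>F\<close> at a random
  signed sum of the others. By invariance this sum may be exchanged for the second column, and the
  quarter turn applies.\<close>

lemma integral_exp_le:
  assumes t: "t \<ge> 0" and a: "a \<in> carrier_vec N" "scalar_prod a a = 1"
  shows "(\<integral>U. exp (t * F (U *\<^sub>v a)) \<partial>\<mu>) \<le> exp (t * C\<^sub>0 + 1 + 2 * t\<^sup>2 * L\<^sup>2 / (real N - 1))"
proof -
  let ?e0 = "unit_vec N 0 :: real vec"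
  let ?D = "\<lambda>U e. exp (t * (F (U *\<^sub>v ?e0) - F (U *\<^sub>v sign_vec N e)))"
  \<comment> \<open>Instead of passing to the limit, \<open>n\<close> is taken so large that the
    drift \<open>2 * t * L\<^sup>2 / real n\<close> is at most 1; this is the summand 1 in the
    exponent.\<close>
  obtain n :: nat where n: "2 * t * L\<^sup>2 \<le> real n" "n \<ge> 1"
    by (metis le_max_iff_disj max.cobounded1 of_nat_mono order_trans real_arch_simple max.cobounded2)
  have int: "integrable \<mu> (\<lambda>U. ?D U e)" if "e \<in> signs {1..<N}" for e
    using orthonormal_pair_sign_vec[OF N that] by (intro integrable_exp_diff) (auto simp: orthonormal_pair_def)
  have comb: "0 \<cdot>\<^sub>v ?e0 + q = q" if "q \<in> carrier_vec N" for q :: "real vec"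
    using that by (intro eq_vecI) auto
  have "(\<integral>U. exp (t * F (U *\<^sub>v a)) \<partial>\<mu>) = (\<integral>U. exp (t * F (U *\<^sub>v ?e0)) \<partial>\<mu>)"
    using N by (intro integral_exp_unit a) auto
  also have "\<dots> = exp (t * C\<^sub>0) * (\<integral>U. exp (t * (F (U *\<^sub>v ?e0) - C\<^sub>0)) \<partial>\<mu>)"
    by (simp add: right_diff_distrib exp_diff)
  also have "\<dots> \<le> exp (t * C\<^sub>0) * (\<integral>U. sign_avg {1..<N} (?D U) \<partial>\<mu>)"
  proof (intro mult_left_mono integral_mono)
    show "integrable \<mu> (\<lambda>U. exp (t * (F (U *\<^sub>v ?e0) - C\<^sub>0)))"
      using integrable_exp[of ?e0 t] N by (simp add: right_diff_distrib exp_diff)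
    show "integrable \<mu> (\<lambda>U. sign_avg {1..<N} (?D U))"
      unfolding sign_avg_def using int by auto
    fix U assume "U \<in> space \<mu>"
    then have U: "U \<in> orthogonal_group N" by (simp add: space_haar)
    have "sign_avg {1..<N} (\<lambda>e. t * (F (U *\<^sub>v ?e0) - F (U *\<^sub>v sign_vec N e))) =
        t * (F (U *\<^sub>v ?e0) - sign_avg {1..<N} (\<lambda>e. F (U *\<^sub>v sign_vec N e)))"
      by (simp add: sign_avg_cmult sign_avg_diff sign_avg_const)
    moreover have "t * (F (U *\<^sub>v ?e0) - C\<^sub>0) \<le> \<dots>"
      using F_sign_avg[OF U] t by (intro mult_left_mono) auto
    ultimately have "exp (t * (F (U *\<^sub>v ?e0) - C\<^sub>0)) \<le>
        exp (sign_avg {1..<N} (\<lambda>e. t * (F (U *\<^sub>v ?e0) - F (U *\<^sub>v sign_vec N e))))" by simp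
    also have "\<dots> \<le> sign_avg {1..<N} (?D U)" by (rule exp_sign_avg_le) simp
    finally show "exp (t * (F (U *\<^sub>v ?e0) - C\<^sub>0)) \<le> sign_avg {1..<N} (?D U)" .
  qed simp
  also have "(\<integral>U. sign_avg {1..<N} (?D U) \<partial>\<mu>) = sign_avg {1..<N} (\<lambda>e. \<integral>U. ?D U e \<partial>\<mu>)"
    unfolding sign_avg_def using int by simp
  also have "\<dots> = sign_avg {1..<N} (\<lambda>e. \<integral>U. exp (t * (F (U *\<^sub>v ?e0) - F (U *\<^sub>v unit_vec N 1))) \<partial>\<mu>)"
    unfolding sign_avg_def
  proof (intro arg_cong2[where f="(/)"] sum.cong refl)
    fix e assume e: "e \<in> signs {1..<N}"
    show "(\<integral>U. ?D U e \<partial>\<mu>) = (\<integral>U. exp (t * (F (U *\<^sub>v ?e0) - F (U *\<^sub>v unit_vec N 1))) \<partial>\<mu>)"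
      using integral_exp_diff_pair[OF orthonormal_pair_sign_vec[OF N e] orthonormal_pair_units, of t 0 1]
      by (simp add: comb)
  qed
  also have "\<dots> = (\<integral>U. exp (t * (F (U *\<^sub>v ?e0) - F (U *\<^sub>v unit_vec N 1))) \<partial>\<mu>)"
    by (simp add: sign_avg_const)
  also have "\<dots> \<le> exp (2 * t * L\<^sup>2 / real n + 2 * t\<^sup>2 * L\<^sup>2 / (real N - 1))"
    by (rule integral_exp_diff_steps[OF t n(2)])
  also have "\<dots> \<le> exp (1 + 2 * t\<^sup>2 * L\<^sup>2 / (real N - 1))"
    using n by (simp add: divide_le_eq)
  finally show ?thesis by (simp add: exp_add)
qed

lemma prob_ge_le:
  assumes a: "a \<in> carrier_vec N" "scalar_prod a a = 1" and u: "u \<ge> 0"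
  shows "prob {U \<in> space \<mu>. F (U *\<^sub>v a) \<ge> C\<^sub>0 + u} \<le> exp (1 - u\<^sup>2 * (real N - 1) / (8 * L\<^sup>2))"
proof -
  \<comment> \<open>The minimizer of
    \<open>2 * t\<^sup>2 * L\<^sup>2 / (real N - 1) - t * u\<close>, for the Chernoff bound.\<close>
  define t where "t = u * (real N - 1) / (4 * L\<^sup>2)"
  have t: "t \<ge> 0" using u N by (simp add: t_def)
  have "prob {U \<in> space \<mu>. exp (t * F (U *\<^sub>v a)) \<ge> exp (t * (C\<^sub>0 + u))} \<le>
      (\<integral>U. exp (t * F (U *\<^sub>v a)) \<partial>\<mu>) / exp (t * (C\<^sub>0 + u))"
    by (intro integral_Markov_inequality_measure[where A="{}"] integrable_exp a) auto
  also have "\<dots> \<le> exp (t * C\<^sub>0 + 1 + 2 * t\<^sup>2 * L\<^sup>2 / (real N - 1)) / exp (t * (C\<^sub>0 + u))"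
    by (intro divide_right_mono integral_exp_le t a) simp
  also have "\<dots> = exp (1 - t * u + 2 * t\<^sup>2 * L\<^sup>2 / (real N - 1))"
    by (simp add: exp_diff[symmetric] algebra_simps)
  also have "1 - t * u + 2 * t\<^sup>2 * L\<^sup>2 / (real N - 1) = 1 - u\<^sup>2 * (real N - 1) / (8 * L\<^sup>2)"
    using N L by (simp add: t_def power2_eq_square field_simps)
  finally have "prob {U \<in> space \<mu>. exp (t * F (U *\<^sub>v a)) \<ge> exp (t * (C\<^sub>0 + u))} \<le> exp (1 - u\<^sup>2 * (real N - 1) / (8 * L\<^sup>2))" .
  moreover have "prob {U \<in> space \<mu>. F (U *\<^sub>v a) \<ge> C\<^sub>0 + u} \<le> prob {U \<in> space \<mu>. exp (t * F (U *\<^sub>v a)) \<ge> exp (t * (C\<^sub>0 + u))}"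
  proof (rule finite_measure_mono)
    show "{U \<in> space \<mu>. F (U *\<^sub>v a) \<ge> C\<^sub>0 + u} \<subseteq> {U \<in> space \<mu>. exp (t * F (U *\<^sub>v a)) \<ge> exp (t * (C\<^sub>0 + u))}"
      using t by (auto intro: mult_left_mono)
    note [measurable] = F_measurable[OF a(1)]
    show "{U \<in> space \<mu>. exp (t * F (U *\<^sub>v a)) \<ge> exp (t * (C\<^sub>0 + u))} \<in> sets \<mu>" by measurable
  qed
  ultimately show ?thesis by linarith
qed

end

subsection \<open>The truncated exponential functional\<close>

text \<open>The function H of the outline. Its slope never exceeds \<open>exp \<Lambda>\<close>,
  which controls the subgradients of the energy.\<close>

definition trunc_exp :: "real \<Rightarrow> real \<Rightarrow> real" where
  "trunc_exp \<Lambda> s = exp (min s \<Lambda>) * (1 + max 0 (s - \<Lambda>)) - 1"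

text \<open>Convexity, with \<open>exp (min s \<Lambda>)\<close> as the derivative at
  \<open>s\<close>. Every case reduces to tangent inequalities for \<open>exp\<close> or to
  linearity beyond \<open>\<Lambda>\<close>.\<close>

lemma trunc_exp_subgradient: "trunc_exp \<Lambda> s - trunc_exp \<Lambda> s' \<le> exp (min s \<Lambda>) * (s - s')"
proof -
  have tangent: "exp y * (1 + (x - y)) \<le> exp x" for x y :: real
  proof -
    have "exp y * (1 + (x - y)) \<le> exp y * exp (x - y)"
      by (intro mult_left_mono exp_ge_add_one_self) auto
    then show ?thesis by (simp add: exp_diff)
  qed
  consider "s \<le> \<Lambda>" "s' \<le> \<Lambda>" | "s \<le> \<Lambda>" "s' > \<Lambda>" | "s > \<Lambda>" "s' \<le> \<Lambda>" | "s > \<Lambda>" "s' > \<Lambda>" by linarith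
  then show ?thesis
  proof cases
    case 1
    then show ?thesis using tangent[of s s'] by (simp add: trunc_exp_def algebra_simps)
  next
    case 2
    have "exp s * (s' - \<Lambda>) \<le> exp \<Lambda> * (s' - \<Lambda>)" using 2 by (intro mult_right_mono) auto
    then show ?thesis using 2 tangent[of s \<Lambda>] by (simp add: trunc_exp_def algebra_simps)
  next
    case 3
    then show ?thesis using tangent[of \<Lambda> s'] by (simp add: trunc_exp_def algebra_simps)
  next
    case 4
    then show ?thesis by (simp add: trunc_exp_def algebra_simps)
  qed
qed

lemma trunc_exp_mono: "s \<le> s' \<Longrightarrow> trunc_exp \<Lambda> s \<le> trunc_exp \<Lambda> s'"
  using trunc_exp_subgradient[of \<Lambda> s s'] by (smt (verit) exp_ge_zero mult_nonneg_nonpos)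

lemma trunc_exp_0: "\<Lambda> \<ge> 0 \<Longrightarrow> trunc_exp \<Lambda> 0 = 0"
  by (simp add: trunc_exp_def)

lemma trunc_exp_nonneg: "\<Lambda> \<ge> 0 \<Longrightarrow> s \<ge> 0 \<Longrightarrow> trunc_exp \<Lambda> s \<ge> 0"
  using trunc_exp_mono[of 0 s \<Lambda>] by (simp add: trunc_exp_0)

lemma trunc_exp_le_exp: "trunc_exp \<Lambda> s \<le> exp s - 1"
proof -
  have "exp (min s \<Lambda>) * (1 + max 0 (s - \<Lambda>)) \<le> exp (min s \<Lambda>) * exp (max 0 (s - \<Lambda>))"
    by (intro mult_left_mono exp_ge_add_one_self) auto
  also have "\<dots> = exp s" by (simp add: exp_add[symmetric] min_def max_def)
  finally show ?thesis by (simp add: trunc_exp_def)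
qed

lemma trunc_exp_le: "\<Lambda> \<ge> 0 \<Longrightarrow> s \<ge> 0 \<Longrightarrow> trunc_exp \<Lambda> s \<le> exp \<Lambda> * (1 + s)"
proof -
  assume "\<Lambda> \<ge> 0" "s \<ge> 0"
  then have "exp (min s \<Lambda>) * (1 + max 0 (s - \<Lambda>)) \<le> exp \<Lambda> * (1 + s)"
    by (intro mult_mono) auto
  then show ?thesis by (simp add: trunc_exp_def)
qed

lemma trunc_exp_ge_exp_min: "exp (min s \<Lambda>) - 1 \<le> trunc_exp \<Lambda> s"
proof -
  have "exp (min s \<Lambda>) * 1 \<le> exp (min s \<Lambda>) * (1 + max 0 (s - \<Lambda>))" by (intro mult_left_mono) auto
  then show ?thesis by (simp add: trunc_exp_def)
qed

text \<open>The source of the decay of the remainder: energy at most 1 forces the mean excess over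
  \<open>\<Lambda>\<close> below \<open>exp (- \<Lambda>)\<close>.\<close>

lemma trunc_exp_ge_excess:
  assumes "\<Lambda> \<ge> 0" "s \<ge> 0"
  shows "exp \<Lambda> * max 0 (s - \<Lambda>) \<le> trunc_exp \<Lambda> s"
proof (cases "s \<le> \<Lambda>")
  case True
  then show ?thesis using trunc_exp_nonneg[OF assms] by simp
next
  case False
  have "1 \<le> exp \<Lambda>" using assms by simp
  with False show ?thesis by (simp add: trunc_exp_def algebra_simps)
qed

section \<open>Linear combinations of the system and their energy\<close>

locale bounded_system = T: prob_space T for T :: "'a measure" +
  fixes N :: nat and \<phi> :: "nat \<Rightarrow> 'a \<Rightarrow> real"
  assumes orthonormal: "orthonormal_system T N \<phi>"
    and square_sum_le: "\<And>x. x \<in> space T \<Longrightarrow> (\<Sum>n<N. \<bar>\<phi> n x\<bar>\<^sup>2) \<le> real N"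
begin

definition lin :: "real vec \<Rightarrow> 'a \<Rightarrow> real" where
  "lin b x = (\<Sum>i<N. b $ i * \<phi> i x)"

lemma measurable_phi [measurable]: "i < N \<Longrightarrow> \<phi> i \<in> borel_measurable T"
  using orthonormal by (auto simp: orthonormal_system_def L2_functions_def)

lemma measurable_lin [measurable]: "lin b \<in> borel_measurable T"
  unfolding lin_def by measurable

lemma sq_sum_eq: "b \<in> carrier_vec N \<Longrightarrow> (\<Sum>i<N. (b $ i)\<^sup>2) = scalar_prod b (b :: real vec)"
  by (simp add: scalar_prod_def power2_eq_square lessThan_atLeast0)

lemma abs_phi_le: "i < N \<Longrightarrow> x \<in> space T \<Longrightarrow> \<bar>\<phi> i x\<bar> \<le> sqrt (real N)"
proof -
  assume "i < N" and x: "x \<in> space T"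
  then have "\<bar>\<phi> i x\<bar>\<^sup>2 \<le> (\<Sum>n<N. \<bar>\<phi> n x\<bar>\<^sup>2)" by (intro member_le_sum) auto
  also have "\<dots> \<le> real N" by (rule square_sum_le[OF x])
  finally show ?thesis by (rule real_le_rsqrt)
qed

lemma lin_square_le:
  assumes b: "b \<in> carrier_vec N" and x: "x \<in> space T"
  shows "(lin b x)\<^sup>2 \<le> scalar_prod b b * real N"
proof -
  have "(lin b x)\<^sup>2 \<le> (\<Sum>i<N. (b $ i)\<^sup>2) * (\<Sum>i<N. (\<phi> i x)\<^sup>2)"
    unfolding lin_def by (rule Cauchy_Schwarz_ineq_sum)
  also have "\<dots> \<le> (\<Sum>i<N. (b $ i)\<^sup>2) * real N"
    using square_sum_le[OF x] by (intro mult_left_mono sum_nonneg) auto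
  finally show ?thesis using sq_sum_eq[OF b] by simp
qed

lemma integrable_bounded:
  assumes "f \<in> borel_measurable T" "\<And>x. x \<in> space T \<Longrightarrow> \<bar>f x\<bar> \<le> (B::real)"
  shows "integrable T f"
  using assms by (intro T.integrable_const_bound[where B = B]) auto

lemma integrable_lin_mult:
  assumes "f \<in> borel_measurable T" "\<And>x. x \<in> space T \<Longrightarrow> \<bar>f x\<bar> \<le> (B::real)" "i < N"
  shows "integrable T (\<lambda>x. f x * \<phi> i x)"
proof (rule integrable_bounded)
  show "\<bar>f x * \<phi> i x\<bar> \<le> B * sqrt (real N)" if "x \<in> space T" for x
    using assms(2)[OF that] abs_phi_le[OF assms(3) that]
    by (auto simp: abs_mult intro!: mult_mono intro: order_trans[OF abs_ge_zero])
qed (use assms in measurable)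

lemma abs_lin_le: "b \<in> carrier_vec N \<Longrightarrow> x \<in> space T \<Longrightarrow> \<bar>lin b x\<bar> \<le> sqrt (scalar_prod b b * real N)"
  using lin_square_le by (intro real_le_rsqrt) simp

text \<open>The vector of Fourier coefficients of \<open>f\<close> represents integration against
  \<open>f\<close> on the span of the system. For a suitable \<open>f\<close> it becomes the
  subgradient of the energy.\<close>

lemma integral_mult_lin:
  assumes "f \<in> borel_measurable T" "\<And>x. x \<in> space T \<Longrightarrow> \<bar>f x\<bar> \<le> (B::real)" and c: "c \<in> carrier_vec N"
  shows "(\<integral>x. f x * lin c x \<partial>T) = scalar_prod (vec N (\<lambda>i. \<integral>x. f x * \<phi> i x \<partial>T)) c"
proof -
  have "(\<integral>x. f x * lin c x \<partial>T) = (\<integral>x. (\<Sum>i<N. c $ i * (f x * \<phi> i x)) \<partial>T)"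
    by (simp add: lin_def sum_distrib_left mult_ac)
  also have "\<dots> = (\<Sum>i<N. c $ i * (\<integral>x. f x * \<phi> i x \<partial>T))"
    using integrable_lin_mult[OF assms(1,2)] by simp
  finally show ?thesis using c by (simp add: scalar_prod_def lessThan_atLeast0 mult.commute)
qed

lemma integral_lin_lin:
  assumes b: "b \<in> carrier_vec N" and c: "c \<in> carrier_vec N"
  shows "(\<integral>x. lin b x * lin c x \<partial>T) = scalar_prod b c"
proof -
  have "vec N (\<lambda>i. \<integral>x. lin b x * \<phi> i x \<partial>T) = b"
  proof (rule eq_vecI)
    fix i assume "i < dim_vec b"
    then have i: "i < N" using b by simp
    have u: "unit_vec N i \<in> carrier_vec N" by simp
    have "lin (unit_vec N i) x = \<phi> i x" for x
      using i by (simp add: lin_def if_distrib[of "\<lambda>z. z * _"] cong: if_cong)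
    then have "(\<integral>x. lin b x * \<phi> i x \<partial>T) = (\<integral>x. \<phi> i x * lin b x \<partial>T)"
      by (simp add: mult.commute)
    also have "\<dots> = scalar_prod (vec N (\<lambda>j. \<integral>x. \<phi> i x * \<phi> j x \<partial>T)) b"
      by (rule integral_mult_lin[OF measurable_phi[OF i] abs_phi_le[OF i] b])
    also have "vec N (\<lambda>j. \<integral>x. \<phi> i x * \<phi> j x \<partial>T) = unit_vec N i"
      using orthonormal i by (intro eq_vecI) (auto simp: orthonormal_system_def)
    finally show "vec N (\<lambda>i. \<integral>x. lin b x * \<phi> i x \<partial>T) $ i = b $ i"
      using i b by simp
  qed (use b in simp)
  then show ?thesis using integral_mult_lin[OF measurable_lin abs_lin_le[OF b] c] b by simp
qed

text \<open>The constant 12 is large enough for \<open>sign_avg_energy\<close> below.\<close>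

definition energy :: "real \<Rightarrow> real vec \<Rightarrow> real" where
  "energy \<Lambda> b = (\<integral>x. trunc_exp \<Lambda> ((lin b x)\<^sup>2 / 12) \<partial>T)"

lemma trunc_exp_measurable [measurable]: "trunc_exp \<Lambda> \<in> borel_measurable borel"
  unfolding trunc_exp_def by measurable

lemma trunc_exp_lin_le:
  assumes "\<Lambda> \<ge> 0" "b \<in> carrier_vec N" "x \<in> space T"
  shows "\<bar>trunc_exp \<Lambda> ((lin b x)\<^sup>2 / 12)\<bar> \<le> exp \<Lambda> * (1 + scalar_prod b b * real N / 12)"
proof -
  have "trunc_exp \<Lambda> ((lin b x)\<^sup>2 / 12) \<le> exp \<Lambda> * (1 + (lin b x)\<^sup>2 / 12)"
    using assms by (intro trunc_exp_le) auto
  also have "\<dots> \<le> exp \<Lambda> * (1 + scalar_prod b b * real N / 12)"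
    using lin_square_le[OF assms(2,3)] by simp
  finally show ?thesis using trunc_exp_nonneg[OF assms(1), of "(lin b x)\<^sup>2 / 12"] by simp
qed

lemma integrable_energy:
  assumes "\<Lambda> \<ge> 0" "b \<in> carrier_vec N"
  shows "integrable T (\<lambda>x. trunc_exp \<Lambda> ((lin b x)\<^sup>2 / 12))"
  using trunc_exp_lin_le[OF assms] by (intro integrable_bounded) auto

lemma energy_nonneg: "\<Lambda> \<ge> 0 \<Longrightarrow> 0 \<le> energy \<Lambda> b"
  unfolding energy_def by (intro Bochner_Integration.integral_nonneg trunc_exp_nonneg) auto

lemma energy_le:
  assumes "\<Lambda> \<ge> 0" "b \<in> carrier_vec N"
  shows "energy \<Lambda> b \<le> exp \<Lambda> * (1 + scalar_prod b b * real N / 12)"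
proof -
  have "energy \<Lambda> b \<le> (\<integral>x. exp \<Lambda> * (1 + scalar_prod b b * real N / 12) \<partial>T)"
    unfolding energy_def using trunc_exp_lin_le[OF assms] integrable_energy[OF assms]
    by (intro integral_mono) (auto intro: order_trans[OF abs_ge_self])
  then show ?thesis by (simp add: T.prob_space)
qed

lemma lin_diff: "b \<in> carrier_vec N \<Longrightarrow> c \<in> carrier_vec N \<Longrightarrow> lin (b - c) x = lin b x - lin c x"
  by (simp add: lin_def left_diff_distrib sum_subtractf)

lemma lin_smult: "b \<in> carrier_vec N \<Longrightarrow> lin (r \<cdot>\<^sub>v b) x = r * lin b x"
  by (simp add: lin_def sum_distrib_left mult_ac)

lemma energy_smult_le:
  assumes "\<Lambda> \<ge> 0" "b \<in> carrier_vec N" "\<bar>r\<bar> \<le> 1"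
  shows "energy \<Lambda> (r \<cdot>\<^sub>v b) \<le> energy \<Lambda> b"
  unfolding energy_def
proof (rule integral_mono[OF integrable_energy integrable_energy])
  fix x
  have "r\<^sup>2 * (lin b x)\<^sup>2 \<le> 1 * (lin b x)\<^sup>2"
    using assms(3) by (intro mult_right_mono) (auto simp: abs_square_le_1)
  then show "trunc_exp \<Lambda> ((lin (r \<cdot>\<^sub>v b) x)\<^sup>2 / 12) \<le> trunc_exp \<Lambda> ((lin b x)\<^sup>2 / 12)"
    using assms(2) by (intro trunc_exp_mono) (simp add: lin_smult power_mult_distrib)
qed (use assms in auto)

text \<open>Here \<open>w x\<close> is the derivative of
  \<open>trunc_exp \<Lambda> (y\<^sup>2 / 12)\<close> at \<open>y = lin b x\<close>, and
  \<open>v\<close> collects its Fourier coefficients. The subgradient inequality combines the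
  convexity of \<open>trunc_exp\<close> with that of the square; the length of \<open>v\<close> is
  bounded by Bessel's inequality.\<close>

lemma energy_subgradient:
  assumes "\<Lambda> \<ge> 0" and b: "b \<in> carrier_vec N" and bb: "scalar_prod b b = 1"
  shows "\<exists>v\<in>carrier_vec N. scalar_prod v v \<le> (exp \<Lambda>)\<^sup>2 \<and>
    (\<forall>b'\<in>carrier_vec N. energy \<Lambda> b - energy \<Lambda> b' \<le> scalar_prod v (b - b'))"
proof -
  define w where "w x = exp (min ((lin b x)\<^sup>2 / 12) \<Lambda>) * (lin b x / 6)" for x
  define v where "v = vec N (\<lambda>i. \<integral>x. w x * \<phi> i x \<partial>T)"
  define B where "B = exp \<Lambda> * sqrt (scalar_prod b b * real N)"
  have w_meas [measurable]: "w \<in> borel_measurable T" unfolding w_def by measurable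
  have w_le: "\<bar>w x\<bar> \<le> exp \<Lambda> * \<bar>lin b x\<bar>" for x
  proof -
    have "\<bar>w x\<bar> = exp (min ((lin b x)\<^sup>2 / 12) \<Lambda>) * (\<bar>lin b x\<bar> / 6)" by (simp add: w_def abs_mult)
    also have "\<dots> \<le> exp \<Lambda> * \<bar>lin b x\<bar>" by (intro mult_mono) auto
    finally show ?thesis .
  qed
  have w_bound: "\<bar>w x\<bar> \<le> B" if "x \<in> space T" for x
  proof -
    have "\<bar>w x\<bar> \<le> exp \<Lambda> * \<bar>lin b x\<bar>" by (rule w_le)
    also have "\<dots> \<le> B" unfolding B_def by (intro mult_left_mono abs_lin_le b that) simp
    finally show ?thesis .
  qed
  have v: "v \<in> carrier_vec N" by (simp add: v_def)
  have int: "(\<integral>x. w x * lin c x \<partial>T) = scalar_prod v c" if "c \<in> carrier_vec N" for c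
    unfolding v_def by (rule integral_mult_lin[OF w_meas w_bound that])
  have int_wl: "integrable T (\<lambda>x. w x * lin c x)" if "c \<in> carrier_vec N" for c
  proof (rule integrable_bounded)
    show "\<bar>w x * lin c x\<bar> \<le> B * sqrt (scalar_prod c c * real N)" if "x \<in> space T" for x
      using w_bound[OF that] abs_lin_le[OF \<open>c \<in> _\<close> that]
      by (auto simp: abs_mult intro!: mult_mono intro: order_trans[OF abs_ge_zero])
  qed simp
  have int_ll: "integrable T (\<lambda>x. lin c x * lin c x)" if "c \<in> carrier_vec N" for c
    using lin_square_le[OF that] by (intro integrable_bounded) (auto simp: power2_eq_square abs_mult)
  \<comment> \<open>Bessel's inequality: \<open>scalar_prod v v\<close> is the integral of
    \<open>w x * lin v x\<close>, at most half the integral of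
    \<open>(w x)\<^sup>2 + (lin v x)\<^sup>2\<close>. The second square integrates to
    \<open>scalar_prod v v\<close> again and is moved to the left.\<close>
  have "scalar_prod v v \<le> (exp \<Lambda>)\<^sup>2"
  proof -
    have "scalar_prod v v = (\<integral>x. w x * lin v x \<partial>T)" using int[OF v] by simp
    also have "\<dots> \<le> (\<integral>x. ((exp \<Lambda>)\<^sup>2 * (lin b x * lin b x) + lin v x * lin v x) / 2 \<partial>T)"
    proof (rule integral_mono[OF int_wl[OF v]])
      show "integrable T (\<lambda>x. ((exp \<Lambda>)\<^sup>2 * (lin b x * lin b x) + lin v x * lin v x) / 2)"
        using int_ll[OF b] int_ll[OF v] by auto
      fix x
      have "0 \<le> (w x - lin v x)\<^sup>2" by simp
      moreover have "(w x)\<^sup>2 \<le> (exp \<Lambda> * \<bar>lin b x\<bar>)\<^sup>2"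
        using w_le[of x] by (metis abs_ge_zero power2_abs power_mono)
      ultimately show "w x * lin v x \<le> ((exp \<Lambda>)\<^sup>2 * (lin b x * lin b x) + lin v x * lin v x) / 2"
        by (simp add: power2_diff power_mult_distrib) (simp add: power2_eq_square)
    qed
    also have "\<dots> = ((exp \<Lambda>)\<^sup>2 * scalar_prod b b + scalar_prod v v) / 2"
      using int_ll[OF b] int_ll[OF v] by (simp add: integral_lin_lin b v)
    finally show ?thesis using bb by simp
  qed
  moreover have "energy \<Lambda> b - energy \<Lambda> b' \<le> scalar_prod v (b - b')" if b': "b' \<in> carrier_vec N" for b'
  proof -
    have "energy \<Lambda> b - energy \<Lambda> b' = (\<integral>x. trunc_exp \<Lambda> ((lin b x)\<^sup>2 / 12) - trunc_exp \<Lambda> ((lin b' x)\<^sup>2 / 12) \<partial>T)"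
      unfolding energy_def using integrable_energy[OF assms(1) b] integrable_energy[OF assms(1) b'] by simp
    also have "\<dots> \<le> (\<integral>x. w x * lin (b - b') x \<partial>T)"
    proof (rule integral_mono)
      show "integrable T (\<lambda>x. trunc_exp \<Lambda> ((lin b x)\<^sup>2 / 12) - trunc_exp \<Lambda> ((lin b' x)\<^sup>2 / 12))"
        using integrable_energy[OF assms(1) b] integrable_energy[OF assms(1) b'] by simp
      show "integrable T (\<lambda>x. w x * lin (b - b') x)" using b b' by (intro int_wl) auto
      fix x
      define E where "E = exp (min ((lin b x)\<^sup>2 / 12) \<Lambda>)"
      have "trunc_exp \<Lambda> ((lin b x)\<^sup>2 / 12) - trunc_exp \<Lambda> ((lin b' x)\<^sup>2 / 12)
          \<le> E * ((lin b x)\<^sup>2 / 12 - (lin b' x)\<^sup>2 / 12)"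
        unfolding E_def by (rule trunc_exp_subgradient)
      also have "\<dots> \<le> E * (lin b x / 6 * (lin b x - lin b' x))"
      proof (rule mult_left_mono)
        have "0 \<le> (lin b x - lin b' x)\<^sup>2" by simp
        then show "(lin b x)\<^sup>2 / 12 - (lin b' x)\<^sup>2 / 12 \<le> lin b x / 6 * (lin b x - lin b' x)"
          by (simp add: power2_eq_square algebra_simps)
      qed (simp add: E_def)
      finally show "trunc_exp \<Lambda> ((lin b x)\<^sup>2 / 12) - trunc_exp \<Lambda> ((lin b' x)\<^sup>2 / 12) \<le> w x * lin (b - b') x"
        by (simp add: w_def E_def[symmetric] lin_diff[OF b b'] mult.assoc)
    qed
    also have "\<dots> = scalar_prod v (b - b')" using b b' by (intro int) auto
    finally show ?thesis .
  qed
  ultimately show ?thesis using v by blast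
qed

text \<open>The average over signs is taken inside the integral. For fixed \<open>x\<close> the
  value is an inner product with the vector of the \<open>\<phi> i x\<close>, whose squared length
  is at most \<open>N\<close>, hence at most \<open>2 * (real N - 1)\<close>.\<close>

lemma sign_avg_energy:
  assumes "\<Lambda> \<ge> 0" "N \<ge> 2" and U: "U \<in> orthogonal_group N"
  shows "sign_avg {1..<N} (\<lambda>e. energy \<Lambda> (U *\<^sub>v sign_vec N e)) \<le> 1 / 2"
proof -
  let ?s = "\<lambda>e. U *\<^sub>v sign_vec N e"
  have s: "?s e \<in> carrier_vec N" for e using orthogonal_groupD[OF U] by simp
  have "sign_avg {1..<N} (\<lambda>e. energy \<Lambda> (?s e)) = (\<integral>x. sign_avg {1..<N} (\<lambda>e. trunc_exp \<Lambda> ((lin (?s e) x)\<^sup>2 / 12)) \<partial>T)"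
    unfolding energy_def sign_avg_def using integrable_energy[OF assms(1) s] by simp
  also have "\<dots> \<le> (\<integral>x. 1 / 2 \<partial>T)"
  proof (rule integral_mono)
    show "integrable T (\<lambda>x. sign_avg {1..<N} (\<lambda>e. trunc_exp \<Lambda> ((lin (?s e) x)\<^sup>2 / 12)))"
      unfolding sign_avg_def using integrable_energy[OF assms(1) s] by auto
    fix x assume x: "x \<in> space T"
    define v where "v = vec N (\<lambda>i. \<phi> i x)"
    have v: "v \<in> carrier_vec N" by (simp add: v_def)
    have lin: "lin b x = scalar_prod v b" if "b \<in> carrier_vec N" for b
      using that by (simp add: lin_def v_def scalar_prod_def lessThan_atLeast0 mult.commute)
    have "scalar_prod v v \<le> real N"
      using square_sum_le[OF x] by (simp add: v_def scalar_prod_def lessThan_atLeast0 power2_eq_square)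
    also have "\<dots> \<le> 2 * (real N - 1)" using assms(2) by simp
    finally have "scalar_prod v v / (real N - 1) \<le> 2" using assms(2) by (simp add: divide_le_eq)
    \<comment> \<open>With variance bound 2 and \<open>K = 12\<close> the exponent is 1/4, and
      \<open>exp (1 / 4)\<close> is at most 4/3.\<close>
    then have "sign_avg {1..<N} (\<lambda>e. exp ((lin (?s e) x)\<^sup>2 / 12)) \<le> exp (2 / (12 - 2 * 2))"
      unfolding lin[OF s] by (intro sign_avg_exp_square_rotated assms v) auto
    also have "\<dots> \<le> 3 / 2"
    proof -
      have "1 - 1 / 4 \<le> exp (- (1 / 4 :: real))" using exp_ge_add_one_self[of "- (1 / 4 :: real)"] by simp
      then show ?thesis by (simp add: exp_minus field_simps)
    qed
    finally have "sign_avg {1..<N} (\<lambda>e. exp ((lin (?s e) x)\<^sup>2 / 12)) - sign_avg {1..<N} (\<lambda>e. 1) \<le> 1 / 2"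
      by (simp add: sign_avg_const)
    then show "sign_avg {1..<N} (\<lambda>e. trunc_exp \<Lambda> ((lin (?s e) x)\<^sup>2 / 12)) \<le> 1 / 2"
      unfolding sign_avg_diff[symmetric]
      by (rule order_trans[rotated]) (intro sign_avg_mono trunc_exp_le_exp)
  qed simp
  finally show ?thesis by (simp add: T.prob_space)
qed

end

section \<open>Concentration and stability of the energy of a rotated vector\<close>

locale rotated_bounded_system = bounded_system T N \<phi> + haar N \<mu>
  for T :: "'a measure" and N \<phi> \<mu> +
  fixes \<Lambda> :: real
  assumes \<Lambda>: "\<Lambda> \<ge> 0" and N2: "N \<ge> 2"
begin

lemma energy_rotated_measurable:
  assumes a: "a \<in> carrier_vec N"
  shows "(\<lambda>U. energy \<Lambda> (U *\<^sub>v a)) \<in> borel_measurable \<mu>"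
proof -
  \<comment> \<open>The entries are written out so that joint measurability in \<open>U\<close> and
    \<open>x\<close> is visible; it then passes to the parameter integral.\<close>
  define g where "g U x = (\<Sum>i<N. (\<Sum>j<N. U $$ (i, j) * a $ j) * \<phi> i x)" for U :: "real mat" and x
  have "(\<lambda>(U, x). trunc_exp \<Lambda> ((g U x)\<^sup>2 / 12)) \<in> borel_measurable (\<mu> \<Otimes>\<^sub>M T)"
    unfolding g_def by measurable
  then have "(\<lambda>U. \<integral>x. trunc_exp \<Lambda> ((g U x)\<^sup>2 / 12) \<partial>T) \<in> borel_measurable \<mu>"
    by (rule T.borel_measurable_lebesgue_integral)
  moreover have "energy \<Lambda> (U *\<^sub>v a) = (\<integral>x. trunc_exp \<Lambda> ((g U x)\<^sup>2 / 12) \<partial>T)" if "U \<in> space \<mu>" for U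
  proof -
    have U: "U \<in> carrier_mat N N" using that by (auto simp: space_haar dest: orthogonal_groupD)
    have "lin (U *\<^sub>v a) x = g U x" for x
      unfolding lin_def g_def using U a by (intro sum.cong) (auto simp: scalar_prod_def lessThan_atLeast0)
    then show ?thesis by (simp add: energy_def)
  qed
  ultimately show ?thesis by (simp cong: measurable_cong)
qed

sublocale haar_functional N \<mu> "energy \<Lambda>" "exp \<Lambda>" "exp \<Lambda> * (1 + real N / 12)" "1 / 2"
proof
  show "\<bar>energy \<Lambda> b\<bar> \<le> exp \<Lambda> * (1 + real N / 12)" if "b \<in> carrier_vec N" "scalar_prod b b = 1" for b
    using energy_le[OF \<Lambda> that(1)] energy_nonneg[OF \<Lambda>, of b] that(2) by simp
qed (use \<Lambda> N2 energy_rotated_measurable sign_avg_energy in \<open>auto intro: energy_subgradient\<close>)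

text \<open>The target 1 for the energy is split into 1/2 for the mean, 1/4 for the deviation here
  and 1/4 for the approximation in \<open>energy_perturb\<close>. Lattice vectors may be shorter
  than 1; normalizing them can only increase the energy.\<close>

lemma prob_energy_ge_le:
  assumes a: "a \<in> carrier_vec N" "scalar_prod a a \<le> 1"
  shows "prob {U \<in> space \<mu>. energy \<Lambda> (U *\<^sub>v a) \<ge> 3 / 4} \<le> exp (1 - (real N - 1) / (128 * (exp \<Lambda>)\<^sup>2))"
proof (cases "scalar_prod a a = 0")
  \<comment> \<open>The lattice contains the origin, which cannot be normalized.\<close>
  case True
  have "energy \<Lambda> (U *\<^sub>v a) = 0" if "U \<in> space \<mu>" for U
  proof -
    have U: "U \<in> carrier_mat N N" using that by (auto simp: space_haar dest: orthogonal_groupD)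
    have "U *\<^sub>v a = 0\<^sub>v N" using scalar_prod_self_eq_0[OF a(1) True] U
      by (auto intro!: eq_vecI simp: scalar_prod_def)
    then show ?thesis by (simp add: energy_def lin_def trunc_exp_0 \<Lambda>)
  qed
  then have "{U \<in> space \<mu>. energy \<Lambda> (U *\<^sub>v a) \<ge> 3 / 4} = {}" by auto
  then show ?thesis by (simp only: measure_empty exp_ge_zero)
next
  case False
  define r where "r = sqrt (scalar_prod a a)"
  have aa: "scalar_prod a a \<ge> 0" using a(1) by (auto simp: scalar_prod_def intro!: sum_nonneg)
  have r: "0 < r" "r \<le> 1" "r * r = scalar_prod a a" using False aa a(2) by (auto simp: r_def)
  define a' where "a' = (1 / r) \<cdot>\<^sub>v a"
  have a': "a' \<in> carrier_vec N" "scalar_prod a' a' = 1" "a = r \<cdot>\<^sub>v a'"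
    using a(1) r by (auto simp: a'_def intro!: eq_vecI)
  have "prob {U \<in> space \<mu>. energy \<Lambda> (U *\<^sub>v a) \<ge> 3 / 4} \<le> prob {U \<in> space \<mu>. energy \<Lambda> (U *\<^sub>v a') \<ge> 1 / 2 + 1 / 4}"
  proof (rule finite_measure_mono)
    note [measurable] = energy_rotated_measurable[OF a'(1)]
    show "{U \<in> space \<mu>. energy \<Lambda> (U *\<^sub>v a') \<ge> 1 / 2 + 1 / 4} \<in> sets \<mu>" by measurable
    have "energy \<Lambda> (U *\<^sub>v a) \<le> energy \<Lambda> (U *\<^sub>v a')" if "U \<in> space \<mu>" for U
    proof -
      have U: "U \<in> carrier_mat N N" using that by (auto simp: space_haar dest: orthogonal_groupD)
      have "U *\<^sub>v a = r \<cdot>\<^sub>v (U *\<^sub>v a')" unfolding a'(3) using U a'(1) by (rule mult_mat_vec)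
      then show ?thesis using energy_smult_le[OF \<Lambda>, of "U *\<^sub>v a'" r] U a'(1) r by simp
    qed
    then show "{U \<in> space \<mu>. energy \<Lambda> (U *\<^sub>v a) \<ge> 3 / 4} \<subseteq> {U \<in> space \<mu>. energy \<Lambda> (U *\<^sub>v a') \<ge> 1 / 2 + 1 / 4}"
      by force
  qed
  also have "\<dots> \<le> exp (1 - (1 / 4)\<^sup>2 * (real N - 1) / (8 * (exp \<Lambda>)\<^sup>2))"
    by (intro prob_ge_le a') simp
  finally show ?thesis by (simp add: power2_eq_square)
qed

text \<open>The subgradient is taken at the unit vector \<open>U *\<^sub>v a\<close>, where its
  length is at most \<open>exp \<Lambda>\<close>; the approximation \<open>a'\<close> may have any
  length.\<close>

lemma energy_perturb:
  assumes U: "U \<in> orthogonal_group N"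
    and a: "a \<in> carrier_vec N" "scalar_prod a a = 1" and a': "a' \<in> carrier_vec N"
    and close: "scalar_prod (a - a') (a - a') \<le> 1 / (4 * exp \<Lambda>)\<^sup>2"
  shows "energy \<Lambda> (U *\<^sub>v a) \<le> energy \<Lambda> (U *\<^sub>v a') + 1 / 4"
proof -
  define M where "M = exp \<Lambda>"
  have M: "0 < M" by (simp add: M_def)
  note U' = orthogonal_groupD[OF U]
  define w where "w = U *\<^sub>v a - U *\<^sub>v a'"
  have w: "w \<in> carrier_vec N" using U' a a' by (simp add: w_def)
  have "w = U *\<^sub>v (a - a')" using U' a a' by (simp add: w_def mult_minus_distrib_mat_vec[of _ N N])
  then have ww: "scalar_prod w w \<le> 1 / (4 * M)\<^sup>2"
    using close orthogonal_scalar_prod[OF U, of "a - a'" "a - a'"] a a' by (simp add: M_def)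
  obtain v where v: "v \<in> carrier_vec N" "scalar_prod v v \<le> M\<^sup>2"
      "energy \<Lambda> (U *\<^sub>v a) - energy \<Lambda> (U *\<^sub>v a') \<le> scalar_prod v w"
  proof -
    have "U *\<^sub>v a \<in> carrier_vec N" "scalar_prod (U *\<^sub>v a) (U *\<^sub>v a) = 1"
      using orthogonal_scalar_prod[OF U a(1) a(1)] a U' by auto
    then obtain v where "v \<in> carrier_vec N" "scalar_prod v v \<le> M\<^sup>2"
      "\<forall>b'\<in>carrier_vec N. energy \<Lambda> (U *\<^sub>v a) - energy \<Lambda> b' \<le> scalar_prod v (U *\<^sub>v a - b')"
      using energy_subgradient[OF \<Lambda>] unfolding M_def by blast
    moreover have "U *\<^sub>v a' \<in> carrier_vec N" using U' a' by auto
    ultimately show thesis using that unfolding w_def by blast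
  qed
  \<comment> \<open>A weighted form of Cauchy-Schwarz; the weights make each of the two squares
    contribute at most 1/4.\<close>
  have "0 \<le> scalar_prod ((1 / (2 * M)) \<cdot>\<^sub>v v - (2 * M) \<cdot>\<^sub>v w) ((1 / (2 * M)) \<cdot>\<^sub>v v - (2 * M) \<cdot>\<^sub>v w)"
    by (auto simp: scalar_prod_def intro!: sum_nonneg)
  also have "\<dots> = scalar_prod v v / (4 * M\<^sup>2) - 2 * scalar_prod v w + 4 * M\<^sup>2 * scalar_prod w w"
    using v w M comm_scalar_prod[OF w v(1)]
    by (simp add: minus_scalar_prod_distrib[of _ N] scalar_prod_minus_distrib[of _ N])
       (simp add: power2_eq_square field_simps)
  finally have "2 * scalar_prod v w \<le> scalar_prod v v / (4 * M\<^sup>2) + 4 * M\<^sup>2 * scalar_prod w w" by simp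
  also have "\<dots> \<le> M\<^sup>2 / (4 * M\<^sup>2) + 4 * M\<^sup>2 * (1 / (4 * M)\<^sup>2)"
    using v ww M by (intro add_mono divide_right_mono mult_left_mono) auto
  also have "\<dots> = 1 / 2" using M by (simp add: power2_eq_square)
  finally show ?thesis using v(3) by simp
qed

end

subsection \<open>Sparse vectors\<close>

text \<open>A two-sided geometric sum, the contribution of one coordinate to the weighted count of
  lattice points.\<close>

lemma sum_power_abs_le:
  fixes x :: real
  assumes "0 < x" "x \<le> 1 / 2"
  shows "(\<Sum>k\<in>{- int R..int R}. x ^ nat \<bar>k\<bar>) \<le> 1 + 4 * x"
proof -
  have "(\<Sum>k\<in>{- int R..int R}. x ^ nat \<bar>k\<bar>) * (1 - x) = 1 + x - 2 * x ^ Suc R"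
  proof (induction R)
    case (Suc R)
    have "{- int (Suc R)..int (Suc R)} = insert (- int (Suc R)) (insert (int (Suc R)) {- int R..int R})"
      by auto
    then have "(\<Sum>k\<in>{- int (Suc R)..int (Suc R)}. x ^ nat \<bar>k\<bar>) =
        2 * x ^ Suc R + (\<Sum>k\<in>{- int R..int R}. x ^ nat \<bar>k\<bar>)"
      by (simp add: nat_add_distrib)
    then have "(\<Sum>k\<in>{- int (Suc R)..int (Suc R)}. x ^ nat \<bar>k\<bar>) * (1 - x) =
        2 * x ^ Suc R * (1 - x) + (1 + x - 2 * x ^ Suc R)"
      using Suc.IH by (simp only: distrib_right)
    then show ?case by (simp add: algebra_simps)
  qed simp
  also have "\<dots> \<le> 1 + x" using assms by simp
  also have "\<dots> \<le> (1 + 4 * x) * (1 - x)"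
  proof -
    have "x * x \<le> x * (1 / 2)" using assms by (intro mult_left_mono) auto
    then show ?thesis by (simp add: algebra_simps)
  qed
  finally show ?thesis using assms by simp
qed

text \<open>The integer points of an l1 ball. The box exhibits them as part of a finite product,
  over which the weights of the count factorize.\<close>

definition lattice_ball :: "nat \<Rightarrow> nat \<Rightarrow> (nat \<Rightarrow> int) set" where
  "lattice_ball N R = {z \<in> {..<N} \<rightarrow>\<^sub>E {- int R..int R}. (\<Sum>i<N. \<bar>z i\<bar>) \<le> int R}"

lemma finite_lattice_ball: "finite (lattice_ball N R)"
  unfolding lattice_ball_def by (rule finite_subset[of _ "{..<N} \<rightarrow>\<^sub>E {- int R..int R}"]) (auto intro!: finite_PiE)

text \<open>Rankin's trick: each lattice point \<open>z\<close> is counted with the weight \<open>x\<close> to the power \<open>\<bar>z\<bar>\<^sub>1 - R\<close>.\<close>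

lemma card_lattice_ball_le:
  fixes x :: real
  assumes x: "0 < x" "x \<le> 1 / 2"
  shows "real (card (lattice_ball N R)) \<le> (1 / x) ^ R * exp (4 * x * real N)"
proof -
  let ?P = "{..<N} \<rightarrow>\<^sub>E {- int R..int R}"
  have "real (card (lattice_ball N R)) = (\<Sum>z\<in>lattice_ball N R. 1)" by simp
  also have "\<dots> \<le> (\<Sum>z\<in>lattice_ball N R. (1 / x) ^ R * (\<Prod>i<N. x ^ nat \<bar>z i\<bar>))"
  proof (rule sum_mono)
    fix z assume z: "z \<in> lattice_ball N R"
    have "int (\<Sum>i<N. nat \<bar>z i\<bar>) \<le> int R" using z by (simp add: lattice_ball_def)
    then have "(\<Sum>i<N. nat \<bar>z i\<bar>) \<le> R" by (simp only: of_nat_le_iff)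
    then have "x ^ R \<le> x ^ (\<Sum>i<N. nat \<bar>z i\<bar>)" using x by (intro power_decreasing) auto
    then have "(1 / x) ^ R * x ^ R \<le> (1 / x) ^ R * x ^ (\<Sum>i<N. nat \<bar>z i\<bar>)"
      using x by (intro mult_left_mono) auto
    moreover have "(1 / x) ^ R * x ^ R = 1" using x by (simp add: power_one_over)
    ultimately show "1 \<le> (1 / x) ^ R * (\<Prod>i<N. x ^ nat \<bar>z i\<bar>)" by (simp add: power_sum)
  qed
  also have "\<dots> \<le> (\<Sum>z\<in>?P. (1 / x) ^ R * (\<Prod>i<N. x ^ nat \<bar>z i\<bar>))"
  proof (rule sum_mono2)
    show "finite ?P" by (simp add: finite_PiE)
    show "lattice_ball N R \<subseteq> ?P" by (auto simp only: lattice_ball_def)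
    show "0 \<le> (1 / x) ^ R * (\<Prod>i<N. x ^ nat \<bar>z i\<bar>)" for z
      using x by (intro mult_nonneg_nonneg prod_nonneg) auto
  qed
  also have "\<dots> = (1 / x) ^ R * (\<Prod>i<N. \<Sum>k\<in>{- int R..int R}. x ^ nat \<bar>k\<bar>)"
    by (subst prod_sum_PiE) (auto simp: sum_distrib_left)
  also have "\<dots> \<le> (1 / x) ^ R * (exp (4 * x)) ^ N"
  proof (rule mult_left_mono)
    have "(\<Sum>k\<in>{- int R..int R}. x ^ nat \<bar>k\<bar>) \<le> exp (4 * x)"
      using sum_power_abs_le[OF x, of R] exp_ge_add_one_self[of "4 * x"] by linarith
    then show "(\<Prod>i<N. \<Sum>k\<in>{- int R..int R}. x ^ nat \<bar>k\<bar>) \<le> (exp (4 * x)) ^ N"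
      using x by (simp add: power_mono sum_nonneg)
  qed (use x in simp)
  also have "(exp (4 * x)) ^ N = exp (4 * x * real N)" by (simp add: exp_of_nat_mult[symmetric] mult.commute)
  finally show ?thesis .
qed

text \<open>Unlike rounding to the nearest integer, this never increases absolute values, so neither
  the l1 norm nor the Euclidean norm of the rounded vector grows.\<close>

definition round_to_zero :: "real \<Rightarrow> int" where
  "round_to_zero u = (if u \<ge> 0 then \<lfloor>u\<rfloor> else - \<lfloor>- u\<rfloor>)"

lemma abs_round_to_zero_le: "\<bar>real_of_int (round_to_zero u)\<bar> \<le> \<bar>u\<bar>"
proof (cases "u \<ge> 0")
  case True
  then have "0 \<le> real_of_int \<lfloor>u\<rfloor>" by simp
  then show ?thesis using True of_int_floor_le[of u] by (simp add: round_to_zero_def)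
next
  case False
  then have "0 \<le> real_of_int \<lfloor>- u\<rfloor>" by (simp only: of_int_0_le_iff zero_le_floor)
  then show ?thesis using False of_int_floor_le[of "- u"] unfolding round_to_zero_def by simp
qed

lemma abs_diff_round_to_zero_le: "\<bar>u - real_of_int (round_to_zero u)\<bar> \<le> 1"
proof (cases "u \<ge> 0")
  case True
  have "\<bar>u - real_of_int \<lfloor>u\<rfloor>\<bar> \<le> 1" by linarith
  with True show ?thesis by (simp add: round_to_zero_def)
next
  case False
  have "\<bar>u - real_of_int (- \<lfloor>- u\<rfloor>)\<bar> \<le> 1" by linarith
  with False show ?thesis unfolding round_to_zero_def by (simp only: if_False)
qed

lemma round_to_zero_0 [simp]: "round_to_zero 0 = 0"
  by (simp add: round_to_zero_def)

definition lattice_vec :: "nat \<Rightarrow> real \<Rightarrow> (nat \<Rightarrow> int) \<Rightarrow> real vec" where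
  "lattice_vec N \<rho> z = vec N (\<lambda>i. \<rho> * real_of_int (z i))"

lemma lattice_vec_carrier [simp]: "lattice_vec N \<rho> z \<in> carrier_vec N"
  by (simp add: lattice_vec_def)

text \<open>Sparsity enters twice. By Cauchy-Schwarz on the support the l1 norm of \<open>a\<close>
  is at most \<open>sqrt (real m)\<close>, which bounds the radius of the ball; and the rounding
  error, at most \<open>\<rho>\<close> per coordinate, occurs only on the support.\<close>

lemma sparse_vector_approx:
  fixes \<rho> :: real and a :: "real vec"
  assumes a: "a \<in> carrier_vec N" "scalar_prod a a = 1" and m: "card {i. i < N \<and> a $ i \<noteq> 0} \<le> m"
    and \<rho>: "\<rho> > 0"
  shows "\<exists>z\<in>lattice_ball N (nat \<lfloor>sqrt (real m) / \<rho>\<rfloor>).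
    scalar_prod (lattice_vec N \<rho> z) (lattice_vec N \<rho> z) \<le> 1 \<and>
    scalar_prod (a - lattice_vec N \<rho> z) (a - lattice_vec N \<rho> z) \<le> real m * \<rho>\<^sup>2"
proof -
  define S where "S = {i. i < N \<and> a $ i \<noteq> 0}"
  have S: "finite S" "card S \<le> m" "S \<subseteq> {..<N}" using m by (auto simp: S_def)
  define z where "z = restrict (\<lambda>i. round_to_zero (a $ i / \<rho>)) {..<N}"
  define R where "R = nat \<lfloor>sqrt (real m) / \<rho>\<rfloor>"
  have z: "\<rho> * \<bar>real_of_int (z i)\<bar> \<le> \<bar>a $ i\<bar>" "\<bar>a $ i - \<rho> * real_of_int (z i)\<bar> \<le> \<rho>" if "i < N" for i
  proof -
    have "\<rho> * \<bar>real_of_int (z i)\<bar> \<le> \<rho> * \<bar>a $ i / \<rho>\<bar>"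
      using that \<rho> abs_round_to_zero_le[of "a $ i / \<rho>"] by (intro mult_left_mono) (auto simp: z_def)
    then show "\<rho> * \<bar>real_of_int (z i)\<bar> \<le> \<bar>a $ i\<bar>" using \<rho> by (simp add: abs_divide)
    have "\<rho> * \<bar>a $ i / \<rho> - real_of_int (z i)\<bar> \<le> \<rho> * 1"
      using that \<rho> abs_diff_round_to_zero_le[of "a $ i / \<rho>"] by (intro mult_left_mono) (auto simp: z_def)
    moreover have "\<rho> * \<bar>a $ i / \<rho> - real_of_int (z i)\<bar> = \<bar>\<rho> * (a $ i / \<rho> - real_of_int (z i))\<bar>"
      using \<rho> by (simp add: abs_mult)
    moreover have "\<rho> * (a $ i / \<rho> - real_of_int (z i)) = a $ i - \<rho> * real_of_int (z i)"
      using \<rho> by (simp add: right_diff_distrib)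
    ultimately show "\<bar>a $ i - \<rho> * real_of_int (z i)\<bar> \<le> \<rho>" by simp
  qed
  have z0: "z i = 0" if "i \<in> {..<N} - S" for i using that by (auto simp: z_def S_def)
  have sq: "(\<Sum>i<N. (a $ i)\<^sup>2) = 1" using a by (simp add: scalar_prod_def lessThan_atLeast0 power2_eq_square)
  have l1: "(\<Sum>i<N. \<bar>a $ i\<bar>) \<le> sqrt (real m)"
  proof (rule real_le_rsqrt)
    have "(\<Sum>i<N. \<bar>a $ i\<bar>) = (\<Sum>i\<in>S. \<bar>a $ i\<bar> * 1)"
      by (simp, rule sum.mono_neutral_right) (use S in \<open>auto simp: S_def\<close>)
    then have "(\<Sum>i<N. \<bar>a $ i\<bar>)\<^sup>2 \<le> (\<Sum>i\<in>S. \<bar>a $ i\<bar>\<^sup>2) * (\<Sum>i\<in>S. 1\<^sup>2)"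
      by (simp only:) (rule Cauchy_Schwarz_ineq_sum)
    also have "\<dots> \<le> (\<Sum>i<N. (a $ i)\<^sup>2) * real m"
      using S by (intro mult_mono) (auto intro!: sum_mono2 sum_nonneg)
    finally show "(\<Sum>i<N. \<bar>a $ i\<bar>)\<^sup>2 \<le> real m" using sq by simp
  qed
  have sum_z: "(\<Sum>i<N. \<bar>z i\<bar>) \<le> int R"
  proof -
    have "\<rho> * (\<Sum>i<N. \<bar>real_of_int (z i)\<bar>) \<le> (\<Sum>i<N. \<bar>a $ i\<bar>)"
      unfolding sum_distrib_left using z(1) by (intro sum_mono) auto
    then have "(\<Sum>i<N. \<bar>real_of_int (z i)\<bar>) \<le> sqrt (real m) / \<rho>"
      using l1 \<rho> by (simp add: pos_le_divide_eq mult.commute)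
    then have "real_of_int (\<Sum>i<N. \<bar>z i\<bar>) \<le> sqrt (real m) / \<rho>" by simp
    then have "(\<Sum>i<N. \<bar>z i\<bar>) \<le> \<lfloor>sqrt (real m) / \<rho>\<rfloor>" by (simp only: le_floor_iff)
    moreover have "0 \<le> sqrt (real m) / \<rho>" using \<rho> by simp
    ultimately show ?thesis by (simp add: R_def)
  qed
  have "z \<in> lattice_ball N R"
  proof -
    have "\<bar>z i\<bar> \<le> int R" if "i < N" for i
    proof -
      have "\<bar>z i\<bar> \<le> (\<Sum>i<N. \<bar>z i\<bar>)" using that by (intro member_le_sum) auto
      then show ?thesis using sum_z by simp
    qed
    then have "z i \<in> {- int R..int R}" if "i < N" for i using that by (force simp: abs_le_iff)
    then have "z \<in> {..<N} \<rightarrow>\<^sub>E {- int R..int R}" by (auto simp: z_def)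
    then show ?thesis using sum_z by (simp add: lattice_ball_def)
  qed
  moreover have "scalar_prod (lattice_vec N \<rho> z) (lattice_vec N \<rho> z) \<le> 1"
  proof -
    have "scalar_prod (lattice_vec N \<rho> z) (lattice_vec N \<rho> z) = (\<Sum>i<N. (\<rho> * \<bar>real_of_int (z i)\<bar>)\<^sup>2)"
      by (simp add: lattice_vec_def scalar_prod_def lessThan_atLeast0 power_mult_distrib)
         (simp add: power2_eq_square mult_ac)
    also have "\<dots> \<le> (\<Sum>i<N. \<bar>a $ i\<bar>\<^sup>2)"
      using z(1) \<rho> by (intro sum_mono power_mono) auto
    finally show ?thesis using sq by simp
  qed
  moreover have "scalar_prod (a - lattice_vec N \<rho> z) (a - lattice_vec N \<rho> z) \<le> real m * \<rho>\<^sup>2"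
  proof -
    have "scalar_prod (a - lattice_vec N \<rho> z) (a - lattice_vec N \<rho> z) = (\<Sum>i<N. (a $ i - \<rho> * real_of_int (z i))\<^sup>2)"
      using a by (simp add: lattice_vec_def scalar_prod_def lessThan_atLeast0 power2_eq_square)
    also have "\<dots> = (\<Sum>i\<in>S. (a $ i - \<rho> * real_of_int (z i))\<^sup>2)"
      using S z0 by (intro sum.mono_neutral_right) (auto simp: S_def)
    also have "\<dots> \<le> (\<Sum>i\<in>S. \<rho>\<^sup>2)"
    proof (rule sum_mono)
      fix i assume "i \<in> S"
      then have "\<bar>a $ i - \<rho> * real_of_int (z i)\<bar>\<^sup>2 \<le> \<rho>\<^sup>2"
        using z(2) S by (intro power_mono) auto
      then show "(a $ i - \<rho> * real_of_int (z i))\<^sup>2 \<le> \<rho>\<^sup>2" by simp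
    qed
    also have "\<dots> \<le> real m * \<rho>\<^sup>2" using S by (simp add: mult_right_mono)
    finally show ?thesis .
  qed
  ultimately show ?thesis unfolding R_def by blast
qed

section \<open>Uniform control over sparse unit vectors\<close>

context rotated_bounded_system
begin

text \<open>A union bound over lattice vectors of length at most 1 at threshold 3/4, followed by
  approximation at cost 1/4. The positive terms of the exponent, apart from the 1 of the tail bound,
  are the logarithm of the bound for the number of lattice points.\<close>

lemma sparse_energy_event:
  assumes m: "1 \<le> m" "m \<le> N"
  shows "\<exists>Q\<in>sets \<mu>. prob (space \<mu> - Q) \<le>
      exp (4 * exp \<Lambda> * real m * ln (2 * real N / real m) + 2 * real m + 1 - (real N - 1) / (128 * (exp \<Lambda>)\<^sup>2)) \<and>
    (\<forall>U\<in>Q. \<forall>a\<in>carrier_vec N. scalar_prod a a = 1 \<longrightarrow> card {i. i < N \<and> (a :: real vec) $ i \<noteq> 0} \<le> m \<longrightarrow>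
       energy \<Lambda> (U *\<^sub>v a) \<le> 1)"
proof -
  define M where "M = exp \<Lambda>"
  have M: "M > 0" by (simp add: M_def)
  \<comment> \<open>Chosen so that the error \<open>real m * \<rho>\<^sup>2\<close> is exactly the
    one allowed by \<open>energy_perturb\<close>.\<close>
  define \<rho> where "\<rho> = 1 / (4 * M * sqrt (real m))"
  have \<rho>: "\<rho> > 0" using M m by (simp add: \<rho>_def)
  have \<rho>1: "sqrt (real m) / \<rho> = 4 * M * real m" using m M by (simp add: \<rho>_def)
  have \<rho>2: "real m * \<rho>\<^sup>2 = 1 / (4 * M)\<^sup>2" using m M by (simp add: \<rho>_def power_mult_distrib power_divide)
  define R where "R = nat \<lfloor>4 * M * real m\<rfloor>"
  define Z where "Z = {z \<in> lattice_ball N R. scalar_prod (lattice_vec N \<rho> z) (lattice_vec N \<rho> z) \<le> 1}"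
  define bad where "bad z = {U \<in> space \<mu>. energy \<Lambda> (U *\<^sub>v lattice_vec N \<rho> z) \<ge> 3 / 4}" for z
  define P where "P = exp (1 - (real N - 1) / (128 * M\<^sup>2))"
  have fin: "finite Z" using finite_lattice_ball by (simp add: Z_def)
  have bad [measurable]: "bad z \<in> sets \<mu>" for z
  proof -
    note [measurable] = energy_rotated_measurable[OF lattice_vec_carrier[of N \<rho> z]]
    show ?thesis unfolding bad_def by measurable
  qed
  have "prob (\<Union>z\<in>Z. bad z) \<le> (\<Sum>z\<in>Z. prob (bad z))"
    by (rule finite_measure_subadditive_finite[OF fin]) auto
  also have "\<dots> \<le> (\<Sum>z\<in>Z. P)"
    unfolding bad_def P_def M_def by (intro sum_mono prob_energy_ge_le) (auto simp: Z_def)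
  also have "\<dots> \<le> real (card (lattice_ball N R)) * P"
    using card_mono[OF finite_lattice_ball, of Z N R] by (auto simp: Z_def P_def intro!: mult_right_mono)
  \<comment> \<open>The count is used with \<open>x = real m / (2 * real N)\<close>, so that
    \<open>exp (4 * x * real N)\<close> is just \<open>exp (2 * real m)\<close>.\<close>
  also have "\<dots> \<le> ((1 / (real m / (2 * real N))) ^ R * exp (4 * (real m / (2 * real N)) * real N)) * P"
    using m by (intro mult_right_mono card_lattice_ball_le) (auto simp: P_def)
  also have "\<dots> \<le> exp (4 * M * real m * ln (2 * real N / real m)) * exp (2 * real m) * P"
  proof (intro mult_mono)
    define q where "q = 2 * real N / real m"
    have q: "q \<ge> 1" using m by (simp add: q_def)
    have "(1 / (real m / (2 * real N))) ^ R = q powr real R"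
      using q by (simp add: q_def powr_realpow)
    also have "\<dots> \<le> q powr (4 * M * real m)"
      using q M by (intro powr_mono) (auto simp: R_def)
    also have "\<dots> = exp (4 * M * real m * ln q)" using q by (simp add: powr_def)
    finally show "(1 / (real m / (2 * real N))) ^ R \<le> exp (4 * M * real m * ln (2 * real N / real m))"
      by (simp add: q_def)
  qed (use m in \<open>auto simp: P_def\<close>)
  also have "\<dots> = exp (4 * M * real m * ln (2 * real N / real m) + 2 * real m + 1 - (real N - 1) / (128 * M\<^sup>2))"
    by (simp add: P_def exp_add[symmetric] add_diff_eq)
  finally have prob: "prob (\<Union>z\<in>Z. bad z) \<le> \<dots>" .
  have un: "(\<Union>z\<in>Z. bad z) \<in> sets \<mu>" using fin by auto
  have "energy \<Lambda> (U *\<^sub>v a) \<le> 1" if U: "U \<in> space \<mu> - (\<Union>z\<in>Z. bad z)" and a: "a \<in> carrier_vec N" "scalar_prod a a = 1"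
    and c: "card {i. i < N \<and> a $ i \<noteq> 0} \<le> m" for U and a :: "real vec"
  proof -
    from sparse_vector_approx[OF a c \<rho>]
    obtain z where "z \<in> lattice_ball N R" "scalar_prod (lattice_vec N \<rho> z) (lattice_vec N \<rho> z) \<le> 1"
      "scalar_prod (a - lattice_vec N \<rho> z) (a - lattice_vec N \<rho> z) \<le> 1 / (4 * M)\<^sup>2"
      unfolding \<rho>1 \<rho>2 R_def[symmetric] by (elim bexE conjE)
    then have z: "z \<in> Z" "scalar_prod (a - lattice_vec N \<rho> z) (a - lattice_vec N \<rho> z) \<le> 1 / (4 * M)\<^sup>2"
      by (simp_all add: Z_def)
    have "energy \<Lambda> (U *\<^sub>v lattice_vec N \<rho> z) < 3 / 4" using U z(1) by (auto simp: bad_def)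
    moreover have "energy \<Lambda> (U *\<^sub>v a) \<le> energy \<Lambda> (U *\<^sub>v lattice_vec N \<rho> z) + 1 / 4"
      using U z(2) a by (intro energy_perturb) (auto simp: space_haar M_def)
    ultimately show ?thesis by simp
  qed
  moreover have "space \<mu> - (space \<mu> - (\<Union>z\<in>Z. bad z)) = (\<Union>z\<in>Z. bad z)"
    using sets.sets_into_space[OF un] by blast
  ultimately show ?thesis using prob un unfolding M_def
    by (intro bexI[of _ "space \<mu> - (\<Union>z\<in>Z. bad z)"]) auto
qed

end

section \<open>Truncation of a combination of small energy\<close>

context bounded_system
begin

lemma norm_L2_lin:
  assumes "b \<in> carrier_vec N"
  shows "norm_L2 T (lin b) = sqrt (scalar_prod b b)"
  using integral_lin_lin[OF assms assms] by (simp add: norm_L2_def power2_eq_square)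

text \<open>The truncation height satisfies \<open>l\<^sup>2 / 12 = \<Lambda>\<close>. Below it the
  Orlicz integrand is dominated by that of the energy; above it the squared remainder is at most
  \<open>(lin b x)\<^sup>2 - l\<^sup>2\<close>, and \<open>trunc_exp_ge_excess\<close> applies. The
  constant 4 serves both bounds since \<open>12 \<le> 4\<^sup>2\<close>.\<close>

lemma decompose_unit:
  assumes \<Lambda>: "\<Lambda> \<ge> 0" and b: "b \<in> carrier_vec N" and e: "energy \<Lambda> b \<le> 1" and r: "r > 0"
  shows "\<exists>G E. G \<in> borel_measurable T \<and> E \<in> L2_functions T \<and>
    (\<forall>x\<in>space T. r * lin b x = G x + E x) \<and>
    norm_Orlicz T G \<le> ennreal (4 * r) \<and> norm_L2 T E \<le> 4 * exp (- \<Lambda> / 2) * r"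
proof -
  define l where "l = sqrt (12 * \<Lambda>)"
  have l: "l \<ge> 0" "l\<^sup>2 = 12 * \<Lambda>" using \<Lambda> by (auto simp: l_def)
  define g where "g x = max (- l) (min l (lin b x))" for x
  define G where "G x = r * g x" for x
  define E where "E x = r * (lin b x - g x)" for x
  have [measurable]: "g \<in> borel_measurable T" unfolding g_def by measurable
  have G_meas: "G \<in> borel_measurable T" unfolding G_def by measurable
  have E_meas [measurable]: "E \<in> borel_measurable T" unfolding E_def by measurable
  have te_meas: "(\<lambda>x. trunc_exp \<Lambda> ((lin b x)\<^sup>2 / 12)) \<in> borel_measurable T" by measurable
  have g_sq: "(g x)\<^sup>2 / 12 = min ((lin b x)\<^sup>2 / 12) \<Lambda>" for x
  proof (cases "\<bar>lin b x\<bar> \<le> l")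
    case True
    then have "(lin b x)\<^sup>2 \<le> l\<^sup>2" by (metis abs_ge_zero power2_abs power_mono)
    moreover have "g x = lin b x" using True by (auto simp: g_def)
    ultimately show ?thesis using l by simp
  next
    case False
    then have "l\<^sup>2 \<le> \<bar>lin b x\<bar>\<^sup>2" using l by (intro power_mono) auto
    moreover have "\<bar>g x\<bar> = l" using False l by (auto simp: g_def)
    then have "(g x)\<^sup>2 = l\<^sup>2" by (metis power2_abs)
    ultimately show ?thesis using l by simp
  qed
  have rem_sq: "(lin b x - g x)\<^sup>2 \<le> 12 * max 0 ((lin b x)\<^sup>2 / 12 - \<Lambda>)" for x
  proof (cases "\<bar>lin b x\<bar> \<le> l")
    case True
    then have "g x = lin b x" by (auto simp: g_def)
    then show ?thesis by simp
  next
    case False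
    then have "\<bar>lin b x - g x\<bar> = \<bar>lin b x\<bar> - l" using l by (auto simp: g_def)
    then have "(lin b x - g x)\<^sup>2 = (\<bar>lin b x\<bar> - l)\<^sup>2" by (metis power2_abs)
    also have "\<dots> \<le> (\<bar>lin b x\<bar> - l) * (\<bar>lin b x\<bar> + l)"
      unfolding power2_eq_square using False l by (intro mult_left_mono) auto
    also have "\<dots> = (lin b x)\<^sup>2 - l\<^sup>2" by (simp add: algebra_simps power2_eq_square)
    also have "\<dots> = 12 * ((lin b x)\<^sup>2 / 12 - \<Lambda>)" using l by simp
    also have "\<dots> \<le> 12 * max 0 ((lin b x)\<^sup>2 / 12 - \<Lambda>)" by (intro mult_left_mono) auto
    finally show ?thesis .
  qed
  have Orlicz: "norm_Orlicz T G \<le> ennreal (4 * r)"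
  proof -
    have "(\<integral>\<^sup>+x. ennreal (exp (\<bar>G x / (4 * r)\<bar>\<^sup>2) - 1) \<partial>T) \<le> (\<integral>\<^sup>+x. ennreal (trunc_exp \<Lambda> ((lin b x)\<^sup>2 / 12)) \<partial>T)"
    proof (intro nn_integral_mono ennreal_leI)
      fix x
      have "\<bar>G x / (4 * r)\<bar>\<^sup>2 = (g x)\<^sup>2 / 16" using r by (simp add: G_def power_divide power_mult_distrib)
      also have "\<dots> \<le> (g x)\<^sup>2 / 12" by simp
      finally have "exp (\<bar>G x / (4 * r)\<bar>\<^sup>2) - 1 \<le> exp (min ((lin b x)\<^sup>2 / 12) \<Lambda>) - 1" by (simp add: g_sq)
      also have "\<dots> \<le> trunc_exp \<Lambda> ((lin b x)\<^sup>2 / 12)" by (rule trunc_exp_ge_exp_min)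
      finally show "exp (\<bar>G x / (4 * r)\<bar>\<^sup>2) - 1 \<le> trunc_exp \<Lambda> ((lin b x)\<^sup>2 / 12)" .
    qed
    also have "\<dots> = ennreal (energy \<Lambda> b)"
      unfolding energy_def using integrable_energy[OF \<Lambda> b] trunc_exp_nonneg[OF \<Lambda>]
      by (intro nn_integral_eq_integral) auto
    also have "\<dots> \<le> 1" using e by simp
    finally show ?thesis unfolding norm_Orlicz_def using r by (intro Inf_lower) auto
  qed
  have E_sq: "\<bar>E x\<bar>\<^sup>2 \<le> 12 * r\<^sup>2 * exp (- \<Lambda>) * trunc_exp \<Lambda> ((lin b x)\<^sup>2 / 12)" for x
  proof -
    have "\<bar>E x\<bar>\<^sup>2 = r\<^sup>2 * (lin b x - g x)\<^sup>2" by (simp add: E_def power_mult_distrib)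
    also have "\<dots> \<le> r\<^sup>2 * (12 * max 0 ((lin b x)\<^sup>2 / 12 - \<Lambda>))" by (intro mult_left_mono rem_sq) simp
    also have "\<dots> = 12 * r\<^sup>2 * exp (- \<Lambda>) * (exp \<Lambda> * max 0 ((lin b x)\<^sup>2 / 12 - \<Lambda>))"
      by (simp add: exp_minus)
    also have "\<dots> \<le> 12 * r\<^sup>2 * exp (- \<Lambda>) * trunc_exp \<Lambda> ((lin b x)\<^sup>2 / 12)"
      by (intro mult_left_mono trunc_exp_ge_excess \<Lambda>) auto
    finally show ?thesis .
  qed
  have int: "integrable T (\<lambda>x. 12 * r\<^sup>2 * exp (- \<Lambda>) * trunc_exp \<Lambda> ((lin b x)\<^sup>2 / 12))"
    using integrable_energy[OF \<Lambda> b] by simp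
  have E_int: "integrable T (\<lambda>x. \<bar>E x\<bar>\<^sup>2)"
  proof (rule Bochner_Integration.integrable_bound[OF int])
    show "AE x in T. norm (\<bar>E x\<bar>\<^sup>2) \<le> norm (12 * r\<^sup>2 * exp (- \<Lambda>) * trunc_exp \<Lambda> ((lin b x)\<^sup>2 / 12))"
      using E_sq by (intro AE_I2) (auto intro: order_trans[OF _ abs_ge_self])
  qed measurable
  have "(\<integral>x. \<bar>E x\<bar>\<^sup>2 \<partial>T) \<le> (\<integral>x. 12 * r\<^sup>2 * exp (- \<Lambda>) * trunc_exp \<Lambda> ((lin b x)\<^sup>2 / 12) \<partial>T)"
    by (intro integral_mono E_int int E_sq)
  also have "\<dots> = 12 * r\<^sup>2 * exp (- \<Lambda>) * energy \<Lambda> b" by (simp add: energy_def)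
  also have "\<dots> \<le> 12 * r\<^sup>2 * exp (- \<Lambda>) * 1" using e by (intro mult_left_mono) auto
  also have "\<dots> \<le> (4 * exp (- \<Lambda> / 2) * r)\<^sup>2"
    by (simp add: power_mult_distrib exp_double[symmetric])
  finally have "norm_L2 T E \<le> 4 * exp (- \<Lambda> / 2) * r"
    unfolding norm_L2_def using r by (intro real_le_lsqrt) auto
  then show ?thesis using Orlicz G_meas E_meas E_int
    by (intro exI[of _ G] exI[of _ E]) (auto simp: L2_functions_def G_def E_def algebra_simps)
qed

end

subsection \<open>Decomposition and choice of constants\<close>

lemma norm_Orlicz_zero: "norm_Orlicz M (\<lambda>_. 0) = 0"
proof -
  have "norm_Orlicz M (\<lambda>_. 0) \<le> 0"
  proof (rule ennreal_le_epsilon)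
    fix e :: real assume "0 < e"
    then have "norm_Orlicz M (\<lambda>_. 0) \<le> ennreal e"
      unfolding norm_Orlicz_def by (intro Inf_lower) auto
    then show "norm_Orlicz M (\<lambda>_. 0) \<le> 0 + ennreal e" by simp
  qed
  then show ?thesis by simp
qed

section \<open>From unit vectors to arbitrary coefficients of the rotated system\<close>

context bounded_system
begin

lemma lin_L2: "b \<in> carrier_vec N \<Longrightarrow> lin b \<in> L2_functions T"
  using lin_square_le by (auto simp: L2_functions_def intro!: integrable_bounded)

lemma sum_rotated_system:
  assumes U: "U \<in> carrier_mat N N"
  shows "(\<Sum>n<N. a n * rotated_system N U \<phi> n x) = lin (U *\<^sub>v vec N a) x"
proof -
  have "(\<Sum>n<N. a n * rotated_system N U \<phi> n x) = (\<Sum>i<N. \<Sum>n<N. a n * (U $$ (i, n) * \<phi> i x))"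
    unfolding rotated_system_def sum_distrib_left by (rule sum.swap)
  also have "\<dots> = lin (U *\<^sub>v vec N a) x"
    unfolding lin_def
  proof (intro sum.cong refl)
    fix i assume "i \<in> {..<N}"
    then have "(U *\<^sub>v vec N a) $ i = (\<Sum>n<N. U $$ (i, n) * a n)"
      using U by (simp add: scalar_prod_def lessThan_atLeast0)
    then show "(\<Sum>n<N. a n * (U $$ (i, n) * \<phi> i x)) = (U *\<^sub>v vec N a) $ i * \<phi> i x"
      by (simp add: sum_distrib_left mult_ac)
  qed
  finally show ?thesis .
qed

lemma orthonormal_rotated_system:
  assumes U: "U \<in> orthogonal_group N"
  shows "orthonormal_system T N (rotated_system N U \<phi>)"
proof -
  note U' = orthogonal_groupD[OF U]
  have rot: "rotated_system N U \<phi> n = lin (U *\<^sub>v unit_vec N n)" if "n < N" for n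
  proof
    fix x
    have "vec N (\<lambda>k. if k = n then 1 else 0) = (unit_vec N n :: real vec)"
      by (rule eq_vecI) (auto simp: unit_vec_def)
    then show "rotated_system N U \<phi> n x = lin (U *\<^sub>v unit_vec N n) x"
      using sum_rotated_system[OF U'(1), of "\<lambda>k. if k = n then 1 else 0" x] that
      by (simp add: if_distrib[of "\<lambda>z. z * _"] cong: if_cong)
  qed
  show ?thesis
    unfolding orthonormal_system_def
  proof (intro conjI allI impI)
    fix n assume "n < N"
    then show "rotated_system N U \<phi> n \<in> L2_functions T" using U' by (simp add: rot lin_L2)
  next
    fix i j assume ij: "i < N" "j < N"
    have "(\<integral>x. rotated_system N U \<phi> i x * rotated_system N U \<phi> j x \<partial>T) =
        scalar_prod (U *\<^sub>v unit_vec N i) (U *\<^sub>v unit_vec N j)"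
      using ij U' by (simp add: rot integral_lin_lin)
    also have "\<dots> = scalar_prod (unit_vec N i) (unit_vec N j)"
      by (intro orthogonal_scalar_prod[OF U]) auto
    also have "\<dots> = (if i = j then 1 else 0)" using ij by auto
    finally show "(\<integral>x. rotated_system N U \<phi> i x * rotated_system N U \<phi> j x \<partial>T) = (if i = j then 1 else 0)" .
  qed
qed

text \<open>For \<open>y * real m \<le> real N\<close> the normalized vector is decomposed with
  \<open>\<Lambda> = ln (real N / real m) / 10\<close>, so \<open>exp (- \<Lambda> / 2)\<close> is
  the power 1/20 of \<open>real m / real N\<close>. For larger \<open>m\<close> that power is at
  least \<open>1 / y\<close>, and \<open>E = f\<close> satisfies the bound because the constant
  contains \<open>y\<close>.\<close>

lemma decomposition_property_rotated_system:
  assumes U: "U \<in> orthogonal_group N" and N: "N \<ge> 1" and y: "y \<ge> 1"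
    and good: "\<And>m a. 1 \<le> m \<Longrightarrow> y * real m \<le> real N \<Longrightarrow> a \<in> carrier_vec N \<Longrightarrow> scalar_prod a a = 1 \<Longrightarrow>
      card {i. i < N \<and> (a :: real vec) $ i \<noteq> 0} \<le> m \<Longrightarrow> energy (ln (real N / real m) / 10) (U *\<^sub>v a) \<le> 1"
  shows "decomposition_property (4 + y) (1 / 20) T N (rotated_system N U \<phi>)"
  unfolding decomposition_property_def Let_def
proof
  fix a :: "nat \<Rightarrow> real"
  note U' = orthogonal_groupD[OF U]
  define v where "v = vec N a"
  define b where "b = U *\<^sub>v v"
  define m where "m = card {n. n < N \<and> a n \<noteq> 0}"
  define r where "r = sqrt (scalar_prod v v)"
  have v: "v \<in> carrier_vec N" by (simp add: v_def)
  have b: "b \<in> carrier_vec N" using U' v by (simp add: b_def)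
  have f: "(\<lambda>x. \<Sum>n<N. a n * rotated_system N U \<phi> n x) = lin b"
    by (simp add: sum_rotated_system[OF U'(1)] b_def v_def)
  have norm: "norm_L2 T (lin b) = r"
    using orthogonal_scalar_prod[OF U v v] unfolding norm_L2_lin[OF b] by (simp add: b_def r_def)
  have vv: "scalar_prod v v \<ge> 0" by (auto simp: scalar_prod_def intro!: sum_nonneg)
  have r: "r \<ge> 0" "r * r = scalar_prod v v" using vv by (auto simp: r_def)
  have "\<exists>G E. G \<in> borel_measurable T \<and> E \<in> L2_functions T \<and> (\<forall>x\<in>space T. lin b x = G x + E x) \<and>
      norm_Orlicz T G \<le> ennreal ((4 + y) * r) \<and> norm_L2 T E \<le> (4 + y) * (real m / real N) powr (1 / 20) * r"
  proof (cases "1 \<le> m \<and> y * real m \<le> real N \<and> r > 0")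
    case True
    define \<Lambda> where "\<Lambda> = ln (real N / real m) / 10"
    have r0: "r > 0" using True by (elim conjE)
    have "real m \<le> y * real m" using y True by simp
    then have "real m \<le> real N" using True by linarith
    then have q: "1 \<le> real N / real m" using True by simp
    then have \<Lambda>: "\<Lambda> \<ge> 0" by (simp add: \<Lambda>_def)
    define u where "u = (1 / r) \<cdot>\<^sub>v v"
    have u: "u \<in> carrier_vec N" using v by (simp add: u_def)
    have "scalar_prod u u = (1 / r) * ((1 / r) * scalar_prod v v)" using v by (simp add: u_def)
    also have "\<dots> = (1 / r) * ((1 / r) * (r * r))" by (simp only: r(2))
    also have "\<dots> = 1" using r0 by simp
    finally have uu: "scalar_prod u u = 1" .
    have "{i. i < N \<and> u $ i \<noteq> 0} = {n. n < N \<and> a n \<noteq> 0}" using True by (auto simp: u_def v_def)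
    then have "energy \<Lambda> (U *\<^sub>v u) \<le> 1" 
      unfolding \<Lambda>_def using True by (intro good u uu) (simp_all add: m_def)
    moreover have "U *\<^sub>v u \<in> carrier_vec N" using U' u by simp
    ultimately obtain G E where GE: "G \<in> borel_measurable T" "E \<in> L2_functions T"
      "\<forall>x\<in>space T. r * lin (U *\<^sub>v u) x = G x + E x" "norm_Orlicz T G \<le> ennreal (4 * r)"
      "norm_L2 T E \<le> 4 * exp (- \<Lambda> / 2) * r"
      using decompose_unit[OF \<Lambda>, of "U *\<^sub>v u" r] True by blast
    have "U *\<^sub>v u = (1 / r) \<cdot>\<^sub>v b" unfolding u_def b_def using U'(1) v by (rule mult_mat_vec)
    then have "r * lin (U *\<^sub>v u) x = lin b x" for x using True by (simp add: lin_smult[OF b])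
    moreover have "exp (- \<Lambda> / 2) = (real m / real N) powr (1 / 20)"
    proof -
      have "ln (real m / real N) = - ln (real N / real m)" using q True N by (simp add: ln_div)
      then show ?thesis using True N by (simp add: powr_def \<Lambda>_def)
    qed
    moreover have "ennreal (4 * r) \<le> ennreal ((4 + y) * r)"
      using r y by (intro ennreal_leI mult_right_mono) auto
    moreover have "4 * (real m / real N) powr (1 / 20) * r \<le> (4 + y) * (real m / real N) powr (1 / 20) * r"
      using r y by (intro mult_right_mono) auto
    ultimately show ?thesis using GE by (intro exI[of _ G] exI[of _ E]) auto
  next
    case False
    \<comment> \<open>This covers large \<open>m\<close> and also \<open>r = 0\<close>; a vector
      without nonzero entries falls under the latter.\<close>
    have "r \<le> (4 + y) * (real m / real N) powr (1 / 20) * r"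
    proof (cases "r = 0")
      case r0: False
      have "m \<ge> 1"
      proof (rule ccontr)
        assume "\<not> m \<ge> 1"
        then have "m = 0" by simp
        then have "{n. n < N \<and> a n \<noteq> 0} = {}" unfolding m_def by (subst (asm) card_0_eq) auto
        then have "a n = 0" if "n < N" for n using that by auto
        then have "v = 0\<^sub>v N" by (auto simp: v_def intro!: eq_vecI)
        then show False using r0 by (simp add: r_def)
      qed
      with False r0 r have "real N < y * real m" by auto
      then have "1 / y \<le> real m / real N" using y N by (simp add: field_simps)
      moreover have "1 / y \<le> (1 / y) powr (1 / 20)"
        using y powr_mono'[of "1 / 20" 1 "1 / y"] by simp
      moreover have "(1 / y) powr (1 / 20) \<le> (real m / real N) powr (1 / 20)"
        using calculation(1) y by (intro powr_mono2) auto
      ultimately have "1 / y \<le> (real m / real N) powr (1 / 20)" by linarith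
      then have "(4 + y) * (1 / y) \<le> (4 + y) * (real m / real N) powr (1 / 20)"
        using y by (intro mult_left_mono) auto
      moreover have "1 \<le> (4 + y) * (1 / y)" using y by (simp add: field_simps)
      ultimately have "1 \<le> (4 + y) * (real m / real N) powr (1 / 20)" by linarith
      then have "1 * r \<le> (4 + y) * (real m / real N) powr (1 / 20) * r" using r by (intro mult_right_mono) auto
      then show ?thesis by simp
    qed simp
    then show ?thesis
      using lin_L2[OF b] norm by (intro exI[of _ "\<lambda>_. 0"] exI[of _ "lin b"]) (simp add: norm_Orlicz_zero)
  qed
  then show "\<exists>G E. G \<in> borel_measurable T \<and> E \<in> L2_functions T \<and>
      (\<forall>x\<in>space T. (\<Sum>n<N. a n * rotated_system N U \<phi> n x) = G x + E x) \<and>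
      norm_Orlicz T G \<le> ennreal ((4 + y) * norm_L2 T (\<lambda>x. \<Sum>n<N. a n * rotated_system N U \<phi> n x)) \<and>
      norm_L2 T E \<le> (4 + y) * (real (card {n. n < N \<and> a n \<noteq> 0}) / real N) powr (1 / 20) *
        norm_L2 T (\<lambda>x. \<Sum>n<N. a n * rotated_system N U \<phi> n x)"
    unfolding f norm m_def[symmetric] fun_cong[OF f] .
qed

end

text \<open>The first inequality, used with \<open>y = real N / real m\<close>, lets the tail
  exponent dominate the lattice count. The second, used with \<open>y = real N\<close>, pays for the
  union over all \<open>m\<close> by lowering the exponent from 4/5 to 2/5.\<close>

lemma exists_threshold:
  "\<exists>y\<^sub>0\<ge>2. \<forall>y\<ge>y\<^sub>0::real. 3 + 4 * y powr (1 / 10) * ln (2 * y) - y powr (4 / 5) / 256 \<le> - (y powr (4 / 5) / 512) \<and>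
     y * exp (- (y powr (4 / 5) / 512)) \<le> exp (- (y powr (2 / 5)))"
proof -
  have "eventually (\<lambda>y::real. 3 + 4 * y powr (1 / 10) * ln (2 * y) - y powr (4 / 5) / 256 \<le> - (y powr (4 / 5) / 512)) at_top"
    by real_asymp
  moreover have "eventually (\<lambda>y::real. y * exp (- (y powr (4 / 5) / 512)) \<le> exp (- (y powr (2 / 5)))) at_top"
    by real_asymp
  ultimately have "eventually (\<lambda>y::real. 3 + 4 * y powr (1 / 10) * ln (2 * y) - y powr (4 / 5) / 256 \<le> - (y powr (4 / 5) / 512) \<and>
     y * exp (- (y powr (4 / 5) / 512)) \<le> exp (- (y powr (2 / 5)))) at_top"
    by (rule eventually_conj)
  then obtain y\<^sub>1 where y\<^sub>1: "\<And>y::real. y \<ge> y\<^sub>1 \<Longrightarrow> 3 + 4 * y powr (1 / 10) * ln (2 * y) - y powr (4 / 5) / 256 \<le> - (y powr (4 / 5) / 512) \<and>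
     y * exp (- (y powr (4 / 5) / 512)) \<le> exp (- (y powr (2 / 5)))"
    unfolding eventually_at_top_linorder by blast
  show ?thesis by (rule exI[of _ "max 2 y\<^sub>1"]) (use y\<^sub>1 in simp)
qed

text \<open>With \<open>q = real N / real m\<close>, and \<open>N - 1\<close> replaced by
  \<open>N / 2\<close>, every term is bounded by \<open>m\<close> times a function of
  \<open>q\<close>. The threshold leaves \<open>- real m * q powr (4 / 5) / 512\<close>, and
  \<open>real m * q powr (4 / 5)\<close> is at least \<open>real N powr (4 / 5)\<close> because
  \<open>m \<ge> 1\<close>.\<close>

lemma exponent_le:
  fixes y\<^sub>0 :: real
  assumes y\<^sub>0: "y\<^sub>0 \<ge> 2" and y: "\<And>y. y \<ge> y\<^sub>0 \<Longrightarrow>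
      3 + 4 * y powr (1 / 10) * ln (2 * y) - y powr (4 / 5) / 256 \<le> - (y powr (4 / 5) / 512)"
    and m: "1 \<le> m" "y\<^sub>0 * real m \<le> real N"
  shows "4 * exp (ln (real N / real m) / 10) * real m * ln (2 * real N / real m) + 2 * real m + 1
       - (real N - 1) / (128 * (exp (ln (real N / real m) / 10))\<^sup>2) \<le> - (real N powr (4 / 5) / 512)"
proof -
  define q where "q = real N / real m"
  define M where "M = q powr (1 / 10)"
  have qy: "q \<ge> y\<^sub>0" using m by (simp add: q_def pos_le_divide_eq)
  then have q: "q > 0" using y\<^sub>0 by simp
  have qm: "q * real m = real N" using m by (simp add: q_def)
  have N: "real N \<ge> 2" using m y\<^sub>0 mult_mono[of 2 y\<^sub>0 1 "real m"] by simp
  have M: "exp (ln (real N / real m) / 10) = M" using q by (simp add: M_def q_def[symmetric] powr_def)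
  have M2: "M\<^sup>2 = q powr (1 / 5)" using q by (simp add: M_def power2_eq_square powr_add[symmetric])
  have "real N / (256 * M\<^sup>2) \<le> (real N - 1) / (128 * M\<^sup>2)"
    using N q by (simp add: M2 field_simps)
  moreover have "real N / (256 * M\<^sup>2) = real m * (q powr (4 / 5) / 256)"
  proof -
    have "q powr (4 / 5) * q powr (1 / 5) = q" using q by (simp add: powr_add[symmetric])
    then have "q / q powr (1 / 5) = q powr (4 / 5)" using q by (simp add: field_simps)
    moreover have "q * real m / (256 * q powr (1 / 5)) = real m * (q / q powr (1 / 5) / 256)"
      by (simp add: mult_ac)
    ultimately show ?thesis unfolding M2 qm[symmetric] by simp
  qed
  ultimately have "real m * (q powr (4 / 5) / 256) \<le> (real N - 1) / (128 * M\<^sup>2)" by (simp only:)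
  moreover have "2 * real N / real m = 2 * q" by (simp add: q_def)
  moreover have "1 \<le> real m" using m by simp
  ultimately have "4 * M * real m * ln (2 * real N / real m) + 2 * real m + 1 - (real N - 1) / (128 * M\<^sup>2)
      \<le> 4 * M * real m * ln (2 * q) + 2 * real m + real m - real m * (q powr (4 / 5) / 256)"
    by (simp only:)
  also have "\<dots> = real m * (3 + 4 * q powr (1 / 10) * ln (2 * q) - q powr (4 / 5) / 256)"
    by (simp add: M_def algebra_simps)
  also have "\<dots> \<le> real m * (- (q powr (4 / 5) / 512))"
    by (intro mult_left_mono y qy) simp
  also have "\<dots> \<le> - (real N powr (4 / 5) / 512)"
  proof -
    have "real N powr (4 / 5) = q powr (4 / 5) * real m powr (4 / 5)"
      unfolding qm[symmetric] using q by (simp add: powr_mult)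
    also have "\<dots> \<le> q powr (4 / 5) * real m powr 1"
      using m by (intro mult_left_mono powr_mono) auto
    finally show ?thesis using m by (simp add: mult.commute)
  qed
  finally show ?thesis unfolding M .
qed

text \<open>The truncation level depends on \<open>m\<close>, so each sparsity level has its own
  event. At most \<open>N\<close> of them are intersected, each failing with probability at most
  \<open>\<delta>\<close>.\<close>

lemma admissible_constants_exist:
  "\<exists>A>0. \<exists>C>0. \<exists>c>0. \<exists>c\<^sub>1>0. admissible_constants TYPE('a) A C c c\<^sub>1"
proof -
  obtain y\<^sub>0 :: real where y\<^sub>0: "y\<^sub>0 \<ge> 2"
    and exponent: "\<And>y. y \<ge> y\<^sub>0 \<Longrightarrow>
      3 + 4 * y powr (1 / 10) * ln (2 * y) - y powr (4 / 5) / 256 \<le> - (y powr (4 / 5) / 512)"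
    and union: "\<And>y. y \<ge> y\<^sub>0 \<Longrightarrow> y * exp (- (y powr (4 / 5) / 512)) \<le> exp (- (y powr (2 / 5)))"
    using exists_threshold by blast
  have "\<exists>Q\<in>sets \<mu>. measure \<mu> Q \<ge> 1 - 1 * exp (- 1 * real N powr (2 / 5)) \<and>
      (\<forall>U\<in>Q. orthonormal_system T N (rotated_system N U \<phi>) \<and>
        decomposition_property (4 + y\<^sub>0) (1 / 20) T N (rotated_system N U \<phi>))"
    if N: "N \<ge> 1" and haar: "normalized_haar N \<mu>" and T: "prob_space T" and ortho: "orthonormal_system T N \<phi>"
      and sq: "\<forall>x\<in>space T. (\<Sum>n<N. \<bar>\<phi> n x\<bar>\<^sup>2) \<le> real N" for N \<mu> and T :: "'a measure" and \<phi>
  proof -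
    interpret haar N \<mu> using haar by unfold_locales
    interpret bounded_system T N \<phi>
      using T ortho sq by (intro bounded_system.intro bounded_system_axioms.intro) auto
    \<comment> \<open>The levels that require an event; at all others \<open>E = f\<close> is taken.
      For \<open>N\<close> below \<open>y\<^sub>0\<close> the set is empty, and the event is the
      whole group.\<close>
    define I where "I = {m. 1 \<le> m \<and> y\<^sub>0 * real m \<le> real N}"
    define good where "good m U \<longleftrightarrow> (\<forall>a\<in>carrier_vec N. scalar_prod a a = 1 \<longrightarrow>
        card {i. i < N \<and> (a :: real vec) $ i \<noteq> 0} \<le> m \<longrightarrow> energy (ln (real N / real m) / 10) (U *\<^sub>v a) \<le> 1)"
      for m U
    define \<delta> where "\<delta> = exp (- (real N powr (4 / 5) / 512))"
    have IN: "m \<le> N" if "m \<in> I" for m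
    proof -
      have "1 * real m \<le> y\<^sub>0 * real m" using y\<^sub>0 by (intro mult_right_mono) auto
      moreover have "y\<^sub>0 * real m \<le> real N" using that by (simp add: I_def)
      ultimately have "real m \<le> real N" by linarith
      then show ?thesis by simp
    qed
    have "I \<subseteq> {1..N}"
    proof
      fix m assume "m \<in> I"
      then show "m \<in> {1..N}" using IN[of m] by (simp add: I_def)
    qed
    then have I: "finite I" "card I \<le> N"
      using card_mono[of "{1..N}" I] by (auto intro: finite_subset)
    have "\<exists>Q\<in>sets \<mu>. prob (space \<mu> - Q) \<le> \<delta> \<and> (\<forall>U\<in>Q. good m U)"
      if m: "m \<in> I" for m
    proof -
      \<comment> \<open>A level in \<open>I\<close> forces \<open>N \<ge> 2\<close>, as required for
        the random signed columns.\<close>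
      have "y\<^sub>0 * 1 \<le> y\<^sub>0 * real m" using m y\<^sub>0 by (intro mult_left_mono) (auto simp: I_def)
      moreover have "y\<^sub>0 * real m \<le> real N" using m by (simp add: I_def)
      ultimately have "2 \<le> real N" using y\<^sub>0 by linarith
      then have N2: "N \<ge> 2" by simp
      interpret rotated_bounded_system T N \<phi> \<mu> "ln (real N / real m) / 10"
        using N2 IN[OF m] m by unfold_locales (auto simp: I_def)
      obtain Q where "Q \<in> sets \<mu>" and Q: "prob (space \<mu> - Q) \<le>
          exp (4 * exp (ln (real N / real m) / 10) * real m * ln (2 * real N / real m) + 2 * real m + 1
            - (real N - 1) / (128 * (exp (ln (real N / real m) / 10))\<^sup>2))"
        "\<forall>U\<in>Q. good m U"
        using sparse_energy_event[of m] m IN[OF m] unfolding I_def good_def by blast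
      moreover have "exp (4 * exp (ln (real N / real m) / 10) * real m * ln (2 * real N / real m) + 2 * real m + 1
            - (real N - 1) / (128 * (exp (ln (real N / real m) / 10))\<^sup>2)) \<le> \<delta>"
        unfolding \<delta>_def exp_le_cancel_iff using m by (intro exponent_le[OF y\<^sub>0 exponent]) (auto simp: I_def)
      ultimately show ?thesis by (intro bexI[of _ Q]) auto
    qed
    then have "\<forall>m\<in>I. \<exists>Q. Q \<in> sets \<mu> \<and> prob (space \<mu> - Q) \<le> \<delta> \<and> (\<forall>U\<in>Q. good m U)" by blast
    from bchoice[OF this] obtain Q
      where "\<forall>m\<in>I. Q m \<in> sets \<mu> \<and> prob (space \<mu> - Q m) \<le> \<delta> \<and> (\<forall>U\<in>Q m. good m U)" ..
    then have Q: "\<And>m. m \<in> I \<Longrightarrow> Q m \<in> sets \<mu>" "\<And>m. m \<in> I \<Longrightarrow> prob (space \<mu> - Q m) \<le> \<delta>"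
      "\<And>m U. m \<in> I \<Longrightarrow> U \<in> Q m \<Longrightarrow> good m U"
      by simp_all
    define bad where "bad = (\<Union>m\<in>I. space \<mu> - Q m)"
    have bad: "bad \<in> sets \<mu>" unfolding bad_def by (intro sets.finite_UN sets.Diff sets.top I(1) Q(1))
    have "prob bad \<le> exp (- (real N powr (2 / 5)))"
    proof (cases "I = {}")
      case False
      then obtain m where "m \<in> I" by blast
      then have "y\<^sub>0 * 1 \<le> y\<^sub>0 * real m" "y\<^sub>0 * real m \<le> real N"
        using y\<^sub>0 by (auto simp: I_def)
      then have yN: "real N \<ge> y\<^sub>0" by linarith
      have "prob bad \<le> (\<Sum>m\<in>I. prob (space \<mu> - Q m))"
        unfolding bad_def using I Q(1) by (intro finite_measure_subadditive_finite) auto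
      also have "\<dots> \<le> (\<Sum>m\<in>I. \<delta>)" by (intro sum_mono Q)
      also have "\<dots> \<le> real N * \<delta>" using I by (simp add: \<delta>_def)
      also have "\<dots> \<le> exp (- (real N powr (2 / 5)))" unfolding \<delta>_def by (rule union[OF yN])
      finally show ?thesis .
    qed (simp add: bad_def)
    then have "prob (space \<mu> - bad) \<ge> 1 - 1 * exp (- 1 * real N powr (2 / 5))"
      using prob_compl[OF bad] by simp
    moreover have "orthonormal_system T N (rotated_system N U \<phi>) \<and>
        decomposition_property (4 + y\<^sub>0) (1 / 20) T N (rotated_system N U \<phi>)" if U: "U \<in> space \<mu> - bad" for U
    proof -
      have O: "U \<in> orthogonal_group N" using U by (simp add: space_haar)
      have "energy (ln (real N / real m) / 10) (U *\<^sub>v a) \<le> 1"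
        if "1 \<le> m" "y\<^sub>0 * real m \<le> real N" "a \<in> carrier_vec N" "scalar_prod a a = 1"
          "card {i. i < N \<and> a $ i \<noteq> 0} \<le> m" for m and a :: "real vec"
      proof -
        have m: "m \<in> I" using that by (simp add: I_def)
        then have "good m U" using U by (intro Q(3)) (auto simp: bad_def)
        then show ?thesis using that unfolding good_def by blast
      qed
      then show ?thesis
        using orthonormal_rotated_system[OF O] decomposition_property_rotated_system[OF O N, of y\<^sub>0] y\<^sub>0 by simp
    qed
    ultimately show ?thesis using bad by (intro bexI[of _ "space \<mu> - bad"]) auto
  qed
  then have "admissible_constants TYPE('a) (4 + y\<^sub>0) 1 (1 / 20) 1"
    unfolding admissible_constants_def by blast
  then show ?thesis using y\<^sub>0
    by (intro exI[of _ "4 + y\<^sub>0"] exI[of _ "1 :: real"] exI[of _ "1 / 20 :: real"] conjI) auto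
qed

text \<open>
  The map \<open>x \<mapsto> (\<phi> n x)\<^sub>n\<close> transports \<open>T\<close> to \<open>nat \<Rightarrow> real\<close>, where the system becomes that of the
  coordinates. These are set to zero where the sum of their squares exceeds \<open>N\<close>.
\<close>

lemma admissible_constants_transfer:
  assumes adm: "admissible_constants TYPE(nat \<Rightarrow> real) A C c c\<^sub>1"
  shows "admissible_constants TYPE('a) A C c c\<^sub>1"
  unfolding admissible_constants_def
proof (intro allI impI)
  fix N \<mu> and T :: "'a measure" and \<phi> :: "nat \<Rightarrow> 'a \<Rightarrow> real"
  assume N: "1 \<le> N" and haar: "normalized_haar N \<mu>" and T: "prob_space T" and ortho: "orthonormal_system T N \<phi>"
    and sq: "\<forall>x\<in>space T. (\<Sum>n<N. \<bar>\<phi> n x\<bar>\<^sup>2) \<le> real N"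
  interpret T: prob_space T by (rule T)
  let ?P = "PiM UNIV (\<lambda>_. borel) :: (nat \<Rightarrow> real) measure"
  \<comment> \<open>Beyond index \<open>N\<close> nothing is known about the measurability of
    \<open>\<phi> n\<close>, so these coordinates are set to 0.\<close>
  define coords where "coords x = (\<lambda>n. if n < N then \<phi> n x else 0)" for x
  define T' where "T' = distr T ?P coords"
  \<comment> \<open>The space of \<open>T'\<close> is all of \<open>nat \<Rightarrow> real\<close>,
    so the pointwise bound has to hold outside the range of \<open>coords\<close> too.\<close>
  define \<phi>' where "\<phi>' n y = (if (\<Sum>k<N. \<bar>y k\<bar>\<^sup>2) \<le> real N then y n else 0)" for n and y :: "nat \<Rightarrow> real"
  have phi_meas: "\<phi> n \<in> borel_measurable T" if "n < N" for n
    using ortho that by (auto simp: orthonormal_system_def L2_functions_def)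
  have chi [measurable]: "coords \<in> measurable T ?P"
    unfolding coords_def
  proof (rule measurable_PiM_single')
    show "(\<lambda>x. if n < N then \<phi> n x else 0) \<in> borel_measurable T" for n
      using phi_meas by (cases "n < N") auto
  qed auto
  have phi'_meas [measurable]: "\<phi>' n \<in> borel_measurable ?P" for n
    unfolding \<phi>'_def by measurable
  have phi'_chi: "\<phi>' n (coords x) = \<phi> n x" if "x \<in> space T" "n < N" for n x
  proof -
    have "(\<Sum>k<N. \<bar>coords x k\<bar>\<^sup>2) = (\<Sum>k<N. \<bar>\<phi> k x\<bar>\<^sup>2)" by (intro sum.cong) (auto simp: coords_def)
    then have "(\<Sum>k<N. \<bar>coords x k\<bar>\<^sup>2) \<le> real N" using bspec[OF sq that(1)] by (simp only:)
    then have "\<phi>' n (coords x) = coords x n" unfolding \<phi>'_def by (rule if_P)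
    then show ?thesis using that(2) by (simp add: coords_def)
  qed
  have T': "prob_space T'" unfolding T'_def by (rule T.prob_space_distr[OF chi])
  have meas_T': "borel_measurable T' = borel_measurable ?P" by (simp add: T'_def measurable_def)
  have int: "(\<integral>y. g y \<partial>T') = (\<integral>x. g (coords x) \<partial>T)" if "g \<in> borel_measurable ?P" for g :: "_ \<Rightarrow> real"
    unfolding T'_def by (rule integral_distr[OF chi that])
  have integrable: "integrable T' g \<longleftrightarrow> integrable T (\<lambda>x. g (coords x))" if "g \<in> borel_measurable ?P" for g :: "_ \<Rightarrow> real"
    unfolding T'_def by (rule integrable_distr_eq[OF chi that])
  have L2: "(\<lambda>x. g (coords x)) \<in> L2_functions T \<longleftrightarrow> g \<in> L2_functions T'" if [measurable]: "g \<in> borel_measurable ?P" for g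
  proof -
    have "(\<lambda>y. \<bar>g y\<bar>\<^sup>2) \<in> borel_measurable ?P" by measurable
    then show ?thesis using integrable[of "\<lambda>y. \<bar>g y\<bar>\<^sup>2"] measurable_compose[OF chi that]
      by (simp add: L2_functions_def meas_T' that)
  qed
  have norm2: "norm_L2 T' g = norm_L2 T (\<lambda>x. g (coords x))" if [measurable]: "g \<in> borel_measurable ?P" for g
    unfolding norm_L2_def by (subst int) auto
  have Orlicz: "norm_Orlicz T' g = norm_Orlicz T (\<lambda>x. g (coords x))" if [measurable]: "g \<in> borel_measurable ?P" for g
  proof -
    have "(\<integral>\<^sup>+y. ennreal (exp (\<bar>g y / l\<bar>\<^sup>2) - 1) \<partial>T') = (\<integral>\<^sup>+x. ennreal (exp (\<bar>g (coords x) / l\<bar>\<^sup>2) - 1) \<partial>T)" for l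
      unfolding T'_def by (subst nn_integral_distr[OF chi]) auto
    then show ?thesis by (simp add: norm_Orlicz_def)
  qed
  have ortho': "orthonormal_system T' N \<phi>'"
    unfolding orthonormal_system_def
  proof (intro conjI allI impI)
    fix n assume n: "n < N"
    have "(\<lambda>x. \<phi>' n (coords x)) \<in> L2_functions T \<longleftrightarrow> \<phi> n \<in> L2_functions T"
      using phi'_chi n unfolding L2_functions_def
      by (auto cong: measurable_cong Bochner_Integration.integrable_cong)
    then show "\<phi>' n \<in> L2_functions T'"
      using ortho n by (simp add: L2[OF phi'_meas, symmetric] orthonormal_system_def)
  next
    fix i j assume ij: "i < N" "j < N"
    have "(\<integral>y. \<phi>' i y * \<phi>' j y \<partial>T') = (\<integral>x. \<phi>' i (coords x) * \<phi>' j (coords x) \<partial>T)"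
      by (rule int) measurable
    also have "\<dots> = (\<integral>x. \<phi> i x * \<phi> j x \<partial>T)"
      using ij phi'_chi by (intro Bochner_Integration.integral_cong) auto
    finally show "(\<integral>y. \<phi>' i y * \<phi>' j y \<partial>T') = (if i = j then 1 else 0)"
      using ortho ij by (simp add: orthonormal_system_def)
  qed
  have sq': "(\<Sum>n<N. \<bar>\<phi>' n y\<bar>\<^sup>2) \<le> real N" for y
  proof (cases "(\<Sum>k<N. \<bar>y k\<bar>\<^sup>2) \<le> real N")
    case True
    then show ?thesis unfolding \<phi>'_def by (simp only: if_True)
  next
    case False
    then show ?thesis unfolding \<phi>'_def by (simp only: if_False) simp
  qed
  have "\<exists>Q\<in>sets \<mu>. measure \<mu> Q \<ge> 1 - C * exp (- c\<^sub>1 * real N powr (2 / 5)) \<and>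
      (\<forall>U\<in>Q. orthonormal_system T' N (rotated_system N U \<phi>') \<and>
        decomposition_property A c T' N (rotated_system N U \<phi>'))"
    by (rule adm[unfolded admissible_constants_def, rule_format, OF N haar T' ortho']) (rule sq')
  then obtain Q where Q: "Q \<in> sets \<mu>" "measure \<mu> Q \<ge> 1 - C * exp (- c\<^sub>1 * real N powr (2 / 5))"
    "\<forall>U\<in>Q. orthonormal_system T' N (rotated_system N U \<phi>') \<and>
      decomposition_property A c T' N (rotated_system N U \<phi>')"
    by (elim bexE conjE)
  have "orthonormal_system T N (rotated_system N U \<phi>) \<and> decomposition_property A c T N (rotated_system N U \<phi>)"
    if U: "U \<in> Q" for U
  proof
    have "U \<in> space \<mu>" using sets.sets_into_space[OF Q(1)] U by blast
    then have O: "U \<in> orthogonal_group N" using haar.space_haar[OF haar.intro[OF haar]] by simp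
    interpret bounded_system T N \<phi>
      using T ortho sq by (intro bounded_system.intro bounded_system_axioms.intro) auto
    show "orthonormal_system T N (rotated_system N U \<phi>)" by (rule orthonormal_rotated_system[OF O])
    show "decomposition_property A c T N (rotated_system N U \<phi>)"
      unfolding decomposition_property_def Let_def
    proof
      fix a :: "nat \<Rightarrow> real"
      define f where "f x = (\<Sum>n<N. a n * rotated_system N U \<phi> n x)" for x
      define f' where "f' y = (\<Sum>n<N. a n * rotated_system N U \<phi>' n y)" for y
      have f'_meas [measurable]: "f' \<in> borel_measurable ?P" unfolding f'_def rotated_system_def by measurable
      have ff': "f' (coords x) = f x" if "x \<in> space T" for x
        using that by (simp add: f_def f'_def rotated_system_def phi'_chi)
      have "norm_L2 T' f' = norm_L2 T (\<lambda>x. f' (coords x))" by (rule norm2[OF f'_meas])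
      also have "\<dots> = norm_L2 T f"
        unfolding norm_L2_def by (intro arg_cong[where f = sqrt] Bochner_Integration.integral_cong refl) (simp only: ff')
      finally have norm: "norm_L2 T' f' = norm_L2 T f" .
      have "decomposition_property A c T' N (rotated_system N U \<phi>')" using Q(3) U by blast
      from spec[OF this[unfolded decomposition_property_def Let_def], of a]
      obtain G E where GE: "G \<in> borel_measurable T'" "E \<in> L2_functions T'" "\<forall>y\<in>space T'. f' y = G y + E y"
        "norm_Orlicz T' G \<le> ennreal (A * norm_L2 T' f')"
        "norm_L2 T' E \<le> A * (real (card {n. n < N \<and> a n \<noteq> 0}) / real N) powr c * norm_L2 T' f'"
        unfolding f'_def[symmetric] by (elim exE conjE)
      have G: "G \<in> borel_measurable ?P" and E: "E \<in> borel_measurable ?P"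
        using GE(1,2) by (auto simp: meas_T' L2_functions_def)
      have "\<forall>x\<in>space T. f x = G (coords x) + E (coords x)"
        using GE(3) ff' measurable_space[OF chi] by (auto simp: T'_def)
      moreover have "(\<lambda>x. G (coords x)) \<in> borel_measurable T" by (rule measurable_compose[OF chi G])
      moreover have "(\<lambda>x. E (coords x)) \<in> L2_functions T" using L2[OF E] GE(2) by simp
      ultimately show "\<exists>G E. G \<in> borel_measurable T \<and> E \<in> L2_functions T \<and>
          (\<forall>x\<in>space T. (\<Sum>n<N. a n * rotated_system N U \<phi> n x) = G x + E x) \<and>
          norm_Orlicz T G \<le> ennreal (A * norm_L2 T (\<lambda>x. \<Sum>n<N. a n * rotated_system N U \<phi> n x)) \<and>
          norm_L2 T E \<le> A * (real (card {n. n < N \<and> a n \<noteq> 0}) / real N) powr c *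
            norm_L2 T (\<lambda>x. \<Sum>n<N. a n * rotated_system N U \<phi> n x)"
        unfolding f_def[symmetric] using GE(4,5)
        by (intro exI[of _ "\<lambda>x. G (coords x)"] exI[of _ "\<lambda>x. E (coords x)"]) (simp add: norm Orlicz[OF G] norm2[OF E])
    qed
  qed
  then show "\<exists>Q\<in>sets \<mu>. measure \<mu> Q \<ge> 1 - C * exp (- c\<^sub>1 * real N powr (2 / 5)) \<and>
      (\<forall>U\<in>Q. orthonormal_system T N (rotated_system N U \<phi>) \<and> decomposition_property A c T N (rotated_system N U \<phi>))"
    using Q(1,2) by (intro bexI[of _ Q] conjI ballI) auto
qed

theorem proposition3:
  shows "(\<exists>A>0. \<exists>C>0. \<exists>c>0. \<exists>c\<^sub>1>0. admissible_constants TYPE(nat \<Rightarrow> real) A C c c\<^sub>1) \<and>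
         (\<forall>A>0. \<forall>C>0. \<forall>c>0. \<forall>c\<^sub>1>0.
            admissible_constants TYPE(nat \<Rightarrow> real) A C c c\<^sub>1 \<longrightarrow>
            admissible_constants TYPE('a) A C c c\<^sub>1)"
  by (intro conjI allI impI admissible_constants_exist) (rule admissible_constants_transfer)

end
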